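(* Let $G$ and $H$ be discrete groups, let $p\in[1,\infty)\setminus\{2\}$, and let $\varphi\colon F^p_\lambda(G)\to F^p_\lambda(H)$ be a unital, contractive homomorphism. Then: (1) There exist group homomorphisms $\theta\colon G\to H$ and $\gamma\colon G\to S^1$ such that $\varphi(\mathrm{Lt}^G_g)=\gamma(g)\,\mathrm{Lt}^H_{\theta(g)}$ for all $g\in G$. (2) If $p>1$, then the kernel of $\theta$ is amenable. (3) The following are equivalent: $\theta$ is injective; $\varphi$ is injective; $\varphi$ is isometric. In particular, for discrete groups $G$ and $H$ and $p\in[1,\infty)\setminus\{2\}$, there is an isometric isomorphism $F^p_\lambda(G)\to F^p_\lambda(H)$ if and only if $G\cong H$.
   Context: For a discrete group $G$ and $p\in[1,\infty)$, let $\lambda_p\colon \ell^1(G)\to\mathcal{B}(\ell^p(G))$ be the left regular representation $\lambda_p(f)\xi=f\ast\xi$, where $(f\ast\xi)(s)=\sum_{t\in G}f(t)\xi(t^{-1}s)$. The algebra of $p$-pseudofunctions (reduced group $L^p$-operator algebra) is $F^p_\lambda(G)=\overline{\lambda_p(\ell^1(G))}^{\|\cdot\|}\subseteq\mathcal{B}(\ell^p(G))$, a unital Banach algebra with the operator norm. For $g\in G$, $\mathrm{Lt}^G_g\in\mathcal{B}(\ell^p(G))$ is the invertible isometry $\mathrm{Lt}^G_g(\xi)(t)=\xi(g^{-1}t)$ for $\xi\in\ell^p(G)$, $t\in G$; one has $\mathrm{Lt}^G_g=\lambda_p(\delta_g)\in F^p_\lambda(G)$. Homomorphisms of Banach algebras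 are complex-linear and multiplicative; contractive means of norm at most $1$. $S^1$ is the multiplicative group of complex numbers of modulus one. *)

theory Defs
  imports "HOL-Analysis.Analysis" "HOL-Algebra.Coset"
begin

text \<open>
  Vectors of \<open>\<ell>\<^sup>p(A)\<close> are functions on the whole type that vanish off \<open>A\<close>, and
  operators on \<open>\<ell>\<^sup>p(A)\<close> are functions that are \<open>0\<close> off \<open>\<ell>\<^sup>p(A)\<close>. Under these two
  conventions HOL equality is equality of vectors and of operators, the linear
  structure on both is pointwise, and the product of operators is \<open>(\<circ>)\<close>.
\<close>

definition lp :: "real \<Rightarrow> 'a set \<Rightarrow> ('a \<Rightarrow> complex) set" where
  "lp p A = {\<xi>. (\<forall>t. t \<notin> A \<longrightarrow> \<xi> t = 0) \<and> (\<lambda>t. cmod (\<xi> t) powr p) summable_on A}"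

definition lp_norm :: "real \<Rightarrow> 'a set \<Rightarrow> ('a \<Rightarrow> complex) \<Rightarrow> real" where
  "lp_norm p A \<xi> = (\<Sum>\<^sub>\<infinity>t\<in>A. cmod (\<xi> t) powr p) powr (1 / p)"

type_synonym 'a lp_operator = "('a \<Rightarrow> complex) \<Rightarrow> ('a \<Rightarrow> complex)"

definition bounded_operators :: "real \<Rightarrow> 'a set \<Rightarrow> 'a lp_operator set" where
  "bounded_operators p A = {T.
     (\<forall>\<xi>. \<xi> \<notin> lp p A \<longrightarrow> T \<xi> = (\<lambda>t. 0)) \<and>
     (\<forall>\<xi>\<in>lp p A. T \<xi> \<in> lp p A) \<and>
     (\<forall>\<xi>\<in>lp p A. \<forall>\<eta>\<in>lp p A. T (\<lambda>t. \<xi> t + \<eta> t) = (\<lambda>t. T \<xi> t + T \<eta> t)) \<and>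
     (\<forall>c. \<forall>\<xi>\<in>lp p A. T (\<lambda>t. c * \<xi> t) = (\<lambda>t. c * T \<xi> t)) \<and>
     (\<exists>C. \<forall>\<xi>\<in>lp p A. lp_norm p A (T \<xi>) \<le> C * lp_norm p A \<xi>)}"

definition op_norm :: "real \<Rightarrow> 'a set \<Rightarrow> 'a lp_operator \<Rightarrow> real" where
  "op_norm p A T = Sup {lp_norm p A (T \<xi>) | \<xi>. \<xi> \<in> lp p A \<and> lp_norm p A \<xi> \<le> 1}"

definition id_operator :: "real \<Rightarrow> 'a set \<Rightarrow> 'a lp_operator" where
  "id_operator p A = (\<lambda>\<xi>. if \<xi> \<in> lp p A then \<xi> else (\<lambda>t. 0))"

definition left_translate ::
    "('a, 'm) monoid_scheme \<Rightarrow> 'a \<Rightarrow> ('a \<Rightarrow> 'b::zero) \<Rightarrow> 'a \<Rightarrow> 'b" where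
  "left_translate G g f = (\<lambda>t. if t \<in> carrier G then f (inv\<^bsub>G\<^esub> g \<otimes>\<^bsub>G\<^esub> t) else 0)"

definition Lt :: "real \<Rightarrow> ('a, 'm) monoid_scheme \<Rightarrow> 'a \<Rightarrow> 'a lp_operator" where
  "Lt p G g = (\<lambda>\<xi>. if \<xi> \<in> lp p (carrier G) then left_translate G g \<xi> else (\<lambda>t. 0))"

definition convolution ::
    "('a, 'm) monoid_scheme \<Rightarrow> ('a \<Rightarrow> complex) \<Rightarrow> ('a \<Rightarrow> complex) \<Rightarrow> 'a \<Rightarrow> complex" where
  "convolution G f \<xi> = (\<lambda>s. if s \<in> carrier G
     then \<Sum>\<^sub>\<infinity>t\<in>carrier G. f t * \<xi> (inv\<^bsub>G\<^esub> t \<otimes>\<^bsub>G\<^esub> s) else 0)"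

definition lambda_p ::
    "real \<Rightarrow> ('a, 'm) monoid_scheme \<Rightarrow> ('a \<Rightarrow> complex) \<Rightarrow> 'a lp_operator" where
  "lambda_p p G f = (\<lambda>\<xi>. if \<xi> \<in> lp p (carrier G) then convolution G f \<xi> else (\<lambda>t. 0))"

definition pseudofunctions ::
    "real \<Rightarrow> ('a, 'm) monoid_scheme \<Rightarrow> 'a lp_operator set" where
  "pseudofunctions p G = {T \<in> bounded_operators p (carrier G).
     \<forall>\<epsilon>>0. \<exists>f \<in> lp 1 (carrier G).
       op_norm p (carrier G) (\<lambda>\<xi> t. T \<xi> t - lambda_p p G f \<xi> t) < \<epsilon>}"

text \<open>The values of a homomorphism outside \<open>pseudofunctions p G\<close> are irrelevant.\<close>

definition pf_hom :: "real \<Rightarrow> ('a, 'm) monoid_scheme \<Rightarrow> ('b, 'n) monoid_scheme \<Rightarrow>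
    ('a lp_operator \<Rightarrow> 'b lp_operator) \<Rightarrow> bool" where
  "pf_hom p G H \<phi> \<longleftrightarrow>
     (\<forall>S\<in>pseudofunctions p G. \<phi> S \<in> pseudofunctions p H) \<and>
     (\<forall>S\<in>pseudofunctions p G. \<forall>T\<in>pseudofunctions p G.
        \<phi> (\<lambda>\<xi> t. S \<xi> t + T \<xi> t) = (\<lambda>\<xi> t. \<phi> S \<xi> t + \<phi> T \<xi> t)) \<and>
     (\<forall>c. \<forall>S\<in>pseudofunctions p G.
        \<phi> (\<lambda>\<xi> t. c * S \<xi> t) = (\<lambda>\<xi> t. c * \<phi> S \<xi> t)) \<and>
     (\<forall>S\<in>pseudofunctions p G. \<forall>T\<in>pseudofunctions p G. \<phi> (S \<circ> T) = \<phi> S \<circ> \<phi> T)"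

definition pf_unital :: "real \<Rightarrow> ('a, 'm) monoid_scheme \<Rightarrow> ('b, 'n) monoid_scheme \<Rightarrow>
    ('a lp_operator \<Rightarrow> 'b lp_operator) \<Rightarrow> bool" where
  "pf_unital p G H \<phi> \<longleftrightarrow>
     \<phi> (id_operator p (carrier G)) = id_operator p (carrier H)"

definition pf_contractive :: "real \<Rightarrow> ('a, 'm) monoid_scheme \<Rightarrow> ('b, 'n) monoid_scheme \<Rightarrow>
    ('a lp_operator \<Rightarrow> 'b lp_operator) \<Rightarrow> bool" where
  "pf_contractive p G H \<phi> \<longleftrightarrow>
     (\<forall>S\<in>pseudofunctions p G. op_norm p (carrier H) (\<phi> S) \<le> op_norm p (carrier G) S)"

definition pf_isometric :: "real \<Rightarrow> ('a, 'm) monoid_scheme \<Rightarrow> ('b, 'n) monoid_scheme \<Rightarrow>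
    ('a lp_operator \<Rightarrow> 'b lp_operator) \<Rightarrow> bool" where
  "pf_isometric p G H \<phi> \<longleftrightarrow>
     (\<forall>S\<in>pseudofunctions p G. op_norm p (carrier H) (\<phi> S) = op_norm p (carrier G) S)"

definition pf_isometric_iso :: "real \<Rightarrow> ('a, 'm) monoid_scheme \<Rightarrow> ('b, 'n) monoid_scheme \<Rightarrow>
    ('a lp_operator \<Rightarrow> 'b lp_operator) \<Rightarrow> bool" where
  "pf_isometric_iso p G H \<phi> \<longleftrightarrow>
     pf_hom p G H \<phi> \<and> pf_isometric p G H \<phi> \<and>
     bij_betw \<phi> (pseudofunctions p G) (pseudofunctions p H)"

definition circle_group :: "complex monoid" where
  "circle_group = \<lparr>carrier = {z. cmod z = 1}, monoid.mult = (*), one = 1\<rparr>"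

text \<open>Real-valued \<open>\<ell>\<^sup>\<infinity>(A)\<close>, again as functions that vanish off \<open>A\<close>.\<close>

definition linfty :: "'a set \<Rightarrow> ('a \<Rightarrow> real) set" where
  "linfty A = {f. (\<forall>t. t \<notin> A \<longrightarrow> f t = 0) \<and> bounded (f ` A)}"

text \<open>Amenability of a discrete group: there is a left-invariant mean on \<open>\<ell>\<^sup>\<infinity>(G)\<close>.\<close>

definition amenable :: "('a, 'm) monoid_scheme \<Rightarrow> bool" where
  "amenable G \<longleftrightarrow> (\<exists>m :: ('a \<Rightarrow> real) \<Rightarrow> real.
     (\<forall>f\<in>linfty (carrier G). \<forall>h\<in>linfty (carrier G). m (\<lambda>t. f t + h t) = m f + m h) \<and>
     (\<forall>c. \<forall>f\<in>linfty (carrier G). m (\<lambda>t. c * f t) = c * m f) \<and>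
     (\<forall>f\<in>linfty (carrier G). (\<forall>t\<in>carrier G. 0 \<le> f t) \<longrightarrow> 0 \<le> m f) \<and>
     m (indicator (carrier G)) = 1 \<and>
     (\<forall>g\<in>carrier G. \<forall>f\<in>linfty (carrier G). m (left_translate G g f) = m f))"

text \<open>Consistency of the two descriptions of the translation operators.\<close>

lemma Lt_eq_lambda_p:
  assumes "g \<in> carrier G"
  shows "Lt p G g = lambda_p p G (\<lambda>t. if t = g then 1 else 0)"
proof -
  have "(\<Sum>\<^sub>\<infinity>t\<in>carrier G. (if t = g then 1 else 0) * \<xi> (inv\<^bsub>G\<^esub> t \<otimes>\<^bsub>G\<^esub> s))
      = \<xi> (inv\<^bsub>G\<^esub> g \<otimes>\<^bsub>G\<^esub> s)" for \<xi> :: "'a \<Rightarrow> complex" and s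
  proof -
    have "(\<Sum>\<^sub>\<infinity>t\<in>carrier G. (if t = g then 1 else 0) * \<xi> (inv\<^bsub>G\<^esub> t \<otimes>\<^bsub>G\<^esub> s))
        = (\<Sum>\<^sub>\<infinity>t\<in>{g}. (if t = g then 1 else 0) * \<xi> (inv\<^bsub>G\<^esub> t \<otimes>\<^bsub>G\<^esub> s))"
      by (rule infsum_cong_neutral) (use assms in auto)
    then show ?thesis by simp
  qed
  then show ?thesis
    by (auto simp: Lt_def lambda_p_def left_translate_def convolution_def fun_eq_iff)
qed

end

theory Submission
  imports Defs
begin

text \<open>
  Why the theorem holds. For \<open>p \<noteq> 2\<close> the norm of \<open>\<ell>\<^sup>p\<close> knows which vectors have disjoint supports:
  by Clarkson's inequality this is the equality case of
  \<open>\<parallel>\<xi> + \<eta>\<parallel>\<^sup>p + \<parallel>\<xi> - \<eta>\<parallel>\<^sup>p = 2 (\<parallel>\<xi>\<parallel>\<^sup>p + \<parallel>\<eta>\<parallel>\<^sup>p)\<close> (\<open>Clarkson_identity\<close>). A surjective linear isometry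
  therefore permutes the unit vectors up to unimodular factors (\<open>Lamperti_atom\<close>). Pseudofunctions
  commute with right translations, so they are determined by their value at the unit vector of the
  identity, and an invertible isometry among them is a unimodular multiple of a left translation
  (\<open>invertible_isometry_pseudofunction\<close>). A unital contractive homomorphism \<open>\<phi>\<close> sends each translation
  to such an operator; comparing products gives the homomorphisms \<open>\<theta>\<close> and \<open>\<gamma>\<close> (\<open>induced_homs\<close>).

  On the kernel of \<open>\<theta>\<close> the map \<open>\<phi>\<close> takes scalar values. For a finite subset \<open>F\<close> of the kernel the
  operator \<open>\<Sum>g\<in>F. cnj (\<gamma> g) Lt g\<close> is therefore mapped to \<open>card F\<close> times the identity, so it
  has norm \<open>card F\<close>, and there is a unit vector \<open>\<xi>\<close> for which all the norms
  \<open>\<parallel>\<xi> + cnj (\<gamma> g) Lt g \<xi>\<parallel>\<close> with \<open>g \<in> F\<close> are close to \<open>2\<close>. For \<open>p > 1\<close>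
  strict convexity of \<open>x powr p\<close>, made quantitative by a compactness argument
  (\<open>powr_diff_le_midpoint_defect\<close>), shows that the density \<open>\<bar>\<xi>\<bar>\<^sup>p\<close> is almost invariant in \<open>\<ell>\<^sup>1(G)\<close>
  (\<open>kernel_Reiter\<close>). Pushing such densities to the kernel along a choice of coset representatives
  and passing to a limit in a compact product yields an invariant mean
  (\<open>amenable_subgroup_if_almost_invariant\<close>).

  If \<open>\<theta>\<close> is injective, then \<open>\<ell>\<^sup>p(G)\<close> embeds isometrically into \<open>\<ell>\<^sup>p(H)\<close>, twisted by \<open>\<gamma>\<close>, in such a way
  that \<open>\<phi> S\<close> restricts to \<open>S\<close>. This gives the missing inequality of norms
  (\<open>theta_injective_imp_isometric\<close>). The other implications come from
  linearity and from evaluating \<open>\<phi>\<close> on translations. Finally an isometric isomorphism is unital and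
  contractive, and the induced \<open>\<theta>\<close> is bijective; conversely a group isomorphism transports operators
  by relabelling coordinates.

  Identities that depend linearly and continuously on a pseudofunction are checked on translations only
  (\<open>vanishing_functional\<close>), which is legitimate since finite sums of translations are dense by Young's
  inequality.
\<close>

section \<open>Scalar inequalities\<close>

text \<open>
  The tangent line at \<open>1\<close> lies strictly below \<open>x powr p\<close>. Every convexity fact about powers below
  comes from this one inequality by scaling.
\<close>

lemma Bernoulli_powr_strict:
  fixes x p :: real
  assumes p: "1 < p" and x: "0 \<le> x" "x \<noteq> 1"
  shows "1 + p * (x - 1) < x powr p"
proof (cases "x = 0")
  case True
  then show ?thesis using p by simp
next
  case False
  with x have x0: "x > 0" by simp
  have der: "((\<lambda>z. z powr p) has_real_derivative p * z powr (p - 1)) (at z)" if "z > 0" for z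
    using that by (auto intro!: derivative_eq_intros)
  show ?thesis
  proof (cases "x < 1")
    case True
    obtain z where z: "x < z" "z < 1" "1 powr p - x powr p = (1 - x) * (p * z powr (p - 1))"
      using MVT2[OF True, of "\<lambda>z. z powr p" "\<lambda>z. p * z powr (p - 1)"] der x0 by (metis less_le_trans)
    have "z powr (p - 1) < 1" using z x0 p powr_less_mono2[of "p - 1" z 1] by simp
    then have "(1 - x) * (p * z powr (p - 1)) < (1 - x) * p"
      using p True by simp
    then show ?thesis using z(3) by (simp add: algebra_simps)
  next
    case False
    with x have x1: "1 < x" by simp
    obtain z where z: "1 < z" "z < x" "x powr p - 1 powr p = (x - 1) * (p * z powr (p - 1))"
      using MVT2[OF x1, of "\<lambda>z. z powr p" "\<lambda>z. p * z powr (p - 1)"] der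
      by (metis less_le_trans zero_less_one)
    have "1 < z powr (p - 1)" using z p by (simp add: gr_one_powr)
    then have "(x - 1) * p < (x - 1) * (p * z powr (p - 1))"
      using p x1 by simp
    then show ?thesis using z(3) by (simp add: algebra_simps)
  qed
qed

text \<open>
  Add the tangent inequalities at \<open>a / c\<close> and \<open>b / c\<close> for the midpoint \<open>c\<close>: the linear terms
  cancel because the two ratios add up to \<open>2\<close>.
\<close>

lemma powr_midpoint_strict:
  fixes a b p :: real
  assumes p: "1 < p" and ab: "0 \<le> a" "0 \<le> b" "a \<noteq> b"
  shows "((a + b) / 2) powr p < (a powr p + b powr p) / 2"
proof -
  define c where "c = (a + b) / 2"
  have c: "c > 0" using ab by (auto simp: c_def)
  have ne: "a / c \<noteq> 1" "b / c \<noteq> 1" using ab c by (auto simp: c_def field_simps)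
  have "1 + p * (a / c - 1) + (1 + p * (b / c - 1)) < (a / c) powr p + (b / c) powr p"
    using Bernoulli_powr_strict[OF p _ ne(1)] Bernoulli_powr_strict[OF p _ ne(2)] ab c
    by (intro add_strict_mono) auto
  moreover have "1 + p * (a / c - 1) + (1 + p * (b / c - 1)) = 2"
  proof -
    have "a + b = 2 * c" by (simp add: c_def)
    then have "a / c + b / c = 2" using c by (simp flip: add_divide_distrib)
    moreover have "1 + p * (a / c - 1) + (1 + p * (b / c - 1)) = 2 + p * (a / c + b / c - 2)"
      by (simp add: algebra_simps)
    ultimately show ?thesis by simp
  qed
  ultimately have "2 < (a powr p + b powr p) / c powr p"
    using ab c by (simp add: powr_divide add_divide_distrib)
  then show ?thesis using c by (simp add: field_simps flip: c_def)
qed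

lemma powr_midpoint:
  fixes a b p :: real
  assumes p: "1 \<le> p" and ab: "0 \<le> a" "0 \<le> b"
  shows "((a + b) / 2) powr p \<le> (a powr p + b powr p) / 2"
proof (cases "p = 1 \<or> a = b")
  case True
  then show ?thesis using ab by auto
next
  case False
  then show ?thesis using powr_midpoint_strict[of p a b] assms by auto
qed

text \<open>
  The same cancellation of linear terms, with weights \<open>l\<close> and \<open>m\<close> at the weighted mean \<open>c\<close>.
\<close>

lemma powr_convex:
  fixes p x y l m :: real
  assumes p: "1 \<le> p" and xy: "0 \<le> x" "0 \<le> y" and lm: "0 \<le> l" "0 \<le> m" "l + m = 1"
  shows "(l * x + m * y) powr p \<le> l * x powr p + m * y powr p"
proof -
  define c where "c = l * x + m * y"
  have B: "1 + p * (z - 1) \<le> z powr p" if "z \<ge> 0" for z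
    using Bernoulli_powr_strict[of p z] p that by (cases "p = 1 \<or> z = 1") auto
  have c0: "c \<ge> 0" using assms by (simp add: c_def)
  show ?thesis
  proof (cases "c = 0")
    case True
    then show ?thesis using assms by (simp add: c_def)
  next
    case False
    with c0 have c: "c > 0" by simp
    have "l * (1 + p * (x / c - 1)) + m * (1 + p * (y / c - 1))
        \<le> l * (x / c) powr p + m * (y / c) powr p"
      using xy lm c by (intro add_mono mult_left_mono B) auto
    also have "l * (1 + p * (x / c - 1)) + m * (1 + p * (y / c - 1))
        = (l + m) * (1 - p) + p * ((l * x + m * y) / c)"
      by (simp add: algebra_simps add_divide_distrib)
    also have "\<dots> = 1" using c lm by (simp flip: c_def)
    finally have "1 \<le> (l * x powr p + m * y powr p) / c powr p"
      using xy c by (simp add: powr_divide add_divide_distrib)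
    then show ?thesis using c by (simp add: field_simps flip: c_def)
  qed
qed

text \<open>
  After division by \<open>x + y\<close> both arguments lie strictly between \<open>0\<close> and \<open>1\<close>, where raising to
  the power \<open>r\<close> increases the value for \<open>r < 1\<close> and decreases it for \<open>r > 1\<close>.
\<close>

lemma powr_add_strict:
  fixes x y r :: real
  assumes "x > 0" "y > 0"
  shows "0 < r \<Longrightarrow> r < 1 \<Longrightarrow> (x + y) powr r < x powr r + y powr r"
    and "1 < r \<Longrightarrow> x powr r + y powr r < (x + y) powr r"
proof -
  define s where "s = x + y"
  have s: "s > 0" using assms by (simp add: s_def)
  have st: "0 < x / s" "x / s < 1" "0 < y / s" "y / s < 1" "x / s + y / s = 1"
    using assms s by (auto simp: s_def simp flip: add_divide_distrib)
  have scale: "x powr r + y powr r = s powr r * ((x / s) powr r + (y / s) powr r)"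
    using assms s by (simp add: powr_divide field_simps)
  show "(x + y) powr r < x powr r + y powr r" if r: "0 < r" "r < 1"
  proof -
    have "x / s + y / s < (x / s) powr r + (y / s) powr r"
      using st r powr_less_mono'[of "x / s" r 1] powr_less_mono'[of "y / s" r 1]
      by (intro add_strict_mono) (auto simp del: abs_divide)
    then show ?thesis using scale s st by (simp add: s_def)
  qed
  show "x powr r + y powr r < (x + y) powr r" if r: "1 < r"
  proof -
    have "(x / s) powr r + (y / s) powr r < x / s + y / s"
      using st r powr_less_mono'[of "x / s" 1 r] powr_less_mono'[of "y / s" 1 r]
      by (intro add_strict_mono) (auto simp del: abs_divide)
    then show ?thesis using scale s st by (simp add: s_def)
  qed
qed

lemma cmod_parallelogram:
  "(cmod (a + b))\<^sup>2 + (cmod (a - b))\<^sup>2 = 2 * ((cmod a)\<^sup>2 + (cmod b)\<^sup>2)"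
  unfolding cmod_power2 by (simp add: power2_eq_square algebra_simps)

text \<open>
  The inequality that distinguishes \<open>p \<noteq> 2\<close> from the Hilbert space case. Put \<open>r = p / 2\<close> and work
  with squared moduli, so that the parallelogram law fixes the mean of \<open>\<bar>a + b\<bar>\<^sup>2\<close> and
  \<open>\<bar>a - b\<bar>\<^sup>2\<close>. For \<open>p < 2\<close> concavity of \<open>x powr r\<close> and its strict subadditivity push in the same
  direction; for \<open>p > 2\<close> convexity and superadditivity do. The factor \<open>sgn (2 - p)\<close> merges the two
  cases.
\<close>

lemma Clarkson_pointwise:
  fixes a b :: complex and p :: real
  assumes p: "1 \<le> p" "p \<noteq> 2"
  defines "D \<equiv> sgn (2 - p) *
    (2 * (cmod a powr p + cmod b powr p) - (cmod (a + b) powr p + cmod (a - b) powr p))"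
  shows "0 \<le> D" and "a \<noteq> 0 \<Longrightarrow> b \<noteq> 0 \<Longrightarrow> 0 < D"
proof -
  define r where "r = p / 2"
  have sq: "cmod z powr p = ((cmod z)\<^sup>2) powr r" for z
  proof -
    have "(cmod z)\<^sup>2 = cmod z powr 2" by simp
    then show ?thesis by (simp only: powr_powr r_def) simp
  qed
  define X Y x y where XY: "X = (cmod (a + b))\<^sup>2" "Y = (cmod (a - b))\<^sup>2"
    "x = (cmod a)\<^sup>2" "y = (cmod b)\<^sup>2"
  have nn: "X \<ge> 0" "Y \<ge> 0" "x \<ge> 0" "y \<ge> 0" by (auto simp: XY)
  have par: "(X + Y) / 2 = x + y" using cmod_parallelogram[of a b] by (simp add: XY)
  have r0: "r > 0" using p by (simp add: r_def)
  have D: "D = sgn (2 - p) * (2 * (x powr r + y powr r) - (X powr r + Y powr r))"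
    by (simp add: D_def sq XY)
  have pos: "a \<noteq> 0 \<Longrightarrow> x > 0" "b \<noteq> 0 \<Longrightarrow> y > 0" by (auto simp: XY)
  have "0 \<le> D \<and> (a \<noteq> 0 \<longrightarrow> b \<noteq> 0 \<longrightarrow> 0 < D)"
  proof (cases "p < 2")
    case True
    then have r1: "r < 1" by (simp add: r_def)
    have "((X powr r + Y powr r) / 2) powr (1 / r) \<le> (X + Y) / 2"
      using powr_midpoint[of "1 / r" "X powr r" "Y powr r"] r0 r1 nn by (simp add: powr_powr)
    then have "(((X powr r + Y powr r) / 2) powr (1 / r)) powr r \<le> (x + y) powr r"
      unfolding par using r0 by (intro powr_mono2) auto
    then have "X powr r + Y powr r \<le> 2 * (x + y) powr r"
      using r0 by (simp add: powr_powr)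
    moreover have "(x + y) powr r \<le> x powr r + y powr r"
      using powr_add_strict(1)[of x y r] nn r0 r1 by (cases "x = 0"; cases "y = 0") auto
    moreover have "(x + y) powr r < x powr r + y powr r" if "a \<noteq> 0" "b \<noteq> 0"
      using powr_add_strict(1)[of x y r] pos that r0 r1 by auto
    moreover have "D = 2 * (x powr r + y powr r) - (X powr r + Y powr r)"
      using True by (simp add: D)
    ultimately show ?thesis by (smt (verit))
  next
    case False
    with p have r1: "r > 1" by (simp add: r_def)
    have "2 * (x + y) powr r \<le> X powr r + Y powr r"
      using powr_midpoint[of r X Y] r1 nn par by simp
    moreover have "x powr r + y powr r \<le> (x + y) powr r"
      using powr_add_strict(2)[of x y r] nn r0 r1 by (cases "x = 0"; cases "y = 0") auto
    moreover have "x powr r + y powr r < (x + y) powr r" if "a \<noteq> 0" "b \<noteq> 0"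
      using powr_add_strict(2)[of x y r] pos that r0 r1 by auto
    moreover have "D = (X powr r + Y powr r) - 2 * (x powr r + y powr r)"
      using False p by (simp add: D)
    ultimately show ?thesis by (smt (verit))
  qed
  then show "0 \<le> D" "a \<noteq> 0 \<Longrightarrow> b \<noteq> 0 \<Longrightarrow> 0 < D" by auto
qed

text \<open>
  A quantitative form of strict convexity: the midpoint defect of \<open>x powr p\<close> controls the distance
  between \<open>a powr p\<close> and \<open>b powr p\<close>, up to a small multiple of their sum. Both sides are homogeneous,
  so it is enough to treat \<open>a powr p + b powr p = 1\<close>. There the pairs with
  \<open>\<delta> \<le> \<bar>a powr p - b powr p\<bar>\<close> form a compact set, and on it the defect has a positive minimum.
  This inequality takes the place of uniform convexity of the space.
\<close>

lemma powr_diff_le_midpoint_defect: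
  fixes p \<delta> :: real
  assumes p: "1 < p" and \<delta>: "0 < \<delta>"
  obtains C where "0 \<le> C"
    and "\<And>a b. 0 \<le> a \<Longrightarrow> 0 \<le> b \<Longrightarrow> \<bar>a powr p - b powr p\<bar>
      \<le> \<delta> * (a powr p + b powr p) + C * ((a powr p + b powr p) / 2 - ((a + b) / 2) powr p)"
proof -
  \<comment> \<open>The midpoint defect on the normalised pairs, in the variable \<open>x = a powr p\<close>.\<close>
  define h where "h = (\<lambda>x::real. 1 / 2 - ((x powr (1/p) + (1 - x) powr (1/p)) / 2) powr p)"
  define K where "K = {x::real. 0 \<le> x \<and> x \<le> 1 \<and> \<delta> \<le> \<bar>2 * x - 1\<bar>}"
  have h_pos: "0 < h x" if "x \<in> K" for x
  proof -
    have x: "0 \<le> x" "x \<le> 1" "\<delta> \<le> \<bar>2 * x - 1\<bar>" using that by (auto simp: K_def)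
    have "x powr (1/p) \<noteq> (1 - x) powr (1/p)"
    proof
      assume "x powr (1/p) = (1 - x) powr (1/p)"
      then have "(x powr (1/p)) powr p = ((1 - x) powr (1/p)) powr p" by simp
      then show False using x p \<delta> by (simp add: powr_powr)
    qed
    from powr_midpoint_strict[OF p _ _ this] show ?thesis
      using x p by (simp add: h_def powr_powr)
  qed
  have "K = {0..1} \<inter> {x. \<delta> \<le> \<bar>2 * x - 1\<bar>}" by (auto simp: K_def)
  then have "compact K"
    by (auto intro!: compact_Int_closed closed_Collect_le continuous_intros)
  moreover have "continuous_on K h"
    unfolding h_def using p
    by (intro continuous_on_diff continuous_on_powr' continuous_on_divide continuous_on_add
        continuous_on_const continuous_on_id) (auto simp: K_def)
  ultimately obtain m where m: "0 < m" "\<And>x. x \<in> K \<Longrightarrow> m \<le> h x"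
  proof (cases "K = {}")
    case False
    with \<open>compact K\<close> \<open>continuous_on K h\<close> obtain x0 where "x0 \<in> K" "\<And>x. x \<in> K \<Longrightarrow> h x0 \<le> h x"
      using continuous_attains_inf[of K h] by blast
    then show ?thesis using that[of "h x0"] h_pos by blast
  qed (use that[of 1] in auto)
  show ?thesis
  proof (rule that[of "1 / m"])
    fix a b :: real assume ab: "0 \<le> a" "0 \<le> b"
    define s where "s = a powr p + b powr p"
    show "\<bar>a powr p - b powr p\<bar>
      \<le> \<delta> * (a powr p + b powr p) + 1 / m * ((a powr p + b powr p) / 2 - ((a + b) / 2) powr p)"
    proof (cases "\<bar>a powr p - b powr p\<bar> < \<delta> * s")
      case True
      then show ?thesis using powr_midpoint[of p a b] p ab m(1) by (simp add: s_def add_increasing2)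
    next
      case False
      show ?thesis
      proof (cases "s = 0")
        case True
        then have "a powr p = 0" "b powr p = 0"
          using add_nonneg_eq_0_iff[of "a powr p" "b powr p"] by (auto simp: s_def)
        then show ?thesis by simp
      next
        case s: False
        then have s0: "s > 0" by (simp add: s_def order_less_le)
        define x where "x = a powr p / s"
        have x1: "1 - x = b powr p / s" using s0 by (simp add: x_def s_def field_simps)
        have x01: "0 \<le> x" "0 \<le> 1 - x" unfolding x1 using s0 by (auto simp: x_def)
        have d: "\<bar>a powr p - b powr p\<bar> = \<bar>2 * x - 1\<bar> * s"
        proof -
          have "a powr p - b powr p = (2 * x - 1) * s" using s0 by (simp add: x_def s_def field_simps)
          then show ?thesis using s0 by (simp add: abs_mult)
        qed
        then have "x \<in> K" using False s0 x01 by (simp add: K_def)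
        then have "m \<le> h x" by (rule m)
        have root: "x powr (1/p) = a / s powr (1/p)" "(1 - x) powr (1/p) = b / s powr (1/p)"
          unfolding x1 using ab p s0 by (auto simp: x_def powr_divide powr_powr)
        have "h x = 1 / 2 - ((a + b) / 2) powr p / s"
          unfolding h_def root using ab p s0
          by (simp add: powr_divide powr_mult powr_powr flip: add_divide_distrib)
        then have "s * h x = s / 2 - ((a + b) / 2) powr p" using s0 by (simp add: field_simps)
        moreover have "s * m \<le> s * h x" using \<open>m \<le> h x\<close> s0 by simp
        ultimately have "s \<le> 1 / m * (s / 2 - ((a + b) / 2) powr p)"
          using m(1) by (simp add: field_simps)
        moreover have "\<bar>a powr p - b powr p\<bar> \<le> s" by (auto simp: s_def abs_if)
        moreover have "0 \<le> \<delta> * s" using \<delta> s0 by simp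
        ultimately show ?thesis by (simp add: s_def)
      qed
    qed
  qed (use m in auto)
qed

section \<open>The normed space of p-summable functions\<close>

lemma lp_norm_nonneg: "0 \<le> lp_norm p A \<xi>"
  by (simp add: lp_norm_def)

lemma lp_zero_off: "\<xi> \<in> lp p A \<Longrightarrow> t \<notin> A \<Longrightarrow> \<xi> t = 0"
  by (simp add: lp_def)

lemma lp_summable: "\<xi> \<in> lp p A \<Longrightarrow> (\<lambda>t. cmod (\<xi> t) powr p) summable_on A"
  by (simp add: lp_def)

lemma lp_norm_zero [simp]: "lp_norm p A (\<lambda>t. 0) = 0"
  by (simp add: lp_norm_def)

lemma lp_zero [simp]: "(\<lambda>t. 0) \<in> lp p A"
  by (simp add: lp_def)

text \<open>
  Translations of a group, the inclusion of one group into another, and the passage along a group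
  isomorphism all relabel coordinates; that they preserve norms rests on this lemma and the next one.
\<close>

lemma lp_norm_relabel:
  assumes "bij_betw f A B"
  shows "lp_norm p A (\<lambda>t. if t \<in> A then \<xi> (f t) else 0) = lp_norm p B \<xi>"
proof -
  have "(\<Sum>\<^sub>\<infinity>t\<in>A. cmod (if t \<in> A then \<xi> (f t) else 0) powr p) = (\<Sum>\<^sub>\<infinity>t\<in>A. cmod (\<xi> (f t)) powr p)"
    by (rule infsum_cong) auto
  also have "\<dots> = (\<Sum>\<^sub>\<infinity>t\<in>B. cmod (\<xi> t) powr p)"
    by (rule infsum_reindex_bij_betw[OF assms])
  finally show ?thesis by (simp add: lp_norm_def)
qed

lemma lp_relabel:
  assumes "bij_betw f A B" and "\<xi> \<in> lp p B"
  shows "(\<lambda>t. if t \<in> A then \<xi> (f t) else 0) \<in> lp p A"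
proof -
  have "(\<lambda>t. cmod (\<xi> (f t)) powr p) summable_on A"
    using summable_on_reindex_bij_betw[OF assms(1), of "\<lambda>t. cmod (\<xi> t) powr p"]
      lp_summable[OF assms(2)] by simp
  then have "(\<lambda>t. cmod (if t \<in> A then \<xi> (f t) else 0) powr p) summable_on A"
    by (subst summable_on_cong[where g = "\<lambda>t. cmod (\<xi> (f t)) powr p"]) auto
  then show ?thesis by (simp add: lp_def)
qed

lemma lp_superset:
  assumes "A \<subseteq> B" and "\<xi> \<in> lp p A"
  shows "\<xi> \<in> lp p B" and "lp_norm p B \<xi> = lp_norm p A \<xi>"
proof -
  have z: "cmod (\<xi> t) powr p = 0" if "t \<in> B - A" for t
    using that lp_zero_off[OF assms(2)] by auto
  have "(\<lambda>t. cmod (\<xi> t) powr p) summable_on B \<longleftrightarrow> (\<lambda>t. cmod (\<xi> t) powr p) summable_on A"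
    by (rule summable_on_cong_neutral) (use z assms in auto)
  then show "\<xi> \<in> lp p B" using assms by (auto simp: lp_def)
  have "(\<Sum>\<^sub>\<infinity>t\<in>B. cmod (\<xi> t) powr p) = (\<Sum>\<^sub>\<infinity>t\<in>A. cmod (\<xi> t) powr p)"
    by (rule infsum_cong_neutral) (use z assms in auto)
  then show "lp_norm p B \<xi> = lp_norm p A \<xi>" by (simp add: lp_norm_def)
qed

context
  fixes p :: real
  assumes p: "1 \<le> p"
begin

lemma powr_le_imp_le: "x powr p \<le> y powr p \<Longrightarrow> 0 \<le> y \<Longrightarrow> x \<le> (y::real)"
  using powr_less_mono2[of p y x] p by (meson linorder_not_less less_le_trans zero_less_one)

lemma lp_norm_powr: "lp_norm p A \<xi> powr p = (\<Sum>\<^sub>\<infinity>t\<in>A. cmod (\<xi> t) powr p)"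
proof -
  have "0 \<le> (\<Sum>\<^sub>\<infinity>t\<in>A. cmod (\<xi> t) powr p)" by (rule infsum_nonneg) simp
  then show ?thesis using p by (simp add: lp_norm_def powr_powr)
qed

lemma sum_le_lp_norm_powr:
  assumes "\<xi> \<in> lp p A" "finite F" "F \<subseteq> A"
  shows "(\<Sum>t\<in>F. cmod (\<xi> t) powr p) \<le> lp_norm p A \<xi> powr p"
  unfolding lp_norm_powr by (rule finite_sum_le_infsum) (use assms lp_summable in auto)

text \<open>
  Bounds on finite partial sums give membership and the norm bound at once. Minkowski's and Young's
  inequalities are both proved in this form, which avoids any manipulation of infinite sums.
\<close>

lemma lp_finite_sum_bound:
  assumes off: "\<And>t. t \<notin> A \<Longrightarrow> \<xi> t = 0" and C: "0 \<le> C"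
    and bd: "\<And>F. finite F \<Longrightarrow> F \<subseteq> A \<Longrightarrow> (\<Sum>t\<in>F. cmod (\<xi> t) powr p) \<le> C powr p"
  shows "\<xi> \<in> lp p A" and "lp_norm p A \<xi> \<le> C"
proof -
  have s: "(\<lambda>t. cmod (\<xi> t) powr p) summable_on A"
    using bd by (intro nonneg_bdd_above_summable_on bdd_aboveI[where M = "C powr p"]) auto
  then show "\<xi> \<in> lp p A" using off by (auto simp: lp_def)
  have "lp_norm p A \<xi> powr p \<le> C powr p"
    unfolding lp_norm_powr by (rule infsum_le_finite_sums[OF s]) (use bd in auto)
  then show "lp_norm p A \<xi> \<le> C" using C by (rule powr_le_imp_le)
qed

lemma lp_dominated:
  assumes \<xi>: "\<xi> \<in> lp p A" and "\<And>t. t \<notin> A \<Longrightarrow> \<eta> t = 0" and le: "\<And>t. t \<in> A \<Longrightarrow> cmod (\<eta> t) \<le> cmod (\<xi> t)"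
  shows "\<eta> \<in> lp p A" and "lp_norm p A \<eta> \<le> lp_norm p A \<xi>"
proof -
  have "(\<Sum>t\<in>F. cmod (\<eta> t) powr p) \<le> lp_norm p A \<xi> powr p" if "finite F" "F \<subseteq> A" for F
  proof -
    have "(\<Sum>t\<in>F. cmod (\<eta> t) powr p) \<le> (\<Sum>t\<in>F. cmod (\<xi> t) powr p)"
      using le that p by (intro sum_mono powr_mono2) auto
    then show ?thesis using sum_le_lp_norm_powr[OF \<xi> that] by simp
  qed
  then show "\<eta> \<in> lp p A" "lp_norm p A \<eta> \<le> lp_norm p A \<xi>"
    using lp_finite_sum_bound[of A \<eta> "lp_norm p A \<xi>"] lp_norm_nonneg assms by auto
qed

lemma cmod_le_lp_norm:
  assumes "\<xi> \<in> lp p A"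
  shows "cmod (\<xi> t) \<le> lp_norm p A \<xi>"
proof (cases "t \<in> A")
  case True
  then have "cmod (\<xi> t) powr p \<le> lp_norm p A \<xi> powr p"
    using sum_le_lp_norm_powr[OF assms, of "{t}"] by simp
  then show ?thesis using lp_norm_nonneg by (rule powr_le_imp_le)
next
  case False
  then show ?thesis using lp_zero_off[OF assms] lp_norm_nonneg by simp
qed

lemma lp_norm_eq_0:
  assumes "\<xi> \<in> lp p A" "lp_norm p A \<xi> = 0"
  shows "\<xi> = (\<lambda>t. 0)"
  using cmod_le_lp_norm[OF assms(1)] assms(2) by (auto simp: fun_eq_iff)

lemma lp_scale:
  assumes "\<xi> \<in> lp p A"
  shows "(\<lambda>t. c * \<xi> t) \<in> lp p A" and "lp_norm p A (\<lambda>t. c * \<xi> t) = cmod c * lp_norm p A \<xi>"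
proof -
  have *: "cmod (c * \<xi> t) powr p = cmod c powr p * cmod (\<xi> t) powr p" for t
    by (simp add: norm_mult powr_mult)
  show "(\<lambda>t. c * \<xi> t) \<in> lp p A"
    using assms unfolding lp_def * by (auto simp: norm_mult powr_mult intro: summable_on_cmult_right)
  show "lp_norm p A (\<lambda>t. c * \<xi> t) = cmod c * lp_norm p A \<xi>"
    using p unfolding lp_norm_def * infsum_cmult_right'
    by (simp add: powr_mult powr_powr infsum_nonneg)
qed

text \<open>
  Minkowski's inequality: write \<open>\<xi> + \<eta>\<close> as \<open>(a + b)\<close> times a convex combination of the unit
  vectors \<open>\<xi> / a\<close> and \<open>\<eta> / b\<close> and use convexity in every coordinate.
\<close>

lemma lp_add:
  assumes \<xi>: "\<xi> \<in> lp p A" and \<eta>: "\<eta> \<in> lp p A"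
  shows "(\<lambda>t. \<xi> t + \<eta> t) \<in> lp p A"
    and "lp_norm p A (\<lambda>t. \<xi> t + \<eta> t) \<le> lp_norm p A \<xi> + lp_norm p A \<eta>"
proof -
  define a b where "a = lp_norm p A \<xi>" and "b = lp_norm p A \<eta>"
  have "(\<lambda>t. \<xi> t + \<eta> t) \<in> lp p A \<and> lp_norm p A (\<lambda>t. \<xi> t + \<eta> t) \<le> a + b"
  proof (cases "a = 0 \<or> b = 0")
    case True
    then have "\<xi> = (\<lambda>t. 0) \<or> \<eta> = (\<lambda>t. 0)" using lp_norm_eq_0 \<xi> \<eta> by (auto simp: a_def b_def)
    then show ?thesis using \<xi> \<eta> by (auto simp: a_def b_def)
  next
    case False
    then have ab: "a > 0" "b > 0" using lp_norm_nonneg by (auto simp: a_def b_def order_less_le)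
    define l m where "l = a / (a + b)" and "m = b / (a + b)"
    have lm: "0 \<le> l" "0 \<le> m" "l + m = 1"
      using ab by (auto simp: l_def m_def simp flip: add_divide_distrib)
    have pt: "cmod (\<xi> t + \<eta> t) powr p \<le> (a + b) powr p *
        (l * (cmod (\<xi> t) powr p / a powr p) + m * (cmod (\<eta> t) powr p / b powr p))" for t
    proof -
      have "cmod (\<xi> t + \<eta> t) powr p \<le> (cmod (\<xi> t) + cmod (\<eta> t)) powr p"
        using p by (intro powr_mono2 norm_triangle_ineq) auto
      also have "cmod (\<xi> t) + cmod (\<eta> t) = (a + b) * (l * (cmod (\<xi> t) / a) + m * (cmod (\<eta> t) / b))"
        using ab by (simp add: l_def m_def distrib_left add_divide_distrib)
      also have "\<dots> powr p = (a + b) powr p * (l * (cmod (\<xi> t) / a) + m * (cmod (\<eta> t) / b)) powr p"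
        using ab lm by (subst powr_mult) auto
      also have "\<dots> \<le> (a + b) powr p * (l * (cmod (\<xi> t) / a) powr p + m * (cmod (\<eta> t) / b) powr p)"
        using ab lm p by (intro mult_left_mono powr_convex) auto
      finally show ?thesis using ab by (simp add: powr_divide)
    qed
    have "(\<Sum>t\<in>F. cmod (\<xi> t + \<eta> t) powr p) \<le> (a + b) powr p" if F: "finite F" "F \<subseteq> A" for F
    proof -
      have "(\<Sum>t\<in>F. cmod (\<xi> t + \<eta> t) powr p) \<le> (\<Sum>t\<in>F. (a + b) powr p *
        (l * (cmod (\<xi> t) powr p / a powr p) + m * (cmod (\<eta> t) powr p / b powr p)))"
        by (rule sum_mono[OF pt])
      also have "\<dots> = (a + b) powr p * (l * ((\<Sum>t\<in>F. cmod (\<xi> t) powr p) / a powr p)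
          + m * ((\<Sum>t\<in>F. cmod (\<eta> t) powr p) / b powr p))"
        by (simp add: sum.distrib mult.assoc flip: sum_distrib_left sum_divide_distrib times_divide_eq_right)
      also have "\<dots> \<le> (a + b) powr p * (l * 1 + m * 1)"
        using ab lm sum_le_lp_norm_powr[OF \<xi> F] sum_le_lp_norm_powr[OF \<eta> F]
        by (intro mult_left_mono add_mono) (auto simp: a_def b_def)
      finally show ?thesis using lm by simp
    qed
    then show ?thesis
      using lp_finite_sum_bound[of A "\<lambda>t. \<xi> t + \<eta> t" "a + b"] ab lp_zero_off[OF \<xi>] lp_zero_off[OF \<eta>]
      by auto
  qed
  then show "(\<lambda>t. \<xi> t + \<eta> t) \<in> lp p A"
    "lp_norm p A (\<lambda>t. \<xi> t + \<eta> t) \<le> lp_norm p A \<xi> + lp_norm p A \<eta>"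
    by (auto simp: a_def b_def)
qed

lemma lp_diff:
  assumes \<xi>: "\<xi> \<in> lp p A" and \<eta>: "\<eta> \<in> lp p A"
  shows "(\<lambda>t. \<xi> t - \<eta> t) \<in> lp p A"
    and "lp_norm p A (\<lambda>t. \<xi> t - \<eta> t) \<le> lp_norm p A \<xi> + lp_norm p A \<eta>"
  using lp_add[OF \<xi> lp_scale(1)[OF \<eta>, of "-1"]] lp_scale(2)[OF \<eta>, of "-1"] by auto

lemma lp_sum:
  assumes "finite I" and "\<And>i. i \<in> I \<Longrightarrow> \<xi> i \<in> lp p A"
  shows "(\<lambda>t. \<Sum>i\<in>I. c i * \<xi> i t) \<in> lp p A"
    and "lp_norm p A (\<lambda>t. \<Sum>i\<in>I. c i * \<xi> i t) \<le> (\<Sum>i\<in>I. cmod (c i) * lp_norm p A (\<xi> i))"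
proof -
  have "(\<lambda>t. \<Sum>i\<in>I. c i * \<xi> i t) \<in> lp p A \<and>
    lp_norm p A (\<lambda>t. \<Sum>i\<in>I. c i * \<xi> i t) \<le> (\<Sum>i\<in>I. cmod (c i) * lp_norm p A (\<xi> i))"
    using assms
  proof (induction I rule: finite_induct)
    case empty
    then show ?case by simp
  next
    case (insert i I)
    then have IH: "(\<lambda>t. \<Sum>i\<in>I. c i * \<xi> i t) \<in> lp p A"
      "lp_norm p A (\<lambda>t. \<Sum>i\<in>I. c i * \<xi> i t) \<le> (\<Sum>i\<in>I. cmod (c i) * lp_norm p A (\<xi> i))"
      and \<xi>: "\<xi> i \<in> lp p A" by auto
    show ?case
      using lp_add[OF lp_scale(1)[OF \<xi>, of "c i"] IH(1)] lp_scale(2)[OF \<xi>, of "c i"] IH(2) insert(1,2)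
      by auto
  qed
  then show "(\<lambda>t. \<Sum>i\<in>I. c i * \<xi> i t) \<in> lp p A"
    "lp_norm p A (\<lambda>t. \<Sum>i\<in>I. c i * \<xi> i t) \<le> (\<Sum>i\<in>I. cmod (c i) * lp_norm p A (\<xi> i))" by auto
qed

lemma lp_finite_support:
  assumes "finite F" "F \<subseteq> A" "\<And>t. t \<notin> F \<Longrightarrow> \<xi> t = 0"
  shows "\<xi> \<in> lp p A"
proof -
  have "(\<lambda>t. cmod (\<xi> t) powr p) summable_on A \<longleftrightarrow> (\<lambda>t. cmod (\<xi> t) powr p) summable_on F"
    by (rule summable_on_cong_neutral) (use assms in auto)
  then show ?thesis using assms by (auto simp: lp_def)
qed

lemma lp_truncate:
  assumes \<xi>: "\<xi> \<in> lp p A" and \<epsilon>: "0 < \<epsilon>"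
  obtains F where "finite F" "F \<subseteq> A" "lp_norm p A (\<lambda>t. if t \<in> F then 0 else \<xi> t) < \<epsilon>"
proof -
  have e: "\<epsilon> powr p / 2 > 0" using \<epsilon> by simp
  then obtain F where F: "finite F" "F \<subseteq> A"
    and d: "dist (sum (\<lambda>t. cmod (\<xi> t) powr p) F) (\<Sum>\<^sub>\<infinity>t\<in>A. cmod (\<xi> t) powr p) \<le> \<epsilon> powr p / 2"
    using infsum_finite_approximation[OF lp_summable[OF \<xi>]] by blast
  define \<zeta> where "\<zeta> = (\<lambda>t. if t \<in> F then 0 else \<xi> t)"
  have "lp_norm p A \<zeta> powr p = (\<Sum>\<^sub>\<infinity>t\<in>A - F. cmod (\<xi> t) powr p)"
    unfolding lp_norm_powr by (rule infsum_cong_neutral) (auto simp: \<zeta>_def)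
  also have "\<dots> = (\<Sum>\<^sub>\<infinity>t\<in>A. cmod (\<xi> t) powr p) - (\<Sum>\<^sub>\<infinity>t\<in>F. cmod (\<xi> t) powr p)"
    using F by (intro infsum_Diff lp_summable[OF \<xi>]) auto
  also have "\<dots> < \<epsilon> powr p" using d e infsum_finite[OF F(1), of "\<lambda>t. cmod (\<xi> t) powr p"] unfolding dist_real_def by linarith
  finally have "lp_norm p A \<zeta> < \<epsilon>"
    using p powr_mono2[of p \<epsilon> "lp_norm p A \<zeta>"] \<epsilon> by (meson linorder_not_less less_imp_le order_trans zero_le_one)
  then show ?thesis using that F by (auto simp: \<zeta>_def)
qed

end

definition unit_vector :: "'a \<Rightarrow> 'a \<Rightarrow> complex" where
  "unit_vector t = (\<lambda>s. if s = t then 1 else 0)"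

lemma unit_vector_lp:
  assumes "t \<in> A"
  shows "unit_vector t \<in> lp p A" and "lp_norm p A (unit_vector t) = 1"
proof -
  have *: "cmod (unit_vector t s) powr p = (if s = t then 1 else 0)" for s
    by (simp add: unit_vector_def)
  have "(\<lambda>s. cmod (unit_vector t s) powr p) summable_on A \<longleftrightarrow> (\<lambda>s. cmod (unit_vector t s) powr p) summable_on {t}"
    by (rule summable_on_cong_neutral) (use assms * in auto)
  then show "unit_vector t \<in> lp p A" using assms by (auto simp: lp_def unit_vector_def)
  have "(\<Sum>\<^sub>\<infinity>s\<in>A. cmod (unit_vector t s) powr p) = (\<Sum>\<^sub>\<infinity>s\<in>{t}. cmod (unit_vector t s) powr p)"
    by (rule infsum_cong_neutral) (use assms * in auto)
  then show "lp_norm p A (unit_vector t) = 1" by (simp add: lp_norm_def unit_vector_def)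
qed

section \<open>Bounded operators\<close>

lemma bounded_operatorsD:
  assumes "T \<in> bounded_operators p A"
  shows bounded_off: "\<xi> \<notin> lp p A \<Longrightarrow> T \<xi> = (\<lambda>t. 0)"
    and bounded_lp: "\<xi> \<in> lp p A \<Longrightarrow> T \<xi> \<in> lp p A"
    and bounded_add: "\<xi> \<in> lp p A \<Longrightarrow> \<eta> \<in> lp p A \<Longrightarrow> T (\<lambda>t. \<xi> t + \<eta> t) = (\<lambda>t. T \<xi> t + T \<eta> t)"
    and bounded_scale: "\<xi> \<in> lp p A \<Longrightarrow> T (\<lambda>t. c * \<xi> t) = (\<lambda>t. c * T \<xi> t)"
  using assms unfolding bounded_operators_def by blast+

lemma bounded_operatorsI:
  assumes "\<And>\<xi>. \<xi> \<notin> lp p A \<Longrightarrow> T \<xi> = (\<lambda>t. 0)"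
    and "\<And>\<xi>. \<xi> \<in> lp p A \<Longrightarrow> T \<xi> \<in> lp p A"
    and "\<And>\<xi> \<eta>. \<xi> \<in> lp p A \<Longrightarrow> \<eta> \<in> lp p A \<Longrightarrow> T (\<lambda>t. \<xi> t + \<eta> t) = (\<lambda>t. T \<xi> t + T \<eta> t)"
    and "\<And>c \<xi>. \<xi> \<in> lp p A \<Longrightarrow> T (\<lambda>t. c * \<xi> t) = (\<lambda>t. c * T \<xi> t)"
    and "\<And>\<xi>. \<xi> \<in> lp p A \<Longrightarrow> lp_norm p A (T \<xi>) \<le> C * lp_norm p A \<xi>"
  shows "T \<in> bounded_operators p A"
  using assms unfolding bounded_operators_def by blast

lemma bounded_norm_le:
  assumes "T \<in> bounded_operators p A"
  obtains C where "0 \<le> C" "\<And>\<xi>. \<xi> \<in> lp p A \<Longrightarrow> lp_norm p A (T \<xi>) \<le> C * lp_norm p A \<xi>"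
proof -
  obtain C where C: "\<And>\<xi>. \<xi> \<in> lp p A \<Longrightarrow> lp_norm p A (T \<xi>) \<le> C * lp_norm p A \<xi>"
    using assms unfolding bounded_operators_def by blast
  show ?thesis
  proof (rule that[of "max C 0"])
    fix \<xi> assume "\<xi> \<in> lp p A"
    then show "lp_norm p A (T \<xi>) \<le> max C 0 * lp_norm p A \<xi>"
      using C mult_right_mono[of C "max C 0" "lp_norm p A \<xi>"] lp_norm_nonneg by fastforce
  qed auto
qed

lemma op_norm_le:
  assumes "0 \<le> C" and "\<And>\<xi>. \<xi> \<in> lp p A \<Longrightarrow> lp_norm p A (T \<xi>) \<le> C * lp_norm p A \<xi>"
  shows "op_norm p A T \<le> C"
  unfolding op_norm_def
proof (rule cSup_least)
  show "{lp_norm p A (T \<xi>) |\<xi>. \<xi> \<in> lp p A \<and> lp_norm p A \<xi> \<le> 1} \<noteq> {}"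
    by (auto intro!: exI[of _ "\<lambda>t. 0"])
  fix x assume "x \<in> {lp_norm p A (T \<xi>) |\<xi>. \<xi> \<in> lp p A \<and> lp_norm p A \<xi> \<le> 1}"
  then obtain \<xi> where \<xi>: "x = lp_norm p A (T \<xi>)" "\<xi> \<in> lp p A" "lp_norm p A \<xi> \<le> 1" by blast
  then have "x \<le> C * lp_norm p A \<xi>" using assms(2) by simp
  also have "\<dots> \<le> C" using \<xi> assms(1) by (simp add: mult_left_le)
  finally show "x \<le> C" .
qed

lemma unit_ball_bdd_above:
  assumes "T \<in> bounded_operators p A"
  shows "bdd_above {lp_norm p A (T \<xi>) |\<xi>. \<xi> \<in> lp p A \<and> lp_norm p A \<xi> \<le> 1}"
proof -
  obtain C where C: "0 \<le> C" "\<And>\<xi>. \<xi> \<in> lp p A \<Longrightarrow> lp_norm p A (T \<xi>) \<le> C * lp_norm p A \<xi>"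
    using bounded_norm_le[OF assms] by blast
  have "lp_norm p A (T \<xi>) \<le> C" if "\<xi> \<in> lp p A" "lp_norm p A \<xi> \<le> 1" for \<xi>
    using C(2)[OF that(1)] mult_left_le[OF that(2) C(1)] by simp
  then show ?thesis by (intro bdd_aboveI[where M = C]) blast
qed

lemma op_norm_nonneg:
  assumes "T \<in> bounded_operators p A"
  shows "0 \<le> op_norm p A T"
proof -
  have "lp_norm p A (T (\<lambda>t. 0)) \<le> op_norm p A T"
    unfolding op_norm_def by (rule cSup_upper[OF _ unit_ball_bdd_above[OF assms]]) force
  then show ?thesis using lp_norm_nonneg by (meson order_trans)
qed

context
  fixes p :: real
  assumes p: "1 \<le> p"
begin

lemma op_norm_bound:
  assumes T: "T \<in> bounded_operators p A" and \<xi>: "\<xi> \<in> lp p A"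
  shows "lp_norm p A (T \<xi>) \<le> op_norm p A T * lp_norm p A \<xi>"
proof (cases "lp_norm p A \<xi> = 0")
  case True
  obtain C where C: "0 \<le> C" "\<And>\<xi>. \<xi> \<in> lp p A \<Longrightarrow> lp_norm p A (T \<xi>) \<le> C * lp_norm p A \<xi>"
    using bounded_norm_le[OF T] by blast
  then show ?thesis using True C(2)[OF \<xi>] by simp
next
  case False
  define n where "n = lp_norm p A \<xi>"
  have n: "n > 0" using False lp_norm_nonneg by (simp add: n_def order_less_le)
  define c where "c = complex_of_real (1 / n)"
  have "lp_norm p A (T (\<lambda>t. c * \<xi> t)) \<le> op_norm p A T"
    unfolding op_norm_def
    using lp_scale[OF p \<xi>, of c] n
    by (intro cSup_upper[OF _ unit_ball_bdd_above[OF T]]) (auto simp: c_def n_def norm_divide)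
  also have "lp_norm p A (T (\<lambda>t. c * \<xi> t)) = cmod c * lp_norm p A (T \<xi>)"
    using bounded_scale[OF T \<xi>] lp_scale(2)[OF p bounded_lp[OF T \<xi>]] by simp
  finally show ?thesis using n by (simp add: c_def norm_divide field_simps flip: n_def)
qed

lemma bounded_operators_add:
  assumes S: "S \<in> bounded_operators p A" and T: "T \<in> bounded_operators p A"
  shows "(\<lambda>\<xi> t. S \<xi> t + T \<xi> t) \<in> bounded_operators p A"
proof (rule bounded_operatorsI[where C = "op_norm p A S + op_norm p A T"])
  fix \<xi> assume \<xi>: "\<xi> \<in> lp p A"
  show "lp_norm p A (\<lambda>t. S \<xi> t + T \<xi> t) \<le> (op_norm p A S + op_norm p A T) * lp_norm p A \<xi>"
    using lp_add(2)[OF p bounded_lp[OF S \<xi>] bounded_lp[OF T \<xi>]]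
      op_norm_bound[OF S \<xi>] op_norm_bound[OF T \<xi>] by (simp add: distrib_right)
  show "(\<lambda>t. S \<xi> t + T \<xi> t) \<in> lp p A"
    by (rule lp_add(1)[OF p bounded_lp[OF S \<xi>] bounded_lp[OF T \<xi>]])
qed (simp_all add: bounded_operatorsD[OF S] bounded_operatorsD[OF T] algebra_simps)

lemma bounded_operators_scale:
  assumes T: "T \<in> bounded_operators p A"
  shows "(\<lambda>\<xi> t. c * T \<xi> t) \<in> bounded_operators p A"
proof (rule bounded_operatorsI[where C = "cmod c * op_norm p A T"])
  fix \<xi> assume \<xi>: "\<xi> \<in> lp p A"
  show "lp_norm p A (\<lambda>t. c * T \<xi> t) \<le> cmod c * op_norm p A T * lp_norm p A \<xi>"
    using lp_scale(2)[OF p bounded_lp[OF T \<xi>], of c] mult_left_mono[OF op_norm_bound[OF T \<xi>], of "cmod c"]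
    by (simp add: mult.assoc)
  show "(\<lambda>t. c * T \<xi> t) \<in> lp p A"
    by (rule lp_scale(1)[OF p bounded_lp[OF T \<xi>]])
qed (simp_all add: bounded_operatorsD[OF T] algebra_simps)

lemma bounded_operators_diff:
  assumes S: "S \<in> bounded_operators p A" and T: "T \<in> bounded_operators p A"
  shows "(\<lambda>\<xi> t. S \<xi> t - T \<xi> t) \<in> bounded_operators p A"
  using bounded_operators_add[OF S bounded_operators_scale[OF T, of "-1"]] by simp

lemma zero_bounded_operator: "(\<lambda>\<xi> t. 0) \<in> bounded_operators p A"
  by (rule bounded_operatorsI[where C = 0]) auto

lemma bounded_operators_sum:
  assumes "finite I" and "\<And>i. i \<in> I \<Longrightarrow> T i \<in> bounded_operators p A"
  shows "(\<lambda>\<xi> t. \<Sum>i\<in>I. c i * T i \<xi> t) \<in> bounded_operators p A"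
  using assms
proof (induction I rule: finite_induct)
  case empty
  then show ?case using zero_bounded_operator by simp
next
  case (insert i I)
  then show ?case
    using bounded_operators_add[OF bounded_operators_scale[of "T i" A "c i"]] by simp
qed

lemma bounded_lincomb:
  assumes T: "T \<in> bounded_operators p A" and "finite I" and "\<And>i. i \<in> I \<Longrightarrow> \<xi> i \<in> lp p A"
  shows "T (\<lambda>t. \<Sum>i\<in>I. c i * \<xi> i t) = (\<lambda>t. \<Sum>i\<in>I. c i * T (\<xi> i) t)"
  using assms(2,3)
proof (induction I rule: finite_induct)
  case empty
  then show ?case using bounded_scale[OF T lp_zero, of 0] by simp
next
  case (insert i I)
  have \<xi>: "\<xi> i \<in> lp p A" "(\<lambda>t. c i * \<xi> i t) \<in> lp p A" "(\<lambda>t. \<Sum>i\<in>I. c i * \<xi> i t) \<in> lp p A"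
    using insert by (auto intro: lp_scale(1)[OF p] lp_sum(1)[OF p])
  show ?case
    using bounded_add[OF T \<xi>(2,3)] bounded_scale[OF T \<xi>(1), of "c i"] insert by simp
qed

text \<open>
  Finite linear combinations of unit vectors are dense, and the difference of the two operators is
  continuous and kills all of them.
\<close>

lemma bounded_operators_eqI:
  assumes S: "S \<in> bounded_operators p A" and T: "T \<in> bounded_operators p A"
    and eq: "\<And>t. t \<in> A \<Longrightarrow> S (unit_vector t) = T (unit_vector t)"
  shows "S = T"
proof
  fix \<xi>
  show "S \<xi> = T \<xi>"
  proof (cases "\<xi> \<in> lp p A")
    case \<xi>: True
    define D where "D = (\<lambda>\<xi> t. S \<xi> t - T \<xi> t)"
    have D: "D \<in> bounded_operators p A" unfolding D_def by (rule bounded_operators_diff[OF S T])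
    have D0: "D (unit_vector t) = (\<lambda>t. 0)" if "t \<in> A" for t using eq[OF that] by (simp add: D_def)
    have "lp_norm p A (D \<xi>) \<le> 0 + e" if e: "e > 0" for e
    proof -
      define n where "n = op_norm p A D"
      have n: "n \<ge> 0" using op_norm_nonneg[OF D] by (simp add: n_def)
      obtain F where F: "finite F" "F \<subseteq> A" "lp_norm p A (\<lambda>t. if t \<in> F then 0 else \<xi> t) < e / (n + 1)"
        using lp_truncate[OF p \<xi>, of "e / (n + 1)"] e n by auto
      let ?\<zeta> = "\<lambda>t. if t \<in> F then 0 else \<xi> t" and ?\<eta> = "\<lambda>s. \<Sum>t\<in>F. \<xi> t * unit_vector t s"
      have \<zeta>: "?\<zeta> \<in> lp p A" using lp_dominated(1)[OF p \<xi>, of ?\<zeta>] lp_zero_off[OF \<xi>] by auto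
      have \<eta>: "?\<eta> \<in> lp p A" using F by (intro lp_sum(1)[OF p] unit_vector_lp(1)) auto
      have "\<xi> = (\<lambda>s. ?\<eta> s + ?\<zeta> s)"
        using F(1) by (auto simp: fun_eq_iff unit_vector_def if_distrib[of "(*) _"] cong: if_cong)
      then have "D \<xi> = (\<lambda>t. D ?\<eta> t + D ?\<zeta> t)" using bounded_add[OF D \<eta> \<zeta>] by simp
      moreover have "D ?\<eta> = (\<lambda>t. 0)"
        using F D0 by (subst bounded_lincomb[OF D]) (auto simp: subset_iff intro: unit_vector_lp(1))
      ultimately have "lp_norm p A (D \<xi>) = lp_norm p A (D ?\<zeta>)" by simp
      also have "\<dots> \<le> n * lp_norm p A ?\<zeta>" using op_norm_bound[OF D \<zeta>] by (simp add: n_def)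
      also have "\<dots> \<le> n * (e / (n + 1))" using F(3) n by (intro mult_left_mono) auto
      also have "\<dots> \<le> e" using n e by (simp add: field_simps)
      finally show ?thesis by simp
    qed
    then have "lp_norm p A (D \<xi>) \<le> 0" by (rule field_le_epsilon)
    then have "D \<xi> = (\<lambda>t. 0)"
      using lp_norm_eq_0[OF p bounded_lp[OF D \<xi>]] lp_norm_nonneg[of p A "D \<xi>"] by simp
    then show ?thesis by (auto simp: D_def fun_eq_iff)
  qed (simp add: bounded_off[OF S] bounded_off[OF T])
qed

end

section \<open>Translations and pseudofunctions\<close>

locale lp_group = group G for G (structure) +
  fixes p :: real
  assumes p: "1 \<le> p"
begin

lemma left_mult_bij: "g \<in> carrier G \<Longrightarrow> bij_betw (\<lambda>t. inv g \<otimes> t) (carrier G) (carrier G)"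
  by (rule bij_betwI[where g = "\<lambda>t. g \<otimes> t"]) (auto simp: m_assoc[symmetric])

lemma right_mult_bij: "g \<in> carrier G \<Longrightarrow> bij_betw (\<lambda>t. t \<otimes> g) (carrier G) (carrier G)"
  by (rule bij_betwI[where g = "\<lambda>t. t \<otimes> inv g"]) (auto simp: m_assoc)

lemma Lt_lp:
  assumes "g \<in> carrier G" "\<xi> \<in> lp p (carrier G)"
  shows "Lt p G g \<xi> \<in> lp p (carrier G)" and "lp_norm p (carrier G) (Lt p G g \<xi>) = lp_norm p (carrier G) \<xi>"
  using lp_relabel[OF left_mult_bij[OF assms(1)] assms(2)]
    lp_norm_relabel[OF left_mult_bij[OF assms(1)], of p \<xi>] assms(2)
  by (simp_all add: Lt_def left_translate_def)

lemma Lt_apply: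
  "\<xi> \<in> lp p (carrier G) \<Longrightarrow> t \<in> carrier G \<Longrightarrow> Lt p G g \<xi> t = \<xi> (inv g \<otimes> t)"
  by (simp add: Lt_def left_translate_def)

lemma Lt_off: "t \<notin> carrier G \<Longrightarrow> Lt p G g \<xi> t = 0"
  by (simp add: Lt_def left_translate_def)

lemma Lt_bounded: "g \<in> carrier G \<Longrightarrow> Lt p G g \<in> bounded_operators p (carrier G)"
proof (rule bounded_operatorsI[where C = 1])
  fix \<xi> \<eta> and c :: complex
  show "\<xi> \<in> lp p (carrier G) \<Longrightarrow> \<eta> \<in> lp p (carrier G) \<Longrightarrow>
      Lt p G g (\<lambda>t. \<xi> t + \<eta> t) = (\<lambda>t. Lt p G g \<xi> t + Lt p G g \<eta> t)"
    "\<xi> \<in> lp p (carrier G) \<Longrightarrow> Lt p G g (\<lambda>t. c * \<xi> t) = (\<lambda>t. c * Lt p G g \<xi> t)"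
    by (auto simp: Lt_def left_translate_def fun_eq_iff lp_add(1)[OF p] lp_scale(1)[OF p])
qed (auto simp: Lt_lp, simp add: Lt_def)

lemma Lt_unit_vector:
  assumes "g \<in> carrier G" "t \<in> carrier G"
  shows "Lt p G g (unit_vector t) = unit_vector (g \<otimes> t)"
proof -
  have "inv g \<otimes> s = t \<longleftrightarrow> s = g \<otimes> t" if "s \<in> carrier G" for s
    using assms that by (metis inv_solve_left)
  then show ?thesis
    using assms unit_vector_lp(1)[OF assms(2), of p]
    by (auto simp: Lt_def left_translate_def unit_vector_def fun_eq_iff)
qed

lemma Lt_comp:
  assumes "g \<in> carrier G" "h \<in> carrier G"
  shows "Lt p G g \<circ> Lt p G h = Lt p G (g \<otimes> h)"
proof
  fix \<xi>
  show "(Lt p G g \<circ> Lt p G h) \<xi> = Lt p G (g \<otimes> h) \<xi>"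
  proof (cases "\<xi> \<in> lp p (carrier G)")
    case True
    show ?thesis
    proof
      fix t
      show "(Lt p G g \<circ> Lt p G h) \<xi> t = Lt p G (g \<otimes> h) \<xi> t"
      proof (cases "t \<in> carrier G")
        case t: True
        then show ?thesis
          using assms True Lt_lp(1)[of h \<xi>] by (simp add: Lt_apply inv_mult_group m_assoc)
      qed (simp add: Lt_off)
    qed
  next
    case False
    then show ?thesis by (simp add: Lt_def left_translate_def)
  qed
qed

lemma Lt_one: "Lt p G \<one> = id_operator p (carrier G)"
  by (auto simp: Lt_def left_translate_def id_operator_def fun_eq_iff lp_zero_off)

end

text \<open>
  The left regular representation of an element of the complex group algebra.
\<close>

definition translation_sum ::
    "real \<Rightarrow> ('a, 'm) monoid_scheme \<Rightarrow> 'a set \<Rightarrow> ('a \<Rightarrow> complex) \<Rightarrow> 'a lp_operator" where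
  "translation_sum p G F c = (\<lambda>\<xi> t. \<Sum>g\<in>F. c g * Lt p G g \<xi> t)"

context lp_group
begin

lemma translation_sum_bounded:
  "finite F \<Longrightarrow> F \<subseteq> carrier G \<Longrightarrow> translation_sum p G F c \<in> bounded_operators p (carrier G)"
  unfolding translation_sum_def by (rule bounded_operators_sum[OF p]) (auto intro: Lt_bounded)

lemma translation_sum_norm:
  assumes "finite F" "F \<subseteq> carrier G" "\<xi> \<in> lp p (carrier G)"
  shows "lp_norm p (carrier G) (translation_sum p G F c \<xi>) \<le> (\<Sum>g\<in>F. cmod (c g)) * lp_norm p (carrier G) \<xi>"
proof -
  have "lp_norm p (carrier G) (translation_sum p G F c \<xi>)
      \<le> (\<Sum>g\<in>F. cmod (c g) * lp_norm p (carrier G) (Lt p G g \<xi>))"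
    unfolding translation_sum_def using assms by (intro lp_sum(2)[OF p]) (auto intro: Lt_lp)
  also have "\<dots> = (\<Sum>g\<in>F. cmod (c g) * lp_norm p (carrier G) \<xi>)"
    using assms by (intro sum.cong) (auto simp: Lt_lp)
  finally show ?thesis by (simp add: sum_distrib_right)
qed

lemma lambda_p_apply:
  "\<xi> \<in> lp p (carrier G) \<Longrightarrow> s \<in> carrier G \<Longrightarrow>
    lambda_p p G f \<xi> s = (\<Sum>\<^sub>\<infinity>t\<in>carrier G. f t * \<xi> (inv t \<otimes> s))"
  by (simp add: lambda_p_def convolution_def)

lemma lambda_p_off: "s \<notin> carrier G \<Longrightarrow> lambda_p p G f \<xi> s = 0"
  by (simp add: lambda_p_def convolution_def)

lemma convolution_summable:
  assumes f: "f \<in> lp 1 (carrier G)" and \<xi>: "\<xi> \<in> lp p (carrier G)"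
  shows "(\<lambda>t. f t * \<xi> (inv t \<otimes> s)) summable_on carrier G"
proof (rule abs_summable_summable, rule summable_on_comparison_test)
  show "(\<lambda>t. cmod (f t) * lp_norm p (carrier G) \<xi>) summable_on carrier G"
    using lp_summable[OF f] by (auto intro!: summable_on_cmult_left)
  show "cmod (f t * \<xi> (inv t \<otimes> s)) \<le> cmod (f t) * lp_norm p (carrier G) \<xi>" for t
    using cmod_le_lp_norm[OF p \<xi>] by (simp add: norm_mult mult_left_mono)
qed auto

lemma lambda_p_finite:
  assumes "finite F" "F \<subseteq> carrier G"
  shows "lambda_p p G (\<lambda>t. if t \<in> F then c t else 0) = translation_sum p G F c"
proof -
  have "lambda_p p G (\<lambda>t. if t \<in> F then c t else 0) \<xi> s = translation_sum p G F c \<xi> s" for \<xi> s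
  proof (cases "\<xi> \<in> lp p (carrier G) \<and> s \<in> carrier G")
    case True
    then have "lambda_p p G (\<lambda>t. if t \<in> F then c t else 0) \<xi> s
        = (\<Sum>\<^sub>\<infinity>t\<in>carrier G. (if t \<in> F then c t else 0) * \<xi> (inv t \<otimes> s))"
      by (simp add: lambda_p_apply)
    also have "\<dots> = (\<Sum>\<^sub>\<infinity>t\<in>F. c t * \<xi> (inv t \<otimes> s))"
      by (rule infsum_cong_neutral) (use assms in auto)
    also have "\<dots> = translation_sum p G F c \<xi> s"
      using True assms by (simp add: translation_sum_def Lt_apply)
    finally show ?thesis .
  next
    case False
    then show ?thesis
      by (cases "\<xi> \<in> lp p (carrier G)")
         (simp_all add: lambda_p_off translation_sum_def Lt_off, simp_all add: lambda_p_def Lt_def)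
  qed
  then show ?thesis by blast
qed

lemma l1_sum_le:
  assumes "f \<in> lp 1 (carrier G)" "finite F" "F \<subseteq> carrier G"
  shows "(\<Sum>t\<in>F. cmod (f t)) \<le> lp_norm 1 (carrier G) f"
  using sum_le_lp_norm_powr[OF _ assms] lp_norm_nonneg[of 1 "carrier G" f] by simp

text \<open>
  For a finitely supported \<open>f\<close> the bound is the triangle inequality, since translations are
  isometries. Finite truncations of \<open>f\<close> converge coordinatewise, and finite partial sums of the
  norm pass to the limit.
\<close>

lemma Young_lambda_p:
  assumes f: "f \<in> lp 1 (carrier G)" and \<xi>: "\<xi> \<in> lp p (carrier G)"
  shows "lambda_p p G f \<xi> \<in> lp p (carrier G)"
    and "lp_norm p (carrier G) (lambda_p p G f \<xi>) \<le> lp_norm 1 (carrier G) f * lp_norm p (carrier G) \<xi>"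
proof -
  define C where "C = lp_norm 1 (carrier G) f * lp_norm p (carrier G) \<xi>"
  have C: "0 \<le> C" by (simp add: C_def lp_norm_nonneg)
  have "(\<Sum>s\<in>A. cmod (lambda_p p G f \<xi> s) powr p) \<le> C powr p"
    if A: "finite A" "A \<subseteq> carrier G" for A
  proof (rule tendsto_upperbound)
    let ?net = "finite_subsets_at_top (carrier G)"
    have lim: "((\<lambda>F. translation_sum p G F f \<xi> s) \<longlongrightarrow> lambda_p p G f \<xi> s) ?net" if "s \<in> A" for s
    proof -
      have s: "s \<in> carrier G" using that A by auto
      have "translation_sum p G F f \<xi> s = (\<Sum>t\<in>F. f t * \<xi> (inv t \<otimes> s))" for F
        using \<xi> s by (simp add: translation_sum_def Lt_apply)
      then show ?thesis
        using infsum_tendsto[OF convolution_summable[OF f \<xi>, of s]] \<xi> s by (simp add: lambda_p_apply)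
    qed
    show "((\<lambda>F. \<Sum>s\<in>A. cmod (translation_sum p G F f \<xi> s) powr p)
        \<longlongrightarrow> (\<Sum>s\<in>A. cmod (lambda_p p G f \<xi> s) powr p)) ?net"
      using p lim by (intro tendsto_sum tendsto_powr' tendsto_norm tendsto_const) auto
    show "\<forall>\<^sub>F F in ?net. (\<Sum>s\<in>A. cmod (translation_sum p G F f \<xi> s) powr p) \<le> C powr p"
    proof (rule eventually_finite_subsets_at_top_weakI)
      fix F assume F: "finite F" "F \<subseteq> carrier G"
      have "(\<Sum>s\<in>A. cmod (translation_sum p G F f \<xi> s) powr p)
          \<le> lp_norm p (carrier G) (translation_sum p G F f \<xi>) powr p"
        by (rule sum_le_lp_norm_powr[OF p bounded_lp[OF translation_sum_bounded[OF F] \<xi>] A])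
      also have "\<dots> \<le> C powr p"
      proof (rule powr_mono2)
        have "(\<Sum>t\<in>F. cmod (f t)) * lp_norm p (carrier G) \<xi> \<le> C"
          unfolding C_def using l1_sum_le[OF f F] by (intro mult_right_mono lp_norm_nonneg)
        then show "lp_norm p (carrier G) (translation_sum p G F f \<xi>) \<le> C"
          using translation_sum_norm[OF F \<xi>, of f] by simp
      qed (use p lp_norm_nonneg in auto)
      finally show "(\<Sum>s\<in>A. cmod (translation_sum p G F f \<xi> s) powr p) \<le> C powr p" .
    qed
  qed simp
  from lp_finite_sum_bound[OF p lambda_p_off C this] show
    "lambda_p p G f \<xi> \<in> lp p (carrier G)"
    "lp_norm p (carrier G) (lambda_p p G f \<xi>) \<le> lp_norm 1 (carrier G) f * lp_norm p (carrier G) \<xi>"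
    by (auto simp: C_def)
qed

lemma lambda_p_bounded:
  assumes f: "f \<in> lp 1 (carrier G)"
  shows "lambda_p p G f \<in> bounded_operators p (carrier G)"
proof (rule bounded_operatorsI[where C = "lp_norm 1 (carrier G) f"])
  fix \<xi> \<eta> and c :: complex
  assume \<xi>: "\<xi> \<in> lp p (carrier G)"
  show "lambda_p p G f (\<lambda>t. c * \<xi> t) = (\<lambda>t. c * lambda_p p G f \<xi> t)"
  proof
    fix s
    show "lambda_p p G f (\<lambda>t. c * \<xi> t) s = c * lambda_p p G f \<xi> s"
      using \<xi> lp_scale(1)[OF p \<xi>, of c] convolution_summable[OF f \<xi>, of s]
      by (cases "s \<in> carrier G")
         (simp_all add: lambda_p_apply lambda_p_off mult.left_commute[of _ c] infsum_cmult_right')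
  qed
  assume \<eta>: "\<eta> \<in> lp p (carrier G)"
  show "lambda_p p G f (\<lambda>t. \<xi> t + \<eta> t) = (\<lambda>t. lambda_p p G f \<xi> t + lambda_p p G f \<eta> t)"
  proof
    fix s
    show "lambda_p p G f (\<lambda>t. \<xi> t + \<eta> t) s = lambda_p p G f \<xi> s + lambda_p p G f \<eta> s"
      using \<xi> \<eta> lp_add(1)[OF p \<xi> \<eta>]
        infsum_add[OF convolution_summable[OF f \<xi>, of s] convolution_summable[OF f \<eta>, of s]]
      by (cases "s \<in> carrier G") (simp_all add: lambda_p_apply lambda_p_off distrib_left)
  qed
qed (use Young_lambda_p[OF f] in \<open>auto simp: lambda_p_def\<close>)

lemma lambda_p_add:
  assumes f: "f \<in> lp 1 (carrier G)" and h: "h \<in> lp 1 (carrier G)" and \<xi>: "\<xi> \<in> lp p (carrier G)"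
  shows "lambda_p p G (\<lambda>t. f t + h t) \<xi> = (\<lambda>s. lambda_p p G f \<xi> s + lambda_p p G h \<xi> s)"
proof
  fix s
  show "lambda_p p G (\<lambda>t. f t + h t) \<xi> s = lambda_p p G f \<xi> s + lambda_p p G h \<xi> s"
    using \<xi> infsum_add[OF convolution_summable[OF f \<xi>, of s] convolution_summable[OF h \<xi>, of s]]
    by (cases "s \<in> carrier G") (simp_all add: lambda_p_apply lambda_p_off distrib_right)
qed

lemma pseudofunctions_bounded: "T \<in> pseudofunctions p G \<Longrightarrow> T \<in> bounded_operators p (carrier G)"
  by (simp add: pseudofunctions_def)

text \<open>
  By Young's inequality the tail of an absolutely summable function acts with small norm, so the
  group algebra is already dense. This lemma and \<open>pseudofunctionsI\<close> together describe
  the pseudofunctions through finite sums of translations.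
\<close>

lemma pseudofunctions_approx:
  assumes T: "T \<in> pseudofunctions p G" and e: "0 < \<epsilon>"
  obtains F c where "finite F" "F \<subseteq> carrier G"
    "\<And>\<xi>. \<xi> \<in> lp p (carrier G) \<Longrightarrow>
       lp_norm p (carrier G) (\<lambda>t. T \<xi> t - translation_sum p G F c \<xi> t) \<le> \<epsilon> * lp_norm p (carrier G) \<xi>"
proof -
  have "\<epsilon> / 2 > 0" using e by simp
  then obtain f where f: "f \<in> lp 1 (carrier G)"
    and fT: "op_norm p (carrier G) (\<lambda>\<xi> t. T \<xi> t - lambda_p p G f \<xi> t) < \<epsilon> / 2"
    using T unfolding pseudofunctions_def by blast
  obtain F where F: "finite F" "F \<subseteq> carrier G"
    "lp_norm 1 (carrier G) (\<lambda>t. if t \<in> F then 0 else f t) < \<epsilon> / 2"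
    using lp_truncate[OF _ f \<open>\<epsilon> / 2 > 0\<close>] by auto
  let ?h = "\<lambda>t. if t \<in> F then f t else 0" and ?r = "\<lambda>t. if t \<in> F then 0 else f t"
  have r: "?r \<in> lp 1 (carrier G)" using lp_dominated(1)[OF _ f, of ?r] lp_zero_off[OF f] by auto
  have h: "?h \<in> lp 1 (carrier G)" using lp_dominated(1)[OF _ f, of ?h] lp_zero_off[OF f] by auto
  have D: "(\<lambda>\<xi> t. T \<xi> t - lambda_p p G f \<xi> t) \<in> bounded_operators p (carrier G)"
    using bounded_operators_diff[OF p pseudofunctions_bounded[OF T] lambda_p_bounded[OF f]] .
  have fhr: "f = (\<lambda>t. ?h t + ?r t)" by auto
  show ?thesis
  proof (rule that[OF F(1,2), of f])
    fix \<xi> assume \<xi>: "\<xi> \<in> lp p (carrier G)"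
    define n where "n = lp_norm p (carrier G) \<xi>"
    have n: "n \<ge> 0" by (simp add: n_def lp_norm_nonneg)
    have "lambda_p p G f \<xi> = (\<lambda>s. lambda_p p G ?h \<xi> s + lambda_p p G ?r \<xi> s)"
      by (subst fhr, rule lambda_p_add[OF h r \<xi>])
    then have "(\<lambda>t. T \<xi> t - translation_sum p G F f \<xi> t)
        = (\<lambda>t. (T \<xi> t - lambda_p p G f \<xi> t) + lambda_p p G ?r \<xi> t)"
      by (simp add: lambda_p_finite[OF F(1,2)] fun_eq_iff)
    then have "lp_norm p (carrier G) (\<lambda>t. T \<xi> t - translation_sum p G F f \<xi> t)
        \<le> lp_norm p (carrier G) (\<lambda>t. T \<xi> t - lambda_p p G f \<xi> t) + lp_norm p (carrier G) (lambda_p p G ?r \<xi>)"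
      using lp_add(2)[OF p bounded_lp[OF D \<xi>] Young_lambda_p(1)[OF r \<xi>]] by simp
    also have "\<dots> \<le> \<epsilon> / 2 * n + \<epsilon> / 2 * n"
    proof (rule add_mono)
      show "lp_norm p (carrier G) (\<lambda>t. T \<xi> t - lambda_p p G f \<xi> t) \<le> \<epsilon> / 2 * n"
        using op_norm_bound[OF p D \<xi>] mult_right_mono[OF less_imp_le[OF fT] n] by (simp add: n_def)
      show "lp_norm p (carrier G) (lambda_p p G ?r \<xi>) \<le> \<epsilon> / 2 * n"
        using Young_lambda_p(2)[OF r \<xi>] mult_right_mono[OF less_imp_le[OF F(3)] n] by (simp add: n_def)
    qed
    finally show "lp_norm p (carrier G) (\<lambda>t. T \<xi> t - translation_sum p G F f \<xi> t)
        \<le> \<epsilon> * lp_norm p (carrier G) \<xi>" by (simp add: n_def)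
  qed
qed

lemma pseudofunctionsI:
  assumes T: "T \<in> bounded_operators p (carrier G)"
    and approx: "\<And>\<epsilon>. 0 < \<epsilon> \<Longrightarrow> \<exists>F c. finite F \<and> F \<subseteq> carrier G \<and> (\<forall>\<xi>\<in>lp p (carrier G).
       lp_norm p (carrier G) (\<lambda>t. T \<xi> t - translation_sum p G F c \<xi> t) \<le> \<epsilon> * lp_norm p (carrier G) \<xi>)"
  shows "T \<in> pseudofunctions p G"
  unfolding pseudofunctions_def
proof (intro CollectI conjI allI impI)
  fix \<epsilon> :: real assume e: "0 < \<epsilon>"
  then have "0 < \<epsilon> / 2" by simp
  from approx[OF this] obtain F c where F: "finite F" "F \<subseteq> carrier G"
    and b: "\<And>\<xi>. \<xi> \<in> lp p (carrier G) \<Longrightarrow>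
       lp_norm p (carrier G) (\<lambda>t. T \<xi> t - translation_sum p G F c \<xi> t) \<le> \<epsilon> / 2 * lp_norm p (carrier G) \<xi>"
    by blast
  let ?f = "\<lambda>t. if t \<in> F then c t else 0"
  have "op_norm p (carrier G) (\<lambda>\<xi> t. T \<xi> t - lambda_p p G ?f \<xi> t) \<le> \<epsilon> / 2"
    using e b by (intro op_norm_le) (auto simp: lambda_p_finite[OF F])
  moreover have "?f \<in> lp 1 (carrier G)" by (rule lp_finite_support[OF _ F]) auto
  ultimately show "\<exists>f\<in>lp 1 (carrier G). op_norm p (carrier G) (\<lambda>\<xi> t. T \<xi> t - lambda_p p G f \<xi> t) < \<epsilon>"
    using e by (intro bexI[of _ ?f]) auto
qed (rule T)

lemma translation_sum_pseudofunction:
  assumes "finite F" "F \<subseteq> carrier G"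
  shows "translation_sum p G F c \<in> pseudofunctions p G"
  by (rule pseudofunctionsI[OF translation_sum_bounded[OF assms]])
     (use assms in \<open>auto intro!: exI[of _ F] exI[of _ c] simp: lp_norm_nonneg\<close>)

lemma Lt_pseudofunction:
  assumes "g \<in> carrier G"
  shows "Lt p G g \<in> pseudofunctions p G"
  using translation_sum_pseudofunction[of "{g}" "\<lambda>_. 1"] assms by (simp add: translation_sum_def)

lemma id_pseudofunction: "id_operator p (carrier G) \<in> pseudofunctions p G"
  using Lt_pseudofunction[OF one_closed] by (simp add: Lt_one)

lemma translation_sum_superset:
  assumes "finite F'" "F \<subseteq> F'"
  shows "translation_sum p G F' (\<lambda>g. if g \<in> F then c g else 0) = translation_sum p G F c"
proof -
  have "(\<Sum>g\<in>F'. (if g \<in> F then c g else 0) * Lt p G g \<xi> t) = (\<Sum>g\<in>F. c g * Lt p G g \<xi> t)" for \<xi> t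
    using assms by (intro sum.mono_neutral_cong_right) auto
  then show ?thesis by (simp add: translation_sum_def)
qed

lemma pseudofunctions_add:
  assumes S: "S \<in> pseudofunctions p G" and T: "T \<in> pseudofunctions p G"
  shows "(\<lambda>\<xi> t. S \<xi> t + T \<xi> t) \<in> pseudofunctions p G"
proof (rule pseudofunctionsI)
  note bS = pseudofunctions_bounded[OF S] and bT = pseudofunctions_bounded[OF T]
  show "(\<lambda>\<xi> t. S \<xi> t + T \<xi> t) \<in> bounded_operators p (carrier G)"
    by (rule bounded_operators_add[OF p bS bT])
  fix \<epsilon> :: real assume "0 < \<epsilon>"
  then have e: "0 < \<epsilon> / 2" by simp
  obtain F c where F: "finite F" "F \<subseteq> carrier G"
    and c: "\<And>\<xi>. \<xi> \<in> lp p (carrier G) \<Longrightarrow>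
       lp_norm p (carrier G) (\<lambda>t. S \<xi> t - translation_sum p G F c \<xi> t) \<le> \<epsilon> / 2 * lp_norm p (carrier G) \<xi>"
    using pseudofunctions_approx[OF S e] by blast
  obtain E d where E: "finite E" "E \<subseteq> carrier G"
    and d: "\<And>\<xi>. \<xi> \<in> lp p (carrier G) \<Longrightarrow>
       lp_norm p (carrier G) (\<lambda>t. T \<xi> t - translation_sum p G E d \<xi> t) \<le> \<epsilon> / 2 * lp_norm p (carrier G) \<xi>"
    using pseudofunctions_approx[OF T e] by blast
  define k where "k = (\<lambda>g. (if g \<in> F then c g else 0) + (if g \<in> E then d g else 0))"
  have "translation_sum p G (F \<union> E) k \<xi> t = translation_sum p G F c \<xi> t + translation_sum p G E d \<xi> t" for \<xi> t
    using fun_cong[OF fun_cong[OF translation_sum_superset[of "F \<union> E" F c]]]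
      fun_cong[OF fun_cong[OF translation_sum_superset[of "F \<union> E" E d]]] F E
    by (simp add: k_def translation_sum_def distrib_right sum.distrib)
  then have "lp_norm p (carrier G) (\<lambda>t. S \<xi> t + T \<xi> t - translation_sum p G (F \<union> E) k \<xi> t)
      \<le> \<epsilon> * lp_norm p (carrier G) \<xi>" if \<xi>: "\<xi> \<in> lp p (carrier G)" for \<xi>
    using lp_add(2)[OF p
        bounded_lp[OF bounded_operators_diff[OF p bS translation_sum_bounded[OF F, of c]] \<xi>]
        bounded_lp[OF bounded_operators_diff[OF p bT translation_sum_bounded[OF E, of d]] \<xi>]]
      c[OF \<xi>] d[OF \<xi>] by (simp add: algebra_simps)
  then show "\<exists>F c. finite F \<and> F \<subseteq> carrier G \<and> (\<forall>\<xi>\<in>lp p (carrier G).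
       lp_norm p (carrier G) (\<lambda>t. S \<xi> t + T \<xi> t - translation_sum p G F c \<xi> t) \<le> \<epsilon> * lp_norm p (carrier G) \<xi>)"
    using F E by (intro exI[of _ "F \<union> E"] exI[of _ k]) auto
qed

lemma pseudofunctions_scale:
  assumes S: "S \<in> pseudofunctions p G"
  shows "(\<lambda>\<xi> t. a * S \<xi> t) \<in> pseudofunctions p G"
proof (rule pseudofunctionsI)
  note bS = pseudofunctions_bounded[OF S]
  show "(\<lambda>\<xi> t. a * S \<xi> t) \<in> bounded_operators p (carrier G)"
    by (rule bounded_operators_scale[OF p bS])
  fix \<epsilon> :: real assume "0 < \<epsilon>"
  then have e: "0 < \<epsilon> / (cmod a + 1)" by (simp add: add_nonneg_pos)
  obtain F c where F: "finite F" "F \<subseteq> carrier G"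
    and c: "\<And>\<xi>. \<xi> \<in> lp p (carrier G) \<Longrightarrow>
       lp_norm p (carrier G) (\<lambda>t. S \<xi> t - translation_sum p G F c \<xi> t)
         \<le> \<epsilon> / (cmod a + 1) * lp_norm p (carrier G) \<xi>"
    using pseudofunctions_approx[OF S e] by blast
  have "lp_norm p (carrier G) (\<lambda>t. a * S \<xi> t - translation_sum p G F (\<lambda>g. a * c g) \<xi> t)
      \<le> \<epsilon> * lp_norm p (carrier G) \<xi>" if \<xi>: "\<xi> \<in> lp p (carrier G)" for \<xi>
  proof -
    have "(\<lambda>t. a * S \<xi> t - translation_sum p G F (\<lambda>g. a * c g) \<xi> t)
        = (\<lambda>t. a * (S \<xi> t - translation_sum p G F c \<xi> t))"
      by (simp add: translation_sum_def right_diff_distrib sum_distrib_left mult.assoc)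
    then have "lp_norm p (carrier G) (\<lambda>t. a * S \<xi> t - translation_sum p G F (\<lambda>g. a * c g) \<xi> t)
        = cmod a * lp_norm p (carrier G) (\<lambda>t. S \<xi> t - translation_sum p G F c \<xi> t)"
      using lp_scale(2)[OF p bounded_lp[OF bounded_operators_diff[OF p bS translation_sum_bounded[OF F, of c]] \<xi>]]
      by simp
    also have "\<dots> \<le> cmod a * (\<epsilon> / (cmod a + 1) * lp_norm p (carrier G) \<xi>)"
      by (rule mult_left_mono[OF c[OF \<xi>]]) simp
    also have "\<dots> = (cmod a / (cmod a + 1)) * (\<epsilon> * lp_norm p (carrier G) \<xi>)" by simp
    also have "\<dots> \<le> 1 * (\<epsilon> * lp_norm p (carrier G) \<xi>)"
      using \<open>0 < \<epsilon>\<close> by (intro mult_right_mono) (auto simp: divide_le_eq add_nonneg_pos lp_norm_nonneg)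
    finally show ?thesis by simp
  qed
  then show "\<exists>F c. finite F \<and> F \<subseteq> carrier G \<and> (\<forall>\<xi>\<in>lp p (carrier G).
       lp_norm p (carrier G) (\<lambda>t. a * S \<xi> t - translation_sum p G F c \<xi> t) \<le> \<epsilon> * lp_norm p (carrier G) \<xi>)"
    using F by blast
qed

lemma pseudofunctions_diff:
  assumes S: "S \<in> pseudofunctions p G" and T: "T \<in> pseudofunctions p G"
  shows "(\<lambda>\<xi> t. S \<xi> t - T \<xi> t) \<in> pseudofunctions p G"
  using pseudofunctions_add[OF S pseudofunctions_scale[OF T, of "-1"]] by simp

text \<open>
  A continuous linear functional on the pseudofunctions is determined by its values on translations.
  Commutation with right translations, the intertwining property in the isometry argument, and
  surjectivity of the induced group homomorphism are all instances.
\<close>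

lemma vanishing_functional:
  fixes A :: "'a lp_operator \<Rightarrow> complex"
  assumes add: "\<And>S T. S \<in> pseudofunctions p G \<Longrightarrow> T \<in> pseudofunctions p G \<Longrightarrow>
      A (\<lambda>\<xi> t. S \<xi> t + T \<xi> t) = A S + A T"
    and scale: "\<And>c S. S \<in> pseudofunctions p G \<Longrightarrow> A (\<lambda>\<xi> t. c * S \<xi> t) = c * A S"
    and bound: "\<And>S. S \<in> pseudofunctions p G \<Longrightarrow> cmod (A S) \<le> C * op_norm p (carrier G) S"
    and Lt: "\<And>g. g \<in> carrier G \<Longrightarrow> A (Lt p G g) = 0"
    and T: "T \<in> pseudofunctions p G"
  shows "A T = 0"
proof -
  have sum0: "A (translation_sum p G F c) = 0" if "finite F" "F \<subseteq> carrier G" for F c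
    using that
  proof (induction F rule: finite_induct)
    case empty
    have "A (\<lambda>\<xi> t. 0 * id_operator p (carrier G) \<xi> t) = 0 * A (id_operator p (carrier G))"
      by (rule scale[OF id_pseudofunction])
    then show ?case by (simp add: translation_sum_def)
  next
    case (insert g F)
    have "translation_sum p G (insert g F) c = (\<lambda>\<xi> t. c g * Lt p G g \<xi> t + translation_sum p G F c \<xi> t)"
      using insert by (simp add: translation_sum_def)
    then show ?case
      using insert add[OF pseudofunctions_scale[OF Lt_pseudofunction, of g "c g"]
          translation_sum_pseudofunction[of F c]] scale[OF Lt_pseudofunction, of g "c g"] Lt[of g] by simp
  qed
  have "cmod (A T) \<le> 0 + e" if e: "0 < e" for e
  proof -
    define \<epsilon> where "\<epsilon> = e / (\<bar>C\<bar> + 1)"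
    have "0 < \<epsilon>" using e by (simp add: \<epsilon>_def add_nonneg_pos)
    then obtain F c where F: "finite F" "F \<subseteq> carrier G"
      and b: "\<And>\<xi>. \<xi> \<in> lp p (carrier G) \<Longrightarrow>
       lp_norm p (carrier G) (\<lambda>t. T \<xi> t - translation_sum p G F c \<xi> t) \<le> \<epsilon> * lp_norm p (carrier G) \<xi>"
      using pseudofunctions_approx[OF T] by blast
    let ?D = "\<lambda>\<xi> t. T \<xi> t - translation_sum p G F c \<xi> t"
    have D: "?D \<in> pseudofunctions p G"
      by (rule pseudofunctions_diff[OF T translation_sum_pseudofunction[OF F]])
    have "A (\<lambda>\<xi> t. ?D \<xi> t + translation_sum p G F c \<xi> t) = A ?D"
      using add[OF D translation_sum_pseudofunction[OF F, of c]] sum0[OF F] by simp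
    then have "A T = A ?D" by simp
    then have "cmod (A T) \<le> C * op_norm p (carrier G) ?D" using bound[OF D] by simp
    also have "\<dots> \<le> \<bar>C\<bar> * op_norm p (carrier G) ?D"
      using op_norm_nonneg[OF pseudofunctions_bounded[OF D]] by (intro mult_right_mono) auto
    also have "\<dots> \<le> \<bar>C\<bar> * \<epsilon>"
      using b \<open>0 < \<epsilon>\<close> by (intro mult_left_mono op_norm_le) auto
    also have "\<dots> \<le> e" using e by (simp add: \<epsilon>_def field_simps)
    finally show ?thesis by simp
  qed
  then have "cmod (A T) \<le> 0" by (rule field_le_epsilon)
  then show ?thesis by simp
qed

end

section \<open>Isometries and disjointness of supports\<close>

text \<open>
  Sum the pointwise inequality: its defect has constant sign, so the total vanishes exactly when
  the defect vanishes in every coordinate. Disjointness of supports is thus expressed by norms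
  alone.
\<close>

lemma Clarkson_identity:
  fixes p :: real
  assumes p: "1 \<le> p" "p \<noteq> 2" and \<xi>: "\<xi> \<in> lp p A" and \<eta>: "\<eta> \<in> lp p A"
  shows "(\<forall>t. \<xi> t = 0 \<or> \<eta> t = 0) \<longleftrightarrow>
    lp_norm p A (\<lambda>t. \<xi> t + \<eta> t) powr p + lp_norm p A (\<lambda>t. \<xi> t - \<eta> t) powr p
      = 2 * (lp_norm p A \<xi> powr p + lp_norm p A \<eta> powr p)"
proof -
  \<comment> \<open>The pointwise defect in Clarkson's inequality.\<close>
  define D where "D = (\<lambda>t. sgn (2 - p) * (2 * (cmod (\<xi> t) powr p + cmod (\<eta> t) powr p)
    - (cmod (\<xi> t + \<eta> t) powr p + cmod (\<xi> t - \<eta> t) powr p)))"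
  have D0: "0 \<le> D t" for t using Clarkson_pointwise(1)[OF p] by (simp add: D_def)
  have Dz: "D t = 0 \<longleftrightarrow> \<xi> t = 0 \<or> \<eta> t = 0" for t
  proof
    show "D t = 0 \<Longrightarrow> \<xi> t = 0 \<or> \<eta> t = 0"
      using Clarkson_pointwise(2)[OF p, of "\<xi> t" "\<eta> t"] unfolding D_def by fastforce
    show "\<xi> t = 0 \<or> \<eta> t = 0 \<Longrightarrow> D t = 0" by (auto simp: D_def)
  qed
  note s = lp_summable[OF \<xi>] lp_summable[OF \<eta>]
    lp_summable[OF lp_add(1)[OF p(1) \<xi> \<eta>]] lp_summable[OF lp_diff(1)[OF p(1) \<xi> \<eta>]]
  note hs = s[THEN has_sum_infsum, folded lp_norm_powr[OF p(1)]]
  have D_sum: "(D has_sum sgn (2 - p) * (2 * (lp_norm p A \<xi> powr p + lp_norm p A \<eta> powr p) -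
      (lp_norm p A (\<lambda>t. \<xi> t + \<eta> t) powr p + lp_norm p A (\<lambda>t. \<xi> t - \<eta> t) powr p))) A"
    unfolding D_def diff_conv_add_uminus[of "2 * _"]
    by (intro has_sum_cmult_right has_sum_add has_sum_uminusI hs)
  then have "(D has_sum 0) A \<longleftrightarrow> sgn (2 - p) * (2 * (lp_norm p A \<xi> powr p + lp_norm p A \<eta> powr p) -
      (lp_norm p A (\<lambda>t. \<xi> t + \<eta> t) powr p + lp_norm p A (\<lambda>t. \<xi> t - \<eta> t) powr p)) = 0"
    using has_sum_unique[OF D_sum, of 0] D_sum by (metis (no_types))
  then have "(D has_sum 0) A \<longleftrightarrow> lp_norm p A (\<lambda>t. \<xi> t + \<eta> t) powr p + lp_norm p A (\<lambda>t. \<xi> t - \<eta> t) powr p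
      = 2 * (lp_norm p A \<xi> powr p + lp_norm p A \<eta> powr p)" (is "_ \<longleftrightarrow> ?eq")
    using p(2) by (simp only: mult_eq_0_iff sgn_0_0) linarith
  moreover have "(D has_sum 0) A \<longleftrightarrow> (\<forall>t\<in>A. D t = 0)"
    using nonneg_has_sum_le_0D[of D A 0] D0 has_sum_0[of A D] by auto
  moreover have "(\<forall>t\<in>A. D t = 0) \<longleftrightarrow> (\<forall>t. \<xi> t = 0 \<or> \<eta> t = 0)"
    using Dz lp_zero_off[OF \<xi>] by metis
  ultimately show ?thesis by blast
qed

lemma isometry_disjoint_supports:
  assumes p: "1 \<le> p" "p \<noteq> 2" and U: "U \<in> bounded_operators p A"
    and iso: "\<And>\<xi>. \<xi> \<in> lp p A \<Longrightarrow> lp_norm p A (U \<xi>) = lp_norm p A \<xi>"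
    and \<xi>: "\<xi> \<in> lp p A" and \<eta>: "\<eta> \<in> lp p A" and disj: "\<And>t. \<xi> t = 0 \<or> \<eta> t = 0"
  shows "U \<xi> t = 0 \<or> U \<eta> t = 0"
proof -
  have "(\<lambda>t. \<xi> t + (- 1) * \<eta> t) \<in> lp p A" "U (\<lambda>t. \<xi> t + (- 1) * \<eta> t) = (\<lambda>t. U \<xi> t + (- 1) * U \<eta> t)"
    using bounded_add[OF U \<xi> lp_scale(1)[OF p(1) \<eta>, of "- 1"]] bounded_scale[OF U \<eta>, of "- 1"]
      lp_diff(1)[OF p(1) \<xi> \<eta>] by auto
  then have d: "lp_norm p A (\<lambda>t. U \<xi> t - U \<eta> t) = lp_norm p A (\<lambda>t. \<xi> t - \<eta> t)"
    using iso[of "\<lambda>t. \<xi> t + (- 1) * \<eta> t"] by simp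
  have a: "lp_norm p A (\<lambda>t. U \<xi> t + U \<eta> t) = lp_norm p A (\<lambda>t. \<xi> t + \<eta> t)"
    using iso[OF lp_add(1)[OF p(1) \<xi> \<eta>]] bounded_add[OF U \<xi> \<eta>] by simp
  show ?thesis
    using Clarkson_identity[OF p \<xi> \<eta>] Clarkson_identity[OF p bounded_lp[OF U \<xi>] bounded_lp[OF U \<eta>]]
      disj a d iso[OF \<xi>] iso[OF \<eta>] by simp
qed

text \<open>
  A surjective isometry sends atoms to atoms. Let \<open>f\<close> be the image of the unit vector at \<open>t\<close> and split
  it as one nonzero coordinate plus the rest. The inverse \<open>U\<close> keeps these two parts disjoint, and
  their images add up to the unit vector at \<open>t\<close>, so one of the images is that unit vector and the
  other is \<open>0\<close>. The image of the nonzero coordinate is not \<open>0\<close>; hence the rest vanishes.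
\<close>

lemma Lamperti_atom:
  assumes p: "1 \<le> p" "p \<noteq> 2"
    and T: "T \<in> bounded_operators p A" and U: "U \<in> bounded_operators p A"
    and isoT: "\<And>\<xi>. \<xi> \<in> lp p A \<Longrightarrow> lp_norm p A (T \<xi>) = lp_norm p A \<xi>"
    and isoU: "\<And>\<xi>. \<xi> \<in> lp p A \<Longrightarrow> lp_norm p A (U \<xi>) = lp_norm p A \<xi>"
    and TU: "\<And>\<xi>. \<xi> \<in> lp p A \<Longrightarrow> T (U \<xi>) = \<xi>" and UT: "\<And>\<xi>. \<xi> \<in> lp p A \<Longrightarrow> U (T \<xi>) = \<xi>"
    and t: "t \<in> A"
  obtains u c where "u \<in> A" "cmod c = 1" "T (unit_vector t) = (\<lambda>s. c * unit_vector u s)"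
proof -
  note e = unit_vector_lp[OF t, of p]
  define f where "f = T (unit_vector t)"
  have f: "f \<in> lp p A" "lp_norm p A f = 1" "U f = unit_vector t"
    using bounded_lp[OF T e(1)] isoT[OF e(1)] e(2) UT[OF e(1)] by (auto simp: f_def)
  have "f \<noteq> (\<lambda>s. 0)" using f(2) by auto
  then obtain u where u: "f u \<noteq> 0" by auto
  have uA: "u \<in> A" using u lp_zero_off[OF f(1)] by blast
  define g where "g = (\<lambda>s. f u * unit_vector u s)"
  define h where "h = (\<lambda>s. if s = u then 0 else f s)"
  have g: "g \<in> lp p A" unfolding g_def by (rule lp_scale(1)[OF p(1) unit_vector_lp(1)[OF uA]])
  have h: "h \<in> lp p A" using lp_dominated(1)[OF p(1) f(1), of h] lp_zero_off[OF f(1)] by (auto simp: h_def)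
  have fgh: "f = (\<lambda>s. g s + h s)" by (auto simp: g_def h_def unit_vector_def)
  have sum: "unit_vector t s = U g s + U h s" for s
    using bounded_add[OF U g h] f(3) fgh by metis
  have disj: "U g s = 0 \<or> U h s = 0" for s
    by (rule isometry_disjoint_supports[OF p U isoU g h]) (auto simp: g_def h_def unit_vector_def)
  have Ug: "U g = unit_vector t \<or> U g = (\<lambda>s. 0)"
  proof (cases "U g t = 0")
    case True
    then have "U g s = 0" for s
      using sum[of s] disj[of s] by (cases "s = t") (auto simp: unit_vector_def)
    then show ?thesis by auto
  next
    case False
    then have "U g s = unit_vector t s" for s
      using sum[of s] disj[of s] by (cases "s = t") (auto simp: unit_vector_def)
    then show ?thesis by auto
  qed
  moreover have "U g \<noteq> (\<lambda>s. 0)"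
  proof
    assume "U g = (\<lambda>s. 0)"
    then have "lp_norm p A g = 0" using isoU[OF g] by simp
    then have "g u = 0" using cmod_le_lp_norm[OF p(1) g, of u] by simp
    then show False using u by (simp add: g_def unit_vector_def)
  qed
  ultimately have "U g = unit_vector t" by blast
  then have fg: "f = g" using TU[OF g] by (simp add: f_def)
  have c: "cmod (f u) = 1"
    using f(2) lp_scale(2)[OF p(1) unit_vector_lp(1)[OF uA], of "f u"] unit_vector_lp(2)[OF uA, of p]
    by (subst (asm) fg) (simp add: g_def)
  have "T (unit_vector t) = g" using fg by (simp only: f_def)
  then show ?thesis unfolding g_def by (rule that[OF uA c])
qed

context lp_group
begin

text \<open>
  Left translations commute with right translations, and both sides depend continuously on \<open>T\<close>.
\<close>

lemma pseudofunction_right_invariant: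
  assumes T: "T \<in> pseudofunctions p G" and \<xi>: "\<xi> \<in> lp p (carrier G)" and k: "k \<in> carrier G" and s: "s \<in> carrier G"
  shows "T (\<lambda>t. if t \<in> carrier G then \<xi> (t \<otimes> k) else 0) s = T \<xi> (s \<otimes> k)"
proof -
  let ?R = "\<lambda>\<xi> t. if t \<in> carrier G then \<xi> (t \<otimes> k) else 0"
  have R: "?R \<xi> \<in> lp p (carrier G)" "lp_norm p (carrier G) (?R \<xi>) = lp_norm p (carrier G) \<xi>"
    using lp_relabel[OF right_mult_bij[OF k] \<xi>] lp_norm_relabel[OF right_mult_bij[OF k]] by auto
  have "T (?R \<xi>) s - T \<xi> (s \<otimes> k) = 0"
  proof (rule vanishing_functional[where C = "2 * lp_norm p (carrier G) \<xi>" and A = "\<lambda>T. T (?R \<xi>) s - T \<xi> (s \<otimes> k)"])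
    fix S assume S: "S \<in> pseudofunctions p G"
    note b = pseudofunctions_bounded[OF S]
    have "cmod (S (?R \<xi>) s - S \<xi> (s \<otimes> k)) \<le> cmod (S (?R \<xi>) s) + cmod (S \<xi> (s \<otimes> k))"
      by (rule norm_triangle_ineq4)
    also have "\<dots> \<le> lp_norm p (carrier G) (S (?R \<xi>)) + lp_norm p (carrier G) (S \<xi>)"
      by (intro add_mono cmod_le_lp_norm[OF p bounded_lp[OF b]] R(1) \<xi>)
    also have "\<dots> \<le> op_norm p (carrier G) S * lp_norm p (carrier G) \<xi> + op_norm p (carrier G) S * lp_norm p (carrier G) \<xi>"
      using op_norm_bound[OF p b R(1)] op_norm_bound[OF p b \<xi>] R(2) by (intro add_mono) auto
    finally show "cmod (S (?R \<xi>) s - S \<xi> (s \<otimes> k)) \<le> 2 * lp_norm p (carrier G) \<xi> * op_norm p (carrier G) S"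
      by (simp add: algebra_simps)
  next
    fix g assume "g \<in> carrier G"
    then show "Lt p G g (?R \<xi>) s - Lt p G g \<xi> (s \<otimes> k) = 0"
      using R(1) \<xi> s k by (simp add: Lt_apply m_assoc)
  qed (use T in \<open>auto simp: algebra_simps\<close>)
  then show ?thesis by simp
qed

text \<open>
  The unit vector at the identity is cyclic for right translations, with which pseudofunctions
  commute.
\<close>

lemma pseudofunction_eqI:
  assumes S: "S \<in> pseudofunctions p G" and T: "T \<in> pseudofunctions p G"
    and eq: "S (unit_vector \<one>) = T (unit_vector \<one>)"
  shows "S = T"
proof (rule bounded_operators_eqI[OF p pseudofunctions_bounded[OF S] pseudofunctions_bounded[OF T]])
  fix t assume t: "t \<in> carrier G"
  have R: "unit_vector t = (\<lambda>s. if s \<in> carrier G then unit_vector \<one> (s \<otimes> inv t) else 0)"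
  proof
    fix s
    have "s \<otimes> inv t = \<one> \<longleftrightarrow> s = t" if "s \<in> carrier G"
      using that t by (metis inv_closed inv_equality inv_inv r_inv)
    then show "unit_vector t s = (if s \<in> carrier G then unit_vector \<one> (s \<otimes> inv t) else 0)"
      using t by (auto simp: unit_vector_def)
  qed
  note e = unit_vector_lp(1)[OF one_closed, of p]
  show "S (unit_vector t) = T (unit_vector t)"
  proof
    fix s
    show "S (unit_vector t) s = T (unit_vector t) s"
    proof (cases "s \<in> carrier G")
      case True
      then show ?thesis
        using pseudofunction_right_invariant[OF S e inv_closed[OF t] True, folded R]
          pseudofunction_right_invariant[OF T e inv_closed[OF t] True, folded R] eq by simp
    next
      case False
      then show ?thesis
        using lp_zero_off[OF bounded_lp[OF pseudofunctions_bounded[OF S] unit_vector_lp(1)[OF t]]]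
          lp_zero_off[OF bounded_lp[OF pseudofunctions_bounded[OF T] unit_vector_lp(1)[OF t]]] by simp
    qed
  qed
qed

lemma Lt_unique:
  assumes "g \<in> carrier G" "h \<in> carrier G" "a \<noteq> 0"
    and eq: "(\<lambda>\<xi> t. a * Lt p G g \<xi> t) = (\<lambda>\<xi> t. b * Lt p G h \<xi> t)"
  shows "g = h" and "a = b"
proof -
  have "a * unit_vector g g = b * unit_vector h g"
    using fun_cong[OF fun_cong[OF eq, of "unit_vector \<one>"], of g] assms
    by (simp add: Lt_unit_vector)
  then show "g = h" "a = b" using assms(3) by (auto simp: unit_vector_def split: if_splits)
qed

text \<open>
  Lamperti's theorem determines the value at the unit vector of the identity, and a pseudofunction
  is determined by this value.
\<close>

lemma invertible_isometry_pseudofunction: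
  assumes p2: "p \<noteq> 2" and T: "T \<in> pseudofunctions p G" and U: "U \<in> pseudofunctions p G"
    and TU: "T \<circ> U = id_operator p (carrier G)" and UT: "U \<circ> T = id_operator p (carrier G)"
    and nT: "op_norm p (carrier G) T \<le> 1" and nU: "op_norm p (carrier G) U \<le> 1"
  obtains u c where "u \<in> carrier G" "cmod c = 1" "T = (\<lambda>\<xi> t. c * Lt p G u \<xi> t)"
proof -
  note bT = pseudofunctions_bounded[OF T] and bU = pseudofunctions_bounded[OF U]
  have TU': "T (U \<xi>) = \<xi>" and UT': "U (T \<xi>) = \<xi>" if "\<xi> \<in> lp p (carrier G)" for \<xi>
    using fun_cong[OF TU, of \<xi>] fun_cong[OF UT, of \<xi>] that by (auto simp: id_operator_def)
  have le: "lp_norm p (carrier G) (S \<xi>) \<le> lp_norm p (carrier G) \<xi>"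
    if "S \<in> bounded_operators p (carrier G)" "op_norm p (carrier G) S \<le> 1" "\<xi> \<in> lp p (carrier G)" for S \<xi>
    using op_norm_bound[OF p that(1,3)] mult_right_mono[OF that(2) lp_norm_nonneg[of p "carrier G" \<xi>]] by simp
  have isoT: "lp_norm p (carrier G) (T \<xi>) = lp_norm p (carrier G) \<xi>"
    and isoU: "lp_norm p (carrier G) (U \<xi>) = lp_norm p (carrier G) \<xi>" if \<xi>: "\<xi> \<in> lp p (carrier G)" for \<xi>
    using le[OF bT nT \<xi>] le[OF bU nU bounded_lp[OF bT \<xi>]] le[OF bU nU \<xi>] le[OF bT nT bounded_lp[OF bU \<xi>]]
      TU'[OF \<xi>] UT'[OF \<xi>] by auto
  obtain u c where u: "u \<in> carrier G" "cmod c = 1" "T (unit_vector \<one>) = (\<lambda>s. c * unit_vector u s)"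
    by (rule Lamperti_atom[OF p p2 bT bU isoT isoU TU' UT' one_closed])
  have "T = (\<lambda>\<xi> t. c * Lt p G u \<xi> t)"
  proof (rule pseudofunction_eqI[OF T pseudofunctions_scale[OF Lt_pseudofunction[OF u(1)]]])
    show "T (unit_vector \<one>) = (\<lambda>t. c * Lt p G u (unit_vector \<one>) t)"
      by (simp add: u(1,3) Lt_unit_vector)
  qed
  then show ?thesis by (rule that[OF u(1,2)])
qed

end

section \<open>Invariant means from almost invariant densities\<close>

text \<open>
  The supremum norm on \<open>linfty A\<close>, extended by \<open>0\<close> to all functions: a mean is looked for in the
  product, over all \<open>f\<close>, of the intervals of radius \<open>sup_bound A f\<close>, and this product is compact.
\<close>

definition sup_bound :: "'a set \<Rightarrow> ('a \<Rightarrow> real) \<Rightarrow> real" where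
  "sup_bound A f = (if f \<in> linfty A then SUP t\<in>A. \<bar>f t\<bar> else 0)"

lemma abs_le_sup_bound:
  assumes "f \<in> linfty A" "t \<in> A"
  shows "\<bar>f t\<bar> \<le> sup_bound A f"
proof -
  have "bdd_above ((\<lambda>t. \<bar>f t\<bar>) ` A)"
    using assms(1) by (fastforce simp: linfty_def bounded_iff bdd_above_def)
  then show ?thesis using assms by (auto simp: sup_bound_def intro: cSUP_upper)
qed

lemma linftyI: "(\<And>t. t \<notin> A \<Longrightarrow> f t = 0) \<Longrightarrow> (\<And>t. t \<in> A \<Longrightarrow> \<bar>f t\<bar> \<le> C) \<Longrightarrow> f \<in> linfty A"
  unfolding linfty_def bounded_iff by auto

lemma linfty_add: "f \<in> linfty A \<Longrightarrow> h \<in> linfty A \<Longrightarrow> (\<lambda>t. f t + h t) \<in> linfty A"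
proof (rule linftyI[where C = "sup_bound A f + sup_bound A h"])
  assume "f \<in> linfty A" "h \<in> linfty A"
  then show "t \<in> A \<Longrightarrow> \<bar>f t + h t\<bar> \<le> sup_bound A f + sup_bound A h" for t
    by (intro order_trans[OF abs_triangle_ineq] add_mono abs_le_sup_bound)
qed (auto simp: linfty_def)

lemma linfty_scale: "f \<in> linfty A \<Longrightarrow> (\<lambda>t. c * f t) \<in> linfty A"
proof (rule linftyI[where C = "\<bar>c\<bar> * sup_bound A f"])
  assume "f \<in> linfty A"
  then show "t \<in> A \<Longrightarrow> \<bar>c * f t\<bar> \<le> \<bar>c\<bar> * sup_bound A f" for t
    by (simp add: abs_mult mult_left_mono abs_le_sup_bound)
qed (auto simp: linfty_def)

context group
begin

text \<open>
  Choose a representative in each coset of \<open>N\<close> and let \<open>\<kappa> t\<close> be the \<open>N\<close>-part of \<open>t\<close>. Composition with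
  this equivariant map turns bounded functions on \<open>N\<close> into bounded functions on \<open>G\<close>.
\<close>

lemma coset_cocycle:
  assumes N: "subgroup N G"
  obtains \<kappa> where "\<forall>t\<in>carrier G. \<kappa> t \<in> N"
    and "\<forall>n\<in>N. \<forall>t\<in>carrier G. \<kappa> (n \<otimes> t) = n \<otimes> \<kappa> t"
proof -
  interpret N: subgroup N G by (rule N)
  define rep where "rep t = (SOME x. x \<in> N #> t)" for t
  have rep: "rep t \<in> N #> t" if "t \<in> carrier G" for t
    unfolding rep_def by (rule someI[of _ t]) (rule rcos_self[OF that N])
  have rep_mult: "rep (n \<otimes> t) = rep t" if "n \<in> N" "t \<in> carrier G" for n t
    using that coset_mult_assoc[of N n t] coset_join2[OF _ N, of n] by (simp add: rep_def N.subset)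
  have in_G: "rep t \<in> carrier G" if "t \<in> carrier G" for t
    using rep[OF that] r_coset_subset_G[OF N.subset that] by blast
  show ?thesis
  proof (rule that[of "\<lambda>t. t \<otimes> inv (rep t)"]; intro ballI)
    fix t assume t: "t \<in> carrier G"
    obtain n where n: "n \<in> N" "rep t = n \<otimes> t" using rep[OF t] by (auto simp: r_coset_def)
    then have "t \<otimes> inv (rep t) = inv n" using t by (simp add: inv_mult_group m_assoc[symmetric])
    then show "t \<otimes> inv (rep t) \<in> N" using n by simp
  next
    fix n t assume "n \<in> N" "t \<in> carrier G"
    then show "n \<otimes> t \<otimes> inv (rep (n \<otimes> t)) = n \<otimes> (t \<otimes> inv (rep t))"
      using in_G by (simp add: rep_mult m_assoc)
  qed
qed

text \<open>
  Reiter's condition gives an invariant mean. A probability density \<open>\<eta>\<close> on \<open>G\<close> yields the mean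
  \<open>f \<mapsto> \<Sum> \<eta> t * f (\<kappa> t)\<close> on \<open>N\<close>, and a translation by \<open>n\<close> changes it by at most the
  sum of \<open>\<bar>\<eta> (n t) - \<eta> t\<bar>\<close> times the supremum norm of \<open>f\<close>. Means satisfying a bound of this kind
  form closed subsets of a product of compact intervals. Finitely many of them meet, so by
  Tychonoff's theorem all of them do, and a mean in the intersection is invariant.
\<close>

lemma amenable_subgroup_if_almost_invariant:
  assumes N: "subgroup N G"
    and Reiter: "\<And>F \<epsilon>. finite F \<Longrightarrow> F \<subseteq> N \<Longrightarrow> 0 < \<epsilon> \<Longrightarrow>
      \<exists>\<eta>. (\<forall>t. 0 \<le> \<eta> t) \<and> (\<eta> has_sum 1) (carrier G) \<and>
          (\<forall>g\<in>F. (\<Sum>\<^sub>\<infinity>t\<in>carrier G. \<bar>\<eta> (inv g \<otimes> t) - \<eta> t\<bar>) \<le> (\<epsilon>::real))"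
  shows "amenable (G\<lparr>carrier := N\<rparr>)"
proof -
  interpret N: subgroup N G by (rule N)
  let ?N = "G\<lparr>carrier := N\<rparr>"
  obtain \<kappa> where \<kappa>: "\<And>t. t \<in> carrier G \<Longrightarrow> \<kappa> t \<in> N"
    and \<kappa>_mult: "\<And>n t. n \<in> N \<Longrightarrow> t \<in> carrier G \<Longrightarrow> \<kappa> (n \<otimes> t) = n \<otimes> \<kappa> t"
    using coset_cocycle[OF N] by metis
  define L where "L = linfty N"
  define B where "B = sup_bound N"
  have B: "\<bar>f t\<bar> \<le> B f" if "f \<in> L" "t \<in> N" for f t
    using abs_le_sup_bound that by (simp add: L_def B_def)
  have B0: "0 \<le> B f" for f
  proof (cases "f \<in> L")
    case True
    then show ?thesis using B[OF True N.one_closed] by simp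
  qed (simp add: B_def sup_bound_def L_def)
  have add: "(\<lambda>t. f t + h t) \<in> L" if "f \<in> L" "h \<in> L" for f h
    using that unfolding L_def by (rule linfty_add)
  have scale: "(\<lambda>t. c * f t) \<in> L" if "f \<in> L" for f c
    using that unfolding L_def by (rule linfty_scale)
  have one: "indicator N \<in> L" unfolding L_def by (rule linftyI[where C = 1]) auto
  have translate: "left_translate ?N n f \<in> L" "t \<in> N \<Longrightarrow> left_translate ?N n f t = f (inv n \<otimes> t)"
    if "f \<in> L" "n \<in> N" for f n t
  proof -
    show *: "t \<in> N \<Longrightarrow> left_translate ?N n f t = f (inv n \<otimes> t)" for t
      using that by (simp add: left_translate_def m_inv_consistent[OF N])
    show "left_translate ?N n f \<in> L"
      unfolding L_def
    proof (rule linftyI[where C = "B f"])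
      show "\<bar>left_translate ?N n f t\<bar> \<le> B f" if "t \<in> N" for t
        using *[OF that] B[OF \<open>f \<in> L\<close>] \<open>n \<in> N\<close> that by simp
    qed (simp add: left_translate_def)
  qed

  define K where "K = {m :: ('a \<Rightarrow> real) \<Rightarrow> real. \<forall>f. m f \<in> {- B f .. B f}}"
  have "K = (\<Pi>\<^sub>E f\<in>UNIV. {- B f .. B f})" by (auto simp: K_def PiE_def)
  then have "compactin (product_topology (\<lambda>_. euclidean) UNIV) K" by (simp add: compactin_PiE)
  then have compact: "compact K" by (simp add: euclidean_product_topology)
  define M where "M = {m :: ('a \<Rightarrow> real) \<Rightarrow> real.
     (\<forall>f\<in>L. \<forall>h\<in>L. m (\<lambda>t. f t + h t) = m f + m h) \<and> (\<forall>c. \<forall>f\<in>L. m (\<lambda>t. c * f t) = c * m f) \<and>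
     (\<forall>f\<in>L. (\<forall>t\<in>N. 0 \<le> f t) \<longrightarrow> 0 \<le> m f) \<and> m (indicator N) = 1}"
  define E where "E = (\<lambda>(n, k :: nat). M \<inter>
     {m. \<forall>f\<in>L. \<bar>m (left_translate ?N n f) - m f\<bar> \<le> B f / (real k + 1)})"
  have coord: "continuous_on UNIV (\<lambda>m :: ('a \<Rightarrow> real) \<Rightarrow> real. m f)" for f
    by (rule continuous_on_product_coordinates)
  have "closed M"
    unfolding M_def Ball_def
    by (intro closed_Collect_conj closed_Collect_all closed_Collect_imp closed_Collect_le
        closed_Collect_eq continuous_intros coord open_Collect_const)
  then have closed: "closed (E nk)" for nk
    unfolding E_def Ball_def case_prod_beta
    by (intro closed_Int closed_Collect_all closed_Collect_imp closed_Collect_le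
        continuous_intros coord open_Collect_const)
  have fip: "K \<inter> \<Inter> (E ` I) \<noteq> {}" if I: "finite I" "I \<subseteq> N \<times> UNIV" for I
  proof -
    obtain k0 where k0: "\<And>n k. (n, k) \<in> I \<Longrightarrow> k \<le> k0"
      using finite_nat_set_iff_bounded_le[of "snd ` I"] I(1) by force
    define \<epsilon> where "\<epsilon> = 1 / (real k0 + 1)"
    have \<epsilon>: "0 < \<epsilon>" by (simp add: \<epsilon>_def)
    have "finite ((\<lambda>(n, k). inv n) ` I)" "(\<lambda>(n, k). inv n) ` I \<subseteq> N" using I by auto
    from Reiter[OF this \<epsilon>] obtain \<eta> where \<eta>0: "\<And>t. 0 \<le> \<eta> t" and \<eta>: "(\<eta> has_sum 1) (carrier G)"
      and inv': "\<And>g. g \<in> (\<lambda>(n, k). inv n) ` I \<Longrightarrow> (\<Sum>\<^sub>\<infinity>t\<in>carrier G. \<bar>\<eta> (inv g \<otimes> t) - \<eta> t\<bar>) \<le> \<epsilon>"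
      by blast
    have inv: "(\<Sum>\<^sub>\<infinity>t\<in>carrier G. \<bar>\<eta> (inv (inv n) \<otimes> t) - \<eta> t\<bar>) \<le> \<epsilon>" if "(n, k) \<in> I" for n k
      by (rule inv') (use that in force)
    define m where "m f = (if f \<in> L then \<Sum>\<^sub>\<infinity>t\<in>carrier G. \<eta> t * f (\<kappa> t) else 0)" for f
    have bound: "\<bar>\<eta> t * f (\<kappa> t)\<bar> \<le> \<eta> t * B f" if "f \<in> L" "t \<in> carrier G" for f t
      using B[OF that(1) \<kappa>[OF that(2)]] \<eta>0 by (simp add: abs_mult mult_left_mono)
    have sB: "((\<lambda>t. \<eta> t * B f) has_sum B f) (carrier G)" for f
      using has_sum_cmult_left[OF \<eta>, of "B f"] by simp
    have summable: "(\<lambda>t. \<eta> t * f (\<kappa> t)) summable_on carrier G" if "f \<in> L" for f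
    proof (rule abs_summable_summable, rule summable_on_comparison_test[OF has_sum_imp_summable[OF sB[of f]]])
      show "norm (\<eta> t * f (\<kappa> t)) \<le> \<eta> t * B f" if "t \<in> carrier G" for t
        using bound[OF \<open>f \<in> L\<close> that] by simp
    qed simp
    have "m \<in> K"
    proof -
      have "m f \<in> {- B f .. B f}" for f
      proof (cases "f \<in> L")
        case True
        have "\<bar>m f\<bar> \<le> (\<Sum>\<^sub>\<infinity>t\<in>carrier G. \<eta> t * B f)"
          using norm_infsum_le[OF has_sum_infsum[OF summable[OF True]] sB] bound[OF True] infsumI[OF sB] True
          by (simp add: m_def)
        then show ?thesis using infsumI[OF sB] by auto
      qed (use B0 in \<open>simp add: m_def\<close>)
      then show ?thesis by (simp add: K_def)
    qed
    moreover have "m \<in> M"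
      unfolding M_def
    proof (intro CollectI conjI ballI allI impI)
      fix f h assume "f \<in> L" "h \<in> L"
      then show "m (\<lambda>t. f t + h t) = m f + m h"
        by (simp add: m_def add distrib_left infsum_add summable)
    next
      fix c f assume "f \<in> L"
      then show "m (\<lambda>t. c * f t) = c * m f"
        by (simp add: m_def scale mult.left_commute[of _ c] infsum_cmult_right')
    next
      fix f assume "f \<in> L" "\<forall>t\<in>N. 0 \<le> f t"
      then show "0 \<le> m f" using \<kappa> \<eta>0 by (auto simp: m_def intro!: infsum_nonneg)
    next
      have "(\<Sum>\<^sub>\<infinity>t\<in>carrier G. \<eta> t * indicator N (\<kappa> t)) = (\<Sum>\<^sub>\<infinity>t\<in>carrier G. \<eta> t)"
        by (rule infsum_cong) (use \<kappa> in auto)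
      then show "m (indicator N) = 1" using one infsumI[OF \<eta>] by (simp add: m_def)
    qed
    moreover have "\<bar>m (left_translate ?N n f) - m f\<bar> \<le> B f / (real k + 1)" if nk: "(n, k) \<in> I" and f: "f \<in> L" for n k f
    proof -
      have n: "n \<in> N" using nk I by auto
      then have nG: "n \<in> carrier G" by auto
      have bij: "bij_betw (\<lambda>t. n \<otimes> t) (carrier G) (carrier G)"
        using nG by (intro bij_betwI[where g = "\<lambda>t. inv n \<otimes> t"]) (auto simp: m_assoc[symmetric])
      have "m (left_translate ?N n f) = (\<Sum>\<^sub>\<infinity>t\<in>carrier G. \<eta> t * left_translate ?N n f (\<kappa> t))"
        using translate(1)[OF f n] by (simp add: m_def)
      also have "\<dots> = (\<Sum>\<^sub>\<infinity>t\<in>carrier G. \<eta> (n \<otimes> t) * left_translate ?N n f (\<kappa> (n \<otimes> t)))"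
        by (rule infsum_reindex_bij_betw[OF bij, symmetric])
      also have "\<dots> = (\<Sum>\<^sub>\<infinity>t\<in>carrier G. \<eta> (n \<otimes> t) * f (\<kappa> t))"
      proof (rule infsum_cong)
        fix t assume t: "t \<in> carrier G"
        have "left_translate ?N n f (\<kappa> (n \<otimes> t)) = f (inv n \<otimes> (n \<otimes> \<kappa> t))"
          using translate(2)[OF f n] n \<kappa>[OF t] by (simp add: \<kappa>_mult t)
        also have "inv n \<otimes> (n \<otimes> \<kappa> t) = \<kappa> t" using nG \<kappa>[OF t] by (simp add: m_assoc[symmetric])
        finally show "\<eta> (n \<otimes> t) * left_translate ?N n f (\<kappa> (n \<otimes> t)) = \<eta> (n \<otimes> t) * f (\<kappa> t)" by simp
      qed
      \<comment> \<open>Substituting \<open>n \<otimes> t\<close> has moved the translation from \<open>f\<close> to \<open>\<eta>\<close>.\<close>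
      finally have mt: "m (left_translate ?N n f) = (\<Sum>\<^sub>\<infinity>t\<in>carrier G. \<eta> (n \<otimes> t) * f (\<kappa> t))" .
      have \<eta>n: "(\<lambda>t. \<eta> (n \<otimes> t)) summable_on carrier G"
        using summable_on_reindex_bij_betw[OF bij, of \<eta>] \<eta> by (auto dest: has_sum_imp_summable)
      have ab: "(\<lambda>t. \<bar>\<eta> (n \<otimes> t) - \<eta> t\<bar>) summable_on carrier G"
      proof (rule summable_on_comparison_test[OF summable_on_add[OF \<eta>n has_sum_imp_summable[OF \<eta>]]])
        show "\<bar>\<eta> (n \<otimes> t) - \<eta> t\<bar> \<le> \<eta> (n \<otimes> t) + \<eta> t" for t
          using \<eta>0[of t] \<eta>0[of "n \<otimes> t"] by linarith
      qed simp
      have pt: "\<bar>\<eta> (n \<otimes> t) * f (\<kappa> t) - \<eta> t * f (\<kappa> t)\<bar> \<le> \<bar>\<eta> (n \<otimes> t) - \<eta> t\<bar> * B f"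
        if t: "t \<in> carrier G" for t
        using B[OF f \<kappa>[OF t]] by (simp add: abs_mult mult_left_mono flip: left_diff_distrib)
      have abB: "(\<lambda>t. \<bar>\<eta> (n \<otimes> t) - \<eta> t\<bar> * B f) summable_on carrier G"
        by (rule summable_on_cmult_left[OF ab])
      have diff: "(\<lambda>t. \<eta> (n \<otimes> t) * f (\<kappa> t) - \<eta> t * f (\<kappa> t)) summable_on carrier G"
      proof (rule abs_summable_summable, rule summable_on_comparison_test[OF abB])
        show "norm (\<eta> (n \<otimes> t) * f (\<kappa> t) - \<eta> t * f (\<kappa> t)) \<le> \<bar>\<eta> (n \<otimes> t) - \<eta> t\<bar> * B f"
          if "t \<in> carrier G" for t using pt[OF that] by simp
      qed simp
      have "m (left_translate ?N n f) - m f = (\<Sum>\<^sub>\<infinity>t\<in>carrier G. \<eta> (n \<otimes> t) * f (\<kappa> t) - \<eta> t * f (\<kappa> t))"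
        using infsum_add[OF diff summable[OF f]] f by (simp add: mt m_def[of f])
      also have "\<bar>\<dots>\<bar> \<le> (\<Sum>\<^sub>\<infinity>t\<in>carrier G. \<bar>\<eta> (n \<otimes> t) - \<eta> t\<bar> * B f)"
        using norm_infsum_le[OF has_sum_infsum[OF diff] has_sum_infsum[OF abB]] pt by simp
      also have "\<dots> = (\<Sum>\<^sub>\<infinity>t\<in>carrier G. \<bar>\<eta> (n \<otimes> t) - \<eta> t\<bar>) * B f"
        by (rule infsum_cmult_left')
      also have "\<dots> \<le> \<epsilon> * B f"
        using inv[OF nk] nG B0 by (intro mult_right_mono) auto
      also have "\<dots> \<le> B f / (real k + 1)"
        using k0[OF nk] B0[of f] by (simp add: \<epsilon>_def frac_le)
      finally show ?thesis .
    qed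
    ultimately have "m \<in> K \<inter> \<Inter> (E ` I)" by (auto simp: E_def)
    then show ?thesis by blast
  qed
  have "K \<inter> \<Inter> (E ` (N \<times> UNIV)) \<noteq> {}"
    by (rule compact_imp_fip_image[OF compact closed fip])
  then obtain m where m: "\<And>n k. n \<in> N \<Longrightarrow> m \<in> E (n, k)" by blast
  have mM: "m \<in> M" using m[OF N.one_closed] by (simp add: E_def)
  have "m (left_translate ?N n f) = m f" if n: "n \<in> N" and f: "f \<in> L" for n f
  proof -
    have "(\<lambda>k. B f / (real k + 1)) \<longlonglongrightarrow> 0"
      using LIMSEQ_Suc[OF lim_const_over_n[of "B f"]] by (simp add: add.commute)
    moreover have "\<forall>k. \<bar>m (left_translate ?N n f) - m f\<bar> \<le> B f / (real k + 1)"
      using m[OF n] f by (auto simp: E_def)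
    ultimately have "\<bar>m (left_translate ?N n f) - m f\<bar> \<le> 0"
      by (meson LIMSEQ_le_const)
    then show ?thesis by simp
  qed
  then show ?thesis using mM unfolding amenable_def M_def L_def by (intro exI[of _ m]) simp
qed

end

section \<open>Unital contractive homomorphisms\<close>

locale pf_contraction = G: lp_group G p + H: lp_group H p
  for G :: "('a, 'm) monoid_scheme" and H :: "('b, 'n) monoid_scheme" and p :: real +
  fixes \<phi> :: "'a lp_operator \<Rightarrow> 'b lp_operator"
  assumes p2: "p \<noteq> 2" and hom: "pf_hom p G H \<phi>" and unital: "pf_unital p G H \<phi>"
    and contractive: "pf_contractive p G H \<phi>"
begin

lemma phi_mem: "S \<in> pseudofunctions p G \<Longrightarrow> \<phi> S \<in> pseudofunctions p H"
  and phi_add: "S \<in> pseudofunctions p G \<Longrightarrow> T \<in> pseudofunctions p G \<Longrightarrow>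
     \<phi> (\<lambda>\<xi> t. S \<xi> t + T \<xi> t) = (\<lambda>\<xi> t. \<phi> S \<xi> t + \<phi> T \<xi> t)"
  and phi_scale: "S \<in> pseudofunctions p G \<Longrightarrow> \<phi> (\<lambda>\<xi> t. c * S \<xi> t) = (\<lambda>\<xi> t. c * \<phi> S \<xi> t)"
  and phi_comp: "S \<in> pseudofunctions p G \<Longrightarrow> T \<in> pseudofunctions p G \<Longrightarrow> \<phi> (S \<circ> T) = \<phi> S \<circ> \<phi> T"
  using hom by (auto simp: pf_hom_def)

lemma phi_norm: "S \<in> pseudofunctions p G \<Longrightarrow> op_norm p (carrier H) (\<phi> S) \<le> op_norm p (carrier G) S"
  using contractive by (simp add: pf_contractive_def)

lemma phi_id: "\<phi> (id_operator p (carrier G)) = id_operator p (carrier H)"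
  using unital by (simp add: pf_unital_def)

lemma phi_diff:
  assumes "S \<in> pseudofunctions p G" "T \<in> pseudofunctions p G"
  shows "\<phi> (\<lambda>\<xi> t. S \<xi> t - T \<xi> t) = (\<lambda>\<xi> t. \<phi> S \<xi> t - \<phi> T \<xi> t)"
  using phi_add[OF assms(1) G.pseudofunctions_scale[OF assms(2), of "-1"]] phi_scale[OF assms(2), of "-1"] by simp

text \<open>
  A translation and its inverse both have norm at most \<open>1\<close>, and so have their images.
\<close>

lemma phi_Lt:
  assumes g: "g \<in> carrier G"
  obtains h c where "h \<in> carrier H" "cmod c = 1" "\<phi> (Lt p G g) = (\<lambda>\<xi> t. c * Lt p H h \<xi> t)"
proof (rule H.invertible_isometry_pseudofunction[OF p2])
  note i = G.inv_closed[OF g]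
  show "\<phi> (Lt p G g) \<in> pseudofunctions p H" "\<phi> (Lt p G (inv\<^bsub>G\<^esub> g)) \<in> pseudofunctions p H"
    by (auto intro: phi_mem G.Lt_pseudofunction g i)
  show "\<phi> (Lt p G g) \<circ> \<phi> (Lt p G (inv\<^bsub>G\<^esub> g)) = id_operator p (carrier H)"
    "\<phi> (Lt p G (inv\<^bsub>G\<^esub> g)) \<circ> \<phi> (Lt p G g) = id_operator p (carrier H)"
    using phi_comp[OF G.Lt_pseudofunction[OF g] G.Lt_pseudofunction[OF i]]
      phi_comp[OF G.Lt_pseudofunction[OF i] G.Lt_pseudofunction[OF g]]
      G.Lt_comp[OF g i] G.Lt_comp[OF i g] g by (simp_all add: G.Lt_one phi_id)
  have "op_norm p (carrier G) (Lt p G k) \<le> 1" if "k \<in> carrier G" for k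
    by (rule op_norm_le) (auto simp: G.Lt_lp that)
  then show "op_norm p (carrier H) (\<phi> (Lt p G g)) \<le> 1" "op_norm p (carrier H) (\<phi> (Lt p G (inv\<^bsub>G\<^esub> g))) \<le> 1"
    using phi_norm[OF G.Lt_pseudofunction] g i by (meson order_trans)+
qed (rule that)

text \<open>
  Apply \<open>\<phi>\<close> to the product of two translations. Both \<open>\<theta>\<close> and \<open>\<gamma>\<close> come out multiplicative because
  an operator \<open>c * Lt h\<close> with \<open>c \<noteq> 0\<close> determines \<open>c\<close> and \<open>h\<close>.
\<close>

lemma induced_homs:
  obtains \<theta> \<gamma> where "\<theta> \<in> hom G H" "\<gamma> \<in> hom G circle_group"
    "\<forall>g\<in>carrier G. \<phi> (Lt p G g) = (\<lambda>\<xi> t. \<gamma> g * Lt p H (\<theta> g) \<xi> t)"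
proof -
  have "\<forall>g\<in>carrier G. \<exists>hc. fst hc \<in> carrier H \<and> cmod (snd hc) = 1 \<and>
      \<phi> (Lt p G g) = (\<lambda>\<xi> t. snd hc * Lt p H (fst hc) \<xi> t)"
  proof
    fix g assume "g \<in> carrier G"
    then obtain h c where "h \<in> carrier H" "cmod c = 1" "\<phi> (Lt p G g) = (\<lambda>\<xi> t. c * Lt p H h \<xi> t)"
      by (rule phi_Lt)
    then show "\<exists>hc. fst hc \<in> carrier H \<and> cmod (snd hc) = 1 \<and>
      \<phi> (Lt p G g) = (\<lambda>\<xi> t. snd hc * Lt p H (fst hc) \<xi> t)" by (intro exI[of _ "(h, c)"]) simp
  qed
  from bchoice[OF this] obtain F where F: "\<forall>g\<in>carrier G. fst (F g) \<in> carrier H \<and> cmod (snd (F g)) = 1 \<and>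
      \<phi> (Lt p G g) = (\<lambda>\<xi> t. snd (F g) * Lt p H (fst (F g)) \<xi> t)" by blast
  define \<theta> \<gamma> where "\<theta> g = fst (F g)" and "\<gamma> g = snd (F g)" for g
  have \<theta>: "\<theta> g \<in> carrier H" and \<gamma>: "cmod (\<gamma> g) = 1"
    and rep: "\<phi> (Lt p G g) = (\<lambda>\<xi> t. \<gamma> g * Lt p H (\<theta> g) \<xi> t)" if "g \<in> carrier G" for g
    using F that by (auto simp: \<theta>_def \<gamma>_def)
  have mult: "\<theta> (g \<otimes>\<^bsub>G\<^esub> k) = \<theta> g \<otimes>\<^bsub>H\<^esub> \<theta> k \<and> \<gamma> (g \<otimes>\<^bsub>G\<^esub> k) = \<gamma> g * \<gamma> k"
    if g: "g \<in> carrier G" and k: "k \<in> carrier G" for g k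
  proof -
    have gk: "g \<otimes>\<^bsub>G\<^esub> k \<in> carrier G" using g k by simp
    have "(\<lambda>\<xi> t. \<gamma> (g \<otimes>\<^bsub>G\<^esub> k) * Lt p H (\<theta> (g \<otimes>\<^bsub>G\<^esub> k)) \<xi> t) = \<phi> (Lt p G g \<circ> Lt p G k)"
      using rep[OF gk] by (simp add: G.Lt_comp[OF g k])
    also have "\<dots> = \<phi> (Lt p G g) \<circ> \<phi> (Lt p G k)"
      by (rule phi_comp[OF G.Lt_pseudofunction[OF g] G.Lt_pseudofunction[OF k]])
    also have "\<dots> = (\<lambda>\<xi> t. \<gamma> g * \<gamma> k * (Lt p H (\<theta> g) \<circ> Lt p H (\<theta> k)) \<xi> t)"
    proof
      fix \<xi>
      note b = H.Lt_bounded[OF \<theta>[OF k]]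
      have "Lt p H (\<theta> k) \<xi> \<in> lp p (carrier H)"
        using bounded_lp[OF b] bounded_off[OF b] by (cases "\<xi> \<in> lp p (carrier H)") auto
      from bounded_scale[OF H.Lt_bounded[OF \<theta>[OF g]] this]
      show "(\<phi> (Lt p G g) \<circ> \<phi> (Lt p G k)) \<xi> = (\<lambda>t. \<gamma> g * \<gamma> k * (Lt p H (\<theta> g) \<circ> Lt p H (\<theta> k)) \<xi> t)"
        by (simp add: rep[OF g] rep[OF k] mult.assoc)
    qed
    also have "\<dots> = (\<lambda>\<xi> t. \<gamma> g * \<gamma> k * Lt p H (\<theta> g \<otimes>\<^bsub>H\<^esub> \<theta> k) \<xi> t)"
      by (simp add: H.Lt_comp[OF \<theta>[OF g] \<theta>[OF k]])
    finally have eq: "(\<lambda>\<xi> t. \<gamma> (g \<otimes>\<^bsub>G\<^esub> k) * Lt p H (\<theta> (g \<otimes>\<^bsub>G\<^esub> k)) \<xi> t) =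
      (\<lambda>\<xi> t. \<gamma> g * \<gamma> k * Lt p H (\<theta> g \<otimes>\<^bsub>H\<^esub> \<theta> k) \<xi> t)" .
    have "\<gamma> (g \<otimes>\<^bsub>G\<^esub> k) \<noteq> 0" using \<gamma>[OF gk] by auto
    from H.Lt_unique[OF \<theta>[OF gk] H.m_closed[OF \<theta>[OF g] \<theta>[OF k]] this eq] show ?thesis by simp
  qed
  show ?thesis
    by (rule that[of \<theta> \<gamma>]) (use \<theta> \<gamma> rep mult in \<open>auto simp: hom_def circle_group_def\<close>)
qed

end

locale pf_representation = pf_contraction G H p \<phi>
  for G :: "('a, 'm) monoid_scheme" and H :: "('b, 'n) monoid_scheme" and p \<phi> +
  fixes \<theta> :: "'a \<Rightarrow> 'b" and \<gamma> :: "'a \<Rightarrow> complex"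
  assumes \<theta>: "\<theta> \<in> hom G H" and \<gamma>: "\<gamma> \<in> hom G circle_group"
    and rep: "\<forall>g\<in>carrier G. \<phi> (Lt p G g) = (\<lambda>\<xi> t. \<gamma> g * Lt p H (\<theta> g) \<xi> t)"
begin

sublocale \<theta>: group_hom G H \<theta>
  using \<theta> by unfold_locales

lemma gamma_norm [simp]: "g \<in> carrier G \<Longrightarrow> cmod (\<gamma> g) = 1"
  using hom_in_carrier[OF \<gamma>] by (auto simp: circle_group_def)

lemma gamma_mult: "g \<in> carrier G \<Longrightarrow> k \<in> carrier G \<Longrightarrow> \<gamma> (g \<otimes>\<^bsub>G\<^esub> k) = \<gamma> g * \<gamma> k"
  using hom_mult[OF \<gamma>] by (simp add: circle_group_def)

lemma isometric_imp_injective: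
  assumes "pf_isometric p G H \<phi>"
  shows "inj_on \<phi> (pseudofunctions p G)"
proof (rule inj_onI)
  fix S T assume S: "S \<in> pseudofunctions p G" and T: "T \<in> pseudofunctions p G" and eq: "\<phi> S = \<phi> T"
  let ?D = "\<lambda>\<xi> t. S \<xi> t - T \<xi> t"
  have D: "?D \<in> pseudofunctions p G" by (rule G.pseudofunctions_diff[OF S T])
  have "op_norm p (carrier G) ?D = op_norm p (carrier H) (\<phi> ?D)"
    using assms D by (simp add: pf_isometric_def)
  also have "\<phi> ?D = (\<lambda>\<xi> t. 0)" using phi_diff[OF S T] eq by simp
  also have "op_norm p (carrier H) (\<lambda>\<xi> t. 0 :: complex) \<le> 0" by (rule op_norm_le) auto
  finally have n: "op_norm p (carrier G) ?D \<le> 0" .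
  note b = G.pseudofunctions_bounded
  show "S = T"
  proof
    fix \<xi>
    show "S \<xi> = T \<xi>"
    proof (cases "\<xi> \<in> lp p (carrier G)")
      case True
      have "lp_norm p (carrier G) (?D \<xi>) \<le> 0"
        using op_norm_bound[OF G.p b[OF D] True] mult_nonpos_nonneg[OF n lp_norm_nonneg]
        by (rule order_trans)
      then have zero: "lp_norm p (carrier G) (?D \<xi>) = 0" using lp_norm_nonneg by (rule order_antisym)
      have "?D \<xi> = (\<lambda>t. 0)"
        by (rule lp_norm_eq_0[OF G.p bounded_lp[OF b[OF D] True] zero])
      then show ?thesis by (simp add: fun_eq_iff)
    next
      case False
      then show ?thesis using bounded_off[OF b[OF S]] bounded_off[OF b[OF T]] by simp
    qed
  qed
qed

text \<open>
  If \<open>\<theta>\<close> identifies two elements, then \<open>\<phi>\<close> identifies suitable unimodular multiples of their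
  translations.
\<close>

lemma injective_imp_theta_injective:
  assumes inj: "inj_on \<phi> (pseudofunctions p G)"
  shows "inj_on \<theta> (carrier G)"
proof (rule inj_onI)
  fix g k assume g: "g \<in> carrier G" and k: "k \<in> carrier G" and eq: "\<theta> g = \<theta> k"
  have nz: "\<gamma> g \<noteq> 0" "\<gamma> k \<noteq> 0" using gamma_norm g k by fastforce+
  have "\<phi> (\<lambda>\<xi> t. \<gamma> k * Lt p G g \<xi> t) = \<phi> (\<lambda>\<xi> t. \<gamma> g * Lt p G k \<xi> t)"
    using phi_scale[OF G.Lt_pseudofunction[OF g], of "\<gamma> k"] phi_scale[OF G.Lt_pseudofunction[OF k], of "\<gamma> g"]
      rep g k eq by (simp add: mult.left_commute)
  then have "(\<lambda>\<xi> t. \<gamma> k * Lt p G g \<xi> t) = (\<lambda>\<xi> t. \<gamma> g * Lt p G k \<xi> t)"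
    using inj_onD[OF inj] G.pseudofunctions_scale[OF G.Lt_pseudofunction] g k by blast
  then show "g = k" by (rule G.Lt_unique(1)[OF g k nz(2)])
qed

text \<open>
  Transport \<open>\<ell>\<^sup>p(G)\<close> onto the functions supported on the image of \<open>\<theta>\<close>, twisted by \<open>\<gamma>\<close>. The resulting
  isometry \<open>V\<close> intertwines \<open>S\<close> and \<open>\<phi> S\<close>: this holds for translations because \<open>\<gamma>\<close> is
  multiplicative, hence for every pseudofunction. So \<open>S\<close> is a restriction of \<open>\<phi> S\<close> up to isometry, and
  its norm is not larger; contractivity is the other inequality.
\<close>

lemma theta_injective_imp_isometric:
  assumes inj: "inj_on \<theta> (carrier G)"
  shows "pf_isometric p G H \<phi>"
proof -
  let ?I = "\<theta> ` carrier G"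
  define V where "V \<xi> h = (if h \<in> ?I then \<gamma> (inv_into (carrier G) \<theta> h) * \<xi> (inv_into (carrier G) \<theta> h) else 0)" for \<xi> h
  have V_apply: "V \<xi> (\<theta> g) = \<gamma> g * \<xi> g" if "g \<in> carrier G" for \<xi> g
    using that inj by (simp add: V_def)
  have V_off: "V \<xi> h = 0" if "h \<notin> ?I" for \<xi> h using that by (simp add: V_def)
  have V: "V \<xi> \<in> lp p (carrier H)" "lp_norm p (carrier H) (V \<xi>) = lp_norm p (carrier G) \<xi>"
    if \<xi>: "\<xi> \<in> lp p (carrier G)" for \<xi>
  proof -
    let ?\<gamma>\<xi> = "\<lambda>g. \<gamma> g * \<xi> g"
    have \<gamma>\<xi>: "?\<gamma>\<xi> \<in> lp p (carrier G)"
      by (rule lp_dominated(1)[OF G.p \<xi>]) (auto simp: norm_mult lp_zero_off[OF \<xi>])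
    have "(\<Sum>\<^sub>\<infinity>t\<in>carrier G. cmod (\<gamma> t * \<xi> t) powr p) = (\<Sum>\<^sub>\<infinity>t\<in>carrier G. cmod (\<xi> t) powr p)"
      by (rule infsum_cong) (simp add: norm_mult)
    then have n: "lp_norm p (carrier G) ?\<gamma>\<xi> = lp_norm p (carrier G) \<xi>" by (simp add: lp_norm_def)
    have bij: "bij_betw (inv_into (carrier G) \<theta>) ?I (carrier G)"
      by (rule bij_betw_inv_into) (simp add: inj bij_betw_def)
    have Veq: "V \<xi> = (\<lambda>h. if h \<in> ?I then ?\<gamma>\<xi> (inv_into (carrier G) \<theta> h) else 0)"
      by (simp add: V_def fun_eq_iff)
    have I: "V \<xi> \<in> lp p ?I" "lp_norm p ?I (V \<xi>) = lp_norm p (carrier G) \<xi>"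
      unfolding Veq using lp_relabel[OF bij \<gamma>\<xi>] lp_norm_relabel[OF bij, of p ?\<gamma>\<xi>] n by auto
    have "?I \<subseteq> carrier H" by auto
    from lp_superset[OF this I(1)] I(2)
    show "V \<xi> \<in> lp p (carrier H)" "lp_norm p (carrier H) (V \<xi>) = lp_norm p (carrier G) \<xi>" by auto
  qed
  have V_add: "V (\<lambda>t. \<xi> t + \<eta> t) = (\<lambda>t. V \<xi> t + V \<eta> t)" and V_scale: "V (\<lambda>t. c * \<xi> t) = (\<lambda>t. c * V \<xi> t)" for \<xi> \<eta> c
    by (auto simp: V_def fun_eq_iff algebra_simps)
  have intertwine: "\<phi> S (V \<xi>) = V (S \<xi>)" if S: "S \<in> pseudofunctions p G" and \<xi>: "\<xi> \<in> lp p (carrier G)" for S \<xi>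
  proof
    fix s
    have "\<phi> S (V \<xi>) s - V (S \<xi>) s = 0"
    proof (rule G.vanishing_functional[where C = "2 * lp_norm p (carrier G) \<xi>" and A = "\<lambda>S. \<phi> S (V \<xi>) s - V (S \<xi>) s", OF _ _ _ _ S])
      fix S assume S: "S \<in> pseudofunctions p G"
      note b = G.pseudofunctions_bounded[OF S] and b' = H.pseudofunctions_bounded[OF phi_mem[OF S]]
      have "cmod (\<phi> S (V \<xi>) s - V (S \<xi>) s) \<le> cmod (\<phi> S (V \<xi>) s) + cmod (V (S \<xi>) s)"
        by (rule norm_triangle_ineq4)
      also have "\<dots> \<le> lp_norm p (carrier H) (\<phi> S (V \<xi>)) + lp_norm p (carrier H) (V (S \<xi>))"
        by (intro add_mono cmod_le_lp_norm[OF G.p] bounded_lp[OF b'] V bounded_lp[OF b] \<xi>)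
      also have "\<dots> \<le> op_norm p (carrier G) S * lp_norm p (carrier G) \<xi> + op_norm p (carrier G) S * lp_norm p (carrier G) \<xi>"
        using op_norm_bound[OF G.p b' V(1)[OF \<xi>]] op_norm_bound[OF G.p b \<xi>] V(2)[OF \<xi>]
          V(2)[OF bounded_lp[OF b \<xi>]] mult_right_mono[OF phi_norm[OF S] lp_norm_nonneg[of p "carrier G" \<xi>]]
        by (intro add_mono) auto
      finally show "cmod (\<phi> S (V \<xi>) s - V (S \<xi>) s) \<le> 2 * lp_norm p (carrier G) \<xi> * op_norm p (carrier G) S"
        by (simp add: algebra_simps)
    next
      fix g assume g: "g \<in> carrier G"
      have "\<gamma> g * Lt p H (\<theta> g) (V \<xi>) s = V (Lt p G g \<xi>) s"
      proof (cases "s \<in> ?I")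
        case True
        then obtain t where t: "t \<in> carrier G" "s = \<theta> t" by auto
        have k: "inv\<^bsub>G\<^esub> g \<otimes>\<^bsub>G\<^esub> t \<in> carrier G" using g t by simp
        have "inv\<^bsub>H\<^esub> (\<theta> g) \<otimes>\<^bsub>H\<^esub> s = \<theta> (inv\<^bsub>G\<^esub> g \<otimes>\<^bsub>G\<^esub> t)" using g t by simp
        then have "Lt p H (\<theta> g) (V \<xi>) s = \<gamma> (inv\<^bsub>G\<^esub> g \<otimes>\<^bsub>G\<^esub> t) * \<xi> (inv\<^bsub>G\<^esub> g \<otimes>\<^bsub>G\<^esub> t)"
          using t H.Lt_apply[OF V(1)[OF \<xi>], of s "\<theta> g"] V_apply[OF k, of \<xi>] by simp
        moreover have "\<gamma> g * \<gamma> (inv\<^bsub>G\<^esub> g \<otimes>\<^bsub>G\<^esub> t) = \<gamma> t"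
          using gamma_mult[of g "inv\<^bsub>G\<^esub> g \<otimes>\<^bsub>G\<^esub> t"] g t by (simp add: G.m_assoc[symmetric])
        ultimately show ?thesis
          using t \<xi> by (simp add: G.Lt_apply V_apply mult.assoc[symmetric])
      next
        case False
        show ?thesis
        proof (cases "s \<in> carrier H")
          case s: True
          have "inv\<^bsub>H\<^esub> (\<theta> g) \<otimes>\<^bsub>H\<^esub> s \<notin> ?I"
          proof
            assume "inv\<^bsub>H\<^esub> (\<theta> g) \<otimes>\<^bsub>H\<^esub> s \<in> ?I"
            then obtain t where t: "t \<in> carrier G" "inv\<^bsub>H\<^esub> (\<theta> g) \<otimes>\<^bsub>H\<^esub> s = \<theta> t" by auto
            then have "s = \<theta> (g \<otimes>\<^bsub>G\<^esub> t)" using g s by (simp add: H.inv_solve_left')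
            then show False using False g t by blast
          qed
          then show ?thesis using False s V(1)[OF \<xi>] by (simp add: H.Lt_apply V_off)
        next
          case False
          then show ?thesis using \<open>s \<notin> ?I\<close> by (simp add: H.Lt_off V_off)
        qed
      qed
      then show "\<phi> (Lt p G g) (V \<xi>) s - V (Lt p G g \<xi>) s = 0" using rep g by simp
    qed (simp_all add: phi_add phi_scale V_add V_scale right_diff_distrib)
    then show "\<phi> S (V \<xi>) s = V (S \<xi>) s" by simp
  qed
  show ?thesis
    unfolding pf_isometric_def
  proof
    fix S assume S: "S \<in> pseudofunctions p G"
    note b = G.pseudofunctions_bounded[OF S] and b' = H.pseudofunctions_bounded[OF phi_mem[OF S]]
    have "op_norm p (carrier G) S \<le> op_norm p (carrier H) (\<phi> S)"
    proof (rule op_norm_le[OF op_norm_nonneg[OF b']])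
      fix \<xi> assume \<xi>: "\<xi> \<in> lp p (carrier G)"
      show "lp_norm p (carrier G) (S \<xi>) \<le> op_norm p (carrier H) (\<phi> S) * lp_norm p (carrier G) \<xi>"
        using op_norm_bound[OF G.p b' V(1)[OF \<xi>]] V(2)[OF \<xi>] V(2)[OF bounded_lp[OF b \<xi>]]
        by (simp add: intertwine[OF S \<xi>])
    qed
    then show "op_norm p (carrier H) (\<phi> S) = op_norm p (carrier G) S" using phi_norm[OF S] by simp
  qed
qed

end

section \<open>Amenability of the kernel\<close>

context pf_contraction
begin

lemma phi_translation_sum:
  assumes "finite F" "F \<subseteq> carrier G"
  shows "\<phi> (translation_sum p G F c) = (\<lambda>\<xi> t. \<Sum>g\<in>F. c g * \<phi> (Lt p G g) \<xi> t)"
  using assms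
proof (induction F rule: finite_induct)
  case empty
  have "\<phi> (\<lambda>\<xi> t. 0 * id_operator p (carrier G) \<xi> t) = (\<lambda>\<xi> t. 0)"
    by (subst phi_scale[OF G.id_pseudofunction]) simp
  then show ?case by (simp add: translation_sum_def)
next
  case (insert g F)
  then have g: "g \<in> carrier G" and F: "F \<subseteq> carrier G" by auto
  have "translation_sum p G (insert g F) c = (\<lambda>\<xi> t. c g * Lt p G g \<xi> t + translation_sum p G F c \<xi> t)"
    using insert by (simp add: translation_sum_def)
  then have "\<phi> (translation_sum p G (insert g F) c)
      = (\<lambda>\<xi> t. c g * \<phi> (Lt p G g) \<xi> t + \<phi> (translation_sum p G F c) \<xi> t)"
    using phi_add[OF G.pseudofunctions_scale[OF G.Lt_pseudofunction[OF g], of "c g"]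
        G.translation_sum_pseudofunction[OF insert(1) F, of c]]
      phi_scale[OF G.Lt_pseudofunction[OF g], of "c g"] by simp
  then show ?case using insert by simp
qed

end

context pf_representation
begin

lemma kernel_subset: "kernel G H \<theta> \<subseteq> carrier G"
  by (auto simp: kernel_def)

text \<open>
  On the kernel \<open>\<phi>\<close> maps translations to scalars, so the given sum is sent to \<open>card F\<close> times the
  identity. As \<open>\<phi>\<close> is contractive, no cancellation takes place in the sum on \<open>\<ell>\<^sup>p(G)\<close> either.
\<close>

lemma kernel_average_norm:
  assumes F: "finite F" "F \<subseteq> kernel G H \<theta>"
  shows "real (card F) \<le> op_norm p (carrier G) (translation_sum p G F (\<lambda>g. cnj (\<gamma> g)))"
proof -
  have FG: "F \<subseteq> carrier G" using F kernel_subset by blast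
  let ?S = "translation_sum p G F (\<lambda>g. cnj (\<gamma> g))"
  note S = G.translation_sum_pseudofunction[OF F(1) FG, of "\<lambda>g. cnj (\<gamma> g)"]
  let ?e = "unit_vector \<one>\<^bsub>H\<^esub>"
  note e = unit_vector_lp[OF H.one_closed, of p]
  have "cnj (\<gamma> g) * \<phi> (Lt p G g) ?e t = ?e t" if "g \<in> F" for g t
  proof -
    have g: "g \<in> carrier G" "\<theta> g = \<one>\<^bsub>H\<^esub>" using that F by (auto simp: kernel_def)
    have "cnj (\<gamma> g) * \<gamma> g = 1" using gamma_norm[OF g(1)] by (metis complex_norm_square mult.commute of_real_1 power_one)
    then show ?thesis using rep g H.Lt_unit_vector[OF H.one_closed H.one_closed]
      by (simp add: mult.assoc[symmetric])
  qed
  then have "\<phi> ?S ?e = (\<lambda>t. of_nat (card F) * ?e t)"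
    by (simp add: phi_translation_sum[OF F(1) FG])
  then have "real (card F) = lp_norm p (carrier H) (\<phi> ?S ?e)"
    using lp_scale(2)[OF G.p e(1), of "of_nat (card F)"] e(2) by simp
  also have "\<dots> \<le> op_norm p (carrier H) (\<phi> ?S)"
    using op_norm_bound[OF G.p H.pseudofunctions_bounded[OF phi_mem[OF S]] e(1)] e(2) by simp
  also have "\<dots> \<le> op_norm p (carrier G) ?S" by (rule phi_norm[OF S])
  finally show ?thesis .
qed

text \<open>
  Pick a unit vector on which the sum over the finite set almost attains its norm, the number of
  summands. All summands of \<open>?S \<xi>\<close> have norm \<open>1\<close>, so any two of them already have a sum of
  norm close to \<open>2\<close>. One of the two is taken to be the summand of the identity, which is therefore
  added to the finite set.
\<close>

lemma kernel_almost_invariant_vector: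
  assumes F: "finite F" "F \<subseteq> kernel G H \<theta>" and \<epsilon>: "0 < \<epsilon>" "\<epsilon> \<le> 1"
  obtains \<xi> where "\<xi> \<in> lp p (carrier G)" "lp_norm p (carrier G) \<xi> = 1"
    "\<forall>g\<in>F. 2 - \<epsilon> \<le> lp_norm p (carrier G) (\<lambda>t. \<xi> t + cnj (\<gamma> g) * Lt p G g \<xi> t)"
proof -
  let ?N = "lp_norm p (carrier G)"
  \<comment> \<open>The identity is added so that its summand is \<open>\<xi>\<close> itself.\<close>
  define E where "E = insert \<one>\<^bsub>G\<^esub> F"
  have E: "finite E" "E \<subseteq> kernel G H \<theta>" "\<one>\<^bsub>G\<^esub> \<in> E"
    using F by (auto simp: E_def kernel_def)
  have EG: "E \<subseteq> carrier G" using E kernel_subset by blast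
  define n where "n = real (card E)"
  have n1: "1 \<le> n" using E card_gt_0_iff[of E] by (auto simp: n_def Suc_le_eq)
  define c where "c = (\<lambda>g. cnj (\<gamma> g))"
  let ?S = "translation_sum p G E c"
  have \<gamma>1: "\<gamma> \<one>\<^bsub>G\<^esub> = 1"
  proof -
    have "\<gamma> \<one>\<^bsub>G\<^esub> \<noteq> 0" using gamma_norm[OF G.one_closed] by force
    then show ?thesis using gamma_mult[OF G.one_closed G.one_closed] by simp
  qed
  have "\<exists>\<zeta>\<in>lp p (carrier G). (n - \<epsilon>) * ?N \<zeta> < ?N (?S \<zeta>)"
  proof (rule ccontr)
    assume "\<not> ?thesis"
    then have "op_norm p (carrier G) ?S \<le> n - \<epsilon>"
      using n1 \<epsilon> by (intro op_norm_le) (auto simp: not_less)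
    then show False using kernel_average_norm[OF E(1,2)] \<epsilon> by (simp add: n_def c_def)
  qed
  then obtain \<zeta> where \<zeta>: "\<zeta> \<in> lp p (carrier G)" "(n - \<epsilon>) * ?N \<zeta> < ?N (?S \<zeta>)" by blast
  note bS = G.translation_sum_bounded[OF E(1) EG, of c]
  have "?N \<zeta> \<noteq> 0"
    using \<zeta>(2) op_norm_bound[OF G.p bS \<zeta>(1)] by auto
  then have N\<zeta>: "0 < ?N \<zeta>" using lp_norm_nonneg[of p "carrier G" \<zeta>] by simp
  define a where "a = complex_of_real (1 / ?N \<zeta>)"
  have ca: "cmod a = 1 / ?N \<zeta>" using N\<zeta> by (simp add: a_def norm_divide)
  define \<xi> where "\<xi> = (\<lambda>t. a * \<zeta> t)"
  have \<xi>: "\<xi> \<in> lp p (carrier G)" "?N \<xi> = 1"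
    unfolding \<xi>_def using lp_scale[OF G.p \<zeta>(1), of a] N\<zeta> ca by auto
  have S\<xi>: "n - \<epsilon> < ?N (?S \<xi>)"
    unfolding \<xi>_def bounded_scale[OF bS \<zeta>(1)] lp_scale(2)[OF G.p bounded_lp[OF bS \<zeta>(1)]] ca
    using \<zeta>(2) N\<zeta> by (simp add: field_simps)
  show ?thesis
  proof (rule that[OF \<xi>], rule ballI)
    fix g assume g: "g \<in> F"
    then have gE: "g \<in> E" and gG: "g \<in> carrier G" using F kernel_subset by (auto simp: E_def)
    have one: "Lt p G \<one>\<^bsub>G\<^esub> \<xi> = \<xi>" using \<xi> by (simp add: G.Lt_one id_operator_def)
    let ?\<eta> = "\<lambda>t. \<xi> t + cnj (\<gamma> g) * Lt p G g \<xi> t"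
    show "2 - \<epsilon> \<le> ?N ?\<eta>"
    proof (cases "g = \<one>\<^bsub>G\<^esub>")
      case True
      then have "?\<eta> = (\<lambda>t. 2 * \<xi> t)" using one \<gamma>1 by (simp add: fun_eq_iff)
      then show ?thesis using lp_scale(2)[OF G.p \<xi>(1), of 2] \<xi>(2) \<epsilon> by simp
    next
      case False
      define R where "R = E - {\<one>\<^bsub>G\<^esub>, g}"
      have R: "finite R" "R \<subseteq> carrier G" using E EG by (auto simp: R_def)
      have cE: "card E = card R + 2"
      proof -
        have "E = insert \<one>\<^bsub>G\<^esub> (insert g R)" using E(3) gE by (auto simp: R_def)
        then have "card E = card (insert \<one>\<^bsub>G\<^esub> (insert g R))" by simp
        also have "\<dots> = card R + 2" using R(1) False by (simp add: R_def)
        finally show ?thesis .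
      qed
      have "?S \<xi> t = ?\<eta> t + translation_sum p G R c \<xi> t" for t
      proof -
        have "?S \<xi> t = c \<one>\<^bsub>G\<^esub> * Lt p G \<one>\<^bsub>G\<^esub> \<xi> t + (\<Sum>g\<in>E - {\<one>\<^bsub>G\<^esub>}. c g * Lt p G g \<xi> t)"
          unfolding translation_sum_def by (rule sum.remove[OF E(1,3)])
        also have "(\<Sum>g\<in>E - {\<one>\<^bsub>G\<^esub>}. c g * Lt p G g \<xi> t) = c g * Lt p G g \<xi> t
            + (\<Sum>g\<in>E - {\<one>\<^bsub>G\<^esub>} - {g}. c g * Lt p G g \<xi> t)"
          using E(1) gE False by (intro sum.remove) auto
        also have "E - {\<one>\<^bsub>G\<^esub>} - {g} = R" by (auto simp: R_def)
        finally show ?thesis using one \<gamma>1 by (simp add: c_def translation_sum_def)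
      qed
      then have "?S \<xi> = (\<lambda>t. ?\<eta> t + translation_sum p G R c \<xi> t)" by blast
      moreover have "?\<eta> \<in> lp p (carrier G)"
        by (rule lp_add(1)[OF G.p \<xi>(1) lp_scale(1)[OF G.p G.Lt_lp(1)[OF gG \<xi>(1)]]])
      ultimately have "?N (?S \<xi>) \<le> ?N ?\<eta> + ?N (translation_sum p G R c \<xi>)"
        using lp_add(2)[OF G.p _ bounded_lp[OF G.translation_sum_bounded[OF R, of c] \<xi>(1)], of ?\<eta>] by simp
      moreover have "?N (translation_sum p G R c \<xi>) \<le> (\<Sum>g\<in>R. cmod (c g))"
        using G.translation_sum_norm[OF R \<xi>(1), of c] \<xi>(2) by simp
      moreover have "(\<Sum>g\<in>R. cmod (c g)) = real (card R)"
        using R by (simp add: c_def subset_iff)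
      ultimately show ?thesis using S\<xi> cE by (simp add: n_def)
    qed
  qed
qed

text \<open>
  Let \<open>\<eta> = \<bar>\<xi>\<bar>\<^sup>p\<close> for an almost invariant vector \<open>\<xi>\<close>. Passing to absolute values only increases the
  norm of \<open>\<xi> + \<gamma>\<^sup>* Lt \<xi>\<close>, so the midpoint of \<open>\<bar>\<xi>\<bar>\<close> and its translate still has norm close to \<open>1\<close>.
  The total midpoint defect is then small and bounds the sum of \<open>\<bar>\<eta> (inv g t) - \<eta> t\<bar>\<close>.
  Strict convexity of \<open>x powr p\<close>, hence \<open>p > 1\<close>, is used here.
\<close>

lemma kernel_Reiter:
  assumes p1: "1 < p" and F: "finite F" "F \<subseteq> kernel G H \<theta>" and \<epsilon>: "0 < \<epsilon>"
  obtains \<eta> :: "'a \<Rightarrow> real" where "\<And>t. 0 \<le> \<eta> t" "(\<eta> has_sum 1) (carrier G)"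
    "\<And>g. g \<in> F \<Longrightarrow> (\<Sum>\<^sub>\<infinity>t\<in>carrier G. \<bar>\<eta> (inv\<^bsub>G\<^esub> g \<otimes>\<^bsub>G\<^esub> t) - \<eta> t\<bar>) \<le> \<epsilon>"
proof -
  let ?N = "lp_norm p (carrier G)"
  obtain C where C: "0 \<le> C" "\<And>a b. 0 \<le> a \<Longrightarrow> 0 \<le> b \<Longrightarrow> \<bar>a powr p - b powr p\<bar>
      \<le> \<epsilon> / 4 * (a powr p + b powr p) + C * ((a powr p + b powr p) / 2 - ((a + b) / 2) powr p)"
    using powr_diff_le_midpoint_defect[OF p1, of "\<epsilon> / 4"] \<epsilon> by auto
  \<comment> \<open>With this choice the loss in Bernoulli's inequality, multiplied by \<open>C\<close>, is at most \<open>\<epsilon> / 2\<close>.\<close>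
  define \<delta> where "\<delta> = min 1 (\<epsilon> / (C * p + 1))"
  have Cp: "0 < C * p + 1" using C(1) p1 by (simp add: add_nonneg_pos)
  have \<delta>: "0 < \<delta>" "\<delta> \<le> 1" using \<epsilon> Cp by (auto simp: \<delta>_def)
  have \<delta>C: "C * (p * \<delta>) \<le> \<epsilon>"
  proof -
    have "\<delta> \<le> \<epsilon> / (C * p + 1)" by (simp add: \<delta>_def)
    then have "(C * p + 1) * \<delta> \<le> \<epsilon>" using Cp by (simp add: field_simps)
    then show ?thesis using \<delta>(1) by (simp add: algebra_simps)
  qed
  obtain \<xi> where \<xi>: "\<xi> \<in> lp p (carrier G)" "?N \<xi> = 1"
    and almost: "\<forall>g\<in>F. 2 - \<delta> \<le> ?N (\<lambda>t. \<xi> t + cnj (\<gamma> g) * Lt p G g \<xi> t)"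
    by (rule kernel_almost_invariant_vector[OF F \<delta>])
  define \<eta> where "\<eta> t = cmod (\<xi> t) powr p" for t
  have \<eta>_sum: "(\<eta> has_sum 1) (carrier G)"
    unfolding \<eta>_def using has_sum_infsum[OF lp_summable[OF \<xi>(1)]] lp_norm_powr[OF G.p, of "carrier G" \<xi>] \<xi>(2)
    by simp
  show ?thesis
  proof (rule that[of \<eta>])
    show "0 \<le> \<eta> t" for t by (simp add: \<eta>_def)
    show "(\<eta> has_sum 1) (carrier G)" by (rule \<eta>_sum)
    fix g assume g: "g \<in> F"
    then have gG: "g \<in> carrier G" using F kernel_subset by blast
    define a b where "a t = cmod (\<xi> t)" and "b t = cmod (\<xi> (inv\<^bsub>G\<^esub> g \<otimes>\<^bsub>G\<^esub> t))" for t
    define \<zeta> where "\<zeta> t = complex_of_real (cmod (\<xi> t)) + complex_of_real (cmod (Lt p G g \<xi> t))" for t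
    have abs_lp: "(\<lambda>t. complex_of_real (cmod (\<xi>' t))) \<in> lp p (carrier G)" if "\<xi>' \<in> lp p (carrier G)" for \<xi>'
      by (rule lp_dominated(1)[OF G.p that]) (auto simp: lp_zero_off[OF that])
    have \<zeta>: "\<zeta> \<in> lp p (carrier G)"
      unfolding \<zeta>_def by (rule lp_add(1)[OF G.p abs_lp[OF \<xi>(1)] abs_lp[OF G.Lt_lp(1)[OF gG \<xi>(1)]]])
    have \<zeta>ab: "cmod (\<zeta> t) = a t + b t" if "t \<in> carrier G" for t
    proof -
      have "\<zeta> t = complex_of_real (a t + b t)"
        using that \<xi>(1) by (simp add: \<zeta>_def a_def b_def G.Lt_apply)
      moreover have "0 \<le> a t + b t" by (simp add: a_def b_def)
      ultimately show ?thesis by (simp only: norm_of_real abs_of_nonneg)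
    qed
    have "2 - \<delta> \<le> ?N \<zeta>"
    proof (rule order_trans[OF bspec[OF almost g] lp_dominated(2)[OF G.p \<zeta>]])
      fix t
      show "t \<notin> carrier G \<Longrightarrow> \<xi> t + cnj (\<gamma> g) * Lt p G g \<xi> t = 0"
        by (simp add: lp_zero_off[OF \<xi>(1)] G.Lt_off)
      assume t: "t \<in> carrier G"
      have "cmod (\<xi> t + cnj (\<gamma> g) * Lt p G g \<xi> t) \<le> cmod (\<xi> t) + cmod (cnj (\<gamma> g) * Lt p G g \<xi> t)"
        by (rule norm_triangle_ineq)
      also have "\<dots> = cmod (\<zeta> t)"
        using t gG \<xi>(1) by (simp add: \<zeta>ab a_def b_def norm_mult G.Lt_apply)
      finally show "cmod (\<xi> t + cnj (\<gamma> g) * Lt p G g \<xi> t) \<le> cmod (\<zeta> t)" .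
    qed
    then have half: "1 - \<delta> / 2 \<le> ?N \<zeta> / 2" by simp
    define m where "m t = ((a t + b t) / 2) powr p" for t
    define M where "M = (?N \<zeta> / 2) powr p"
    have "((\<lambda>t. cmod (\<zeta> t) powr p / 2 powr p) has_sum (?N \<zeta> powr p / 2 powr p)) (carrier G)"
      unfolding lp_norm_powr[OF G.p] by (rule has_sum_divide_const[OF has_sum_infsum[OF lp_summable[OF \<zeta>]]])
    then have m_sum: "(m has_sum M) (carrier G)"
      unfolding M_def m_def
      by (subst has_sum_cong[where g = "\<lambda>t. cmod (\<zeta> t) powr p / 2 powr p"])
         (auto simp: \<zeta>ab powr_divide a_def b_def lp_norm_nonneg)
    have M: "1 - p * \<delta> / 2 \<le> M"
    proof -
      have "1 + p * ((1 - \<delta> / 2) - 1) < (1 - \<delta> / 2) powr p"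
        using \<delta> by (intro Bernoulli_powr_strict[OF p1]) auto
      also have "\<dots> \<le> M" unfolding M_def using half \<delta> p1 by (intro powr_mono2) auto
      finally show ?thesis by simp
    qed
    have \<eta>g_sum: "((\<lambda>t. \<eta> (inv\<^bsub>G\<^esub> g \<otimes>\<^bsub>G\<^esub> t)) has_sum 1) (carrier G)"
      using has_sum_reindex_bij_betw[OF G.left_mult_bij[OF gG], of \<eta> 1] \<eta>_sum by simp
    define D where "D t = \<epsilon> / 4 * (\<eta> t + \<eta> (inv\<^bsub>G\<^esub> g \<otimes>\<^bsub>G\<^esub> t))
      + C * ((\<eta> t + \<eta> (inv\<^bsub>G\<^esub> g \<otimes>\<^bsub>G\<^esub> t)) / 2 + - m t)" for t
    have D_sum: "(D has_sum (\<epsilon> / 4 * (1 + 1) + C * ((1 + 1) / 2 + - M))) (carrier G)"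
      unfolding D_def
      by (intro has_sum_add has_sum_cmult_right has_sum_divide_const has_sum_uminusI \<eta>_sum \<eta>g_sum m_sum)
    have le: "\<bar>\<eta> (inv\<^bsub>G\<^esub> g \<otimes>\<^bsub>G\<^esub> t) - \<eta> t\<bar> \<le> D t" for t
      using C(2)[of "a t" "b t"] by (simp add: D_def \<eta>_def m_def a_def b_def abs_minus_commute)
    have "(\<Sum>\<^sub>\<infinity>t\<in>carrier G. \<bar>\<eta> (inv\<^bsub>G\<^esub> g \<otimes>\<^bsub>G\<^esub> t) - \<eta> t\<bar>) \<le> \<epsilon> / 4 * (1 + 1) + C * ((1 + 1) / 2 + - M)"
    proof -
      have "(\<lambda>t. \<bar>\<eta> (inv\<^bsub>G\<^esub> g \<otimes>\<^bsub>G\<^esub> t) - \<eta> t\<bar>) summable_on carrier G"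
        by (rule summable_on_comparison_test[OF has_sum_imp_summable[OF D_sum] le]) simp
      from has_sum_mono[OF has_sum_infsum[OF this] D_sum le] show ?thesis .
    qed
    also have "\<dots> \<le> \<epsilon> / 2 + C * (p * \<delta> / 2)"
      using M C(1) by (intro add_mono mult_left_mono) auto
    also have "\<dots> \<le> \<epsilon>" using \<delta>C by simp
    finally show "(\<Sum>\<^sub>\<infinity>t\<in>carrier G. \<bar>\<eta> (inv\<^bsub>G\<^esub> g \<otimes>\<^bsub>G\<^esub> t) - \<eta> t\<bar>) \<le> \<epsilon>" .
  qed
qed

lemma kernel_amenable:
  assumes "1 < p"
  shows "amenable (G\<lparr>carrier := kernel G H \<theta>\<rparr>)"
proof (rule G.amenable_subgroup_if_almost_invariant[OF \<theta>.subgroup_kernel])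
  fix F and \<epsilon> :: real assume "finite F" "F \<subseteq> kernel G H \<theta>" "0 < \<epsilon>"
  then obtain \<eta> :: "'a \<Rightarrow> real" where "\<And>t. 0 \<le> \<eta> t" "(\<eta> has_sum 1) (carrier G)"
    "\<And>g. g \<in> F \<Longrightarrow> (\<Sum>\<^sub>\<infinity>t\<in>carrier G. \<bar>\<eta> (inv\<^bsub>G\<^esub> g \<otimes>\<^bsub>G\<^esub> t) - \<eta> t\<bar>) \<le> \<epsilon>"
    using kernel_Reiter[OF assms] by metis
  then show "\<exists>\<eta>. (\<forall>t. 0 \<le> \<eta> t) \<and> (\<eta> has_sum 1) (carrier G) \<and>
      (\<forall>g\<in>F. (\<Sum>\<^sub>\<infinity>t\<in>carrier G. \<bar>\<eta> (inv\<^bsub>G\<^esub> g \<otimes>\<^bsub>G\<^esub> t) - \<eta> t\<bar>) \<le> \<epsilon>)" by blast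
qed

end

section \<open>Isometric isomorphisms\<close>

text \<open>
  The symmetric presentation by two mutually inverse homomorphisms lets every statement about
  \<open>transport\<close> be used in both directions through \<open>flip\<close>.
\<close>

locale lp_group_iso = G: lp_group G p + H: lp_group H p
  for G :: "('a, 'm) monoid_scheme" and H :: "('b, 'n) monoid_scheme" and p :: real +
  fixes \<theta> :: "'a \<Rightarrow> 'b" and \<theta>' :: "'b \<Rightarrow> 'a"
  assumes \<theta>: "\<theta> \<in> hom G H" and \<theta>': "\<theta>' \<in> hom H G"
    and inverse: "\<And>g. g \<in> carrier G \<Longrightarrow> \<theta>' (\<theta> g) = g" "\<And>h. h \<in> carrier H \<Longrightarrow> \<theta> (\<theta>' h) = h"
begin

lemma flip: "lp_group_iso H G p \<theta>' \<theta>"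
  by unfold_locales (auto simp: \<theta> \<theta>' inverse)

sublocale \<theta>: group_hom G H \<theta> using \<theta> by unfold_locales
sublocale \<theta>': group_hom H G \<theta>' using \<theta>' by unfold_locales

definition push :: "('a \<Rightarrow> complex) \<Rightarrow> 'b \<Rightarrow> complex" where
  "push \<xi> = (\<lambda>h. if h \<in> carrier H then \<xi> (\<theta>' h) else 0)"

definition pull :: "('b \<Rightarrow> complex) \<Rightarrow> 'a \<Rightarrow> complex" where
  "pull \<eta> = (\<lambda>g. if g \<in> carrier G then \<eta> (\<theta> g) else 0)"

definition transport :: "'a lp_operator \<Rightarrow> 'b lp_operator" where
  "transport S = (\<lambda>\<eta>. if \<eta> \<in> lp p (carrier H) then push (S (pull \<eta>)) else (\<lambda>h. 0))"

lemma bij: "bij_betw \<theta> (carrier G) (carrier H)" "bij_betw \<theta>' (carrier H) (carrier G)"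
  by (auto intro!: bij_betwI[where g = \<theta>'] bij_betwI[where g = \<theta>] simp: inverse)

lemma push: "\<xi> \<in> lp p (carrier G) \<Longrightarrow> push \<xi> \<in> lp p (carrier H)"
    "lp_norm p (carrier H) (push \<xi>) = lp_norm p (carrier G) \<xi>"
  unfolding push_def by (rule lp_relabel[OF bij(2)], assumption) (rule lp_norm_relabel[OF bij(2)])

lemma pull: "\<eta> \<in> lp p (carrier H) \<Longrightarrow> pull \<eta> \<in> lp p (carrier G)"
    "lp_norm p (carrier G) (pull \<eta>) = lp_norm p (carrier H) \<eta>"
  unfolding pull_def by (rule lp_relabel[OF bij(1)], assumption) (rule lp_norm_relabel[OF bij(1)])

lemma pull_push: "\<xi> \<in> lp p (carrier G) \<Longrightarrow> pull (push \<xi>) = \<xi>"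
  by (auto simp: pull_def push_def inverse fun_eq_iff lp_zero_off)

lemma push_linear: "push (\<lambda>t. \<xi> t + \<zeta> t) = (\<lambda>t. push \<xi> t + push \<zeta> t)"
    "push (\<lambda>t. \<xi> t - \<zeta> t) = (\<lambda>t. push \<xi> t - push \<zeta> t)" "push (\<lambda>t. c * \<xi> t) = (\<lambda>t. c * push \<xi> t)"
  by (auto simp: push_def fun_eq_iff)

lemma pull_linear: "pull (\<lambda>t. \<xi> t + \<zeta> t) = (\<lambda>t. pull \<xi> t + pull \<zeta> t)"
    "pull (\<lambda>t. c * \<xi> t) = (\<lambda>t. c * pull \<xi> t)"
  by (auto simp: pull_def fun_eq_iff)

lemma transport_norm_le:
  assumes S: "S \<in> bounded_operators p (carrier G)" and \<eta>: "\<eta> \<in> lp p (carrier H)"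
  shows "lp_norm p (carrier H) (transport S \<eta>) \<le> op_norm p (carrier G) S * lp_norm p (carrier H) \<eta>"
  using op_norm_bound[OF G.p S pull(1)[OF \<eta>]] \<eta> by (simp add: transport_def push pull)

lemma transport_bounded:
  assumes S: "S \<in> bounded_operators p (carrier G)"
  shows "transport S \<in> bounded_operators p (carrier H)"
proof (rule bounded_operatorsI[where C = "op_norm p (carrier G) S"])
  fix \<xi> \<eta> and c :: complex assume \<xi>: "\<xi> \<in> lp p (carrier H)"
  show "transport S \<xi> \<in> lp p (carrier H)"
    using push(1)[OF bounded_lp[OF S pull(1)[OF \<xi>]]] \<xi> by (simp add: transport_def)
  show "transport S (\<lambda>t. c * \<xi> t) = (\<lambda>t. c * transport S \<xi> t)"
    using \<xi> lp_scale(1)[OF G.p \<xi>] bounded_scale[OF S pull(1)[OF \<xi>]]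
    by (simp add: transport_def push_linear pull_linear)
  assume \<eta>: "\<eta> \<in> lp p (carrier H)"
  show "transport S (\<lambda>t. \<xi> t + \<eta> t) = (\<lambda>t. transport S \<xi> t + transport S \<eta> t)"
    using \<xi> \<eta> lp_add(1)[OF G.p \<xi> \<eta>] bounded_add[OF S pull(1)[OF \<xi>] pull(1)[OF \<eta>]]
    by (simp add: transport_def push_linear pull_linear)
qed (simp_all add: transport_norm_le[OF S], simp add: transport_def)

lemma transport_op_norm_le:
  "S \<in> bounded_operators p (carrier G) \<Longrightarrow> op_norm p (carrier H) (transport S) \<le> op_norm p (carrier G) S"
  by (rule op_norm_le[OF op_norm_nonneg transport_norm_le])

lemma transport_translation_sum:
  assumes F: "finite F" "F \<subseteq> carrier G" and \<eta>: "\<eta> \<in> lp p (carrier H)"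
  shows "push (translation_sum p G F c (pull \<eta>)) = translation_sum p H (\<theta> ` F) (\<lambda>h. c (\<theta>' h)) \<eta>"
proof
  fix s
  have inj: "inj_on \<theta> F" using bij(1) F(2) by (meson bij_betw_def inj_on_subset)
  have "translation_sum p H (\<theta> ` F) (\<lambda>h. c (\<theta>' h)) \<eta> s = (\<Sum>g\<in>F. c (\<theta>' (\<theta> g)) * Lt p H (\<theta> g) \<eta> s)"
    unfolding translation_sum_def by (rule sum.reindex_cong[OF inj refl refl])
  also have "\<dots> = push (translation_sum p G F c (pull \<eta>)) s"
  proof (cases "s \<in> carrier H")
    case s: True
    have "c (\<theta>' (\<theta> g)) * Lt p H (\<theta> g) \<eta> s = c g * Lt p G g (pull \<eta>) (\<theta>' s)" if "g \<in> F" for g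
    proof -
      have g: "g \<in> carrier G" using that F by auto
      have "\<theta> (inv\<^bsub>G\<^esub> g \<otimes>\<^bsub>G\<^esub> \<theta>' s) = inv\<^bsub>H\<^esub> (\<theta> g) \<otimes>\<^bsub>H\<^esub> s" using g s by (simp add: inverse)
      then show ?thesis
        using g s \<eta> pull(1)[OF \<eta>] by (simp add: H.Lt_apply G.Lt_apply inverse) (simp add: pull_def inverse)
    qed
    then show ?thesis using s by (simp add: push_def translation_sum_def)
  qed (simp add: push_def H.Lt_off)
  finally show "push (translation_sum p G F c (pull \<eta>)) s = translation_sum p H (\<theta> ` F) (\<lambda>h. c (\<theta>' h)) \<eta> s" ..
qed

lemma transport_pseudofunction:
  assumes S: "S \<in> pseudofunctions p G"
  shows "transport S \<in> pseudofunctions p H"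
proof (rule H.pseudofunctionsI[OF transport_bounded[OF G.pseudofunctions_bounded[OF S]]])
  fix \<epsilon> :: real assume "0 < \<epsilon>"
  then obtain F c where F: "finite F" "F \<subseteq> carrier G" and
    approx: "\<And>\<xi>. \<xi> \<in> lp p (carrier G) \<Longrightarrow>
       lp_norm p (carrier G) (\<lambda>t. S \<xi> t - translation_sum p G F c \<xi> t) \<le> \<epsilon> * lp_norm p (carrier G) \<xi>"
    using G.pseudofunctions_approx[OF S] by blast
  have "lp_norm p (carrier H) (\<lambda>t. transport S \<eta> t - translation_sum p H (\<theta> ` F) (\<lambda>h. c (\<theta>' h)) \<eta> t)
      \<le> \<epsilon> * lp_norm p (carrier H) \<eta>" if \<eta>: "\<eta> \<in> lp p (carrier H)" for \<eta>
  proof -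
    have "(\<lambda>t. transport S \<eta> t - translation_sum p H (\<theta> ` F) (\<lambda>h. c (\<theta>' h)) \<eta> t)
        = push (\<lambda>t. S (pull \<eta>) t - translation_sum p G F c (pull \<eta>) t)"
      using \<eta> transport_translation_sum[OF F \<eta>, of c] by (simp add: transport_def push_linear)
    then show ?thesis using approx[OF pull(1)[OF \<eta>]] by (simp add: push pull)
  qed
  then show "\<exists>F c. finite F \<and> F \<subseteq> carrier H \<and> (\<forall>\<xi>\<in>lp p (carrier H).
      lp_norm p (carrier H) (\<lambda>t. transport S \<xi> t - translation_sum p H F c \<xi> t) \<le> \<epsilon> * lp_norm p (carrier H) \<xi>)"
    using F by (intro exI[of _ "\<theta> ` F"] exI[of _ "\<lambda>h. c (\<theta>' h)"]) auto
qed

lemma transport_flip: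
  assumes S: "S \<in> bounded_operators p (carrier G)"
  shows "lp_group_iso.transport H G p \<theta>' \<theta> (transport S) = S"
proof -
  interpret inv: lp_group_iso H G p \<theta>' \<theta> by (rule flip)
  have eqs: "inv.push = pull" "inv.pull = push"
    by (simp_all add: inv.push_def pull_def inv.pull_def push_def fun_eq_iff)
  show ?thesis
  proof
    fix \<xi>
    show "inv.transport (transport S) \<xi> = S \<xi>"
    proof (cases "\<xi> \<in> lp p (carrier G)")
      case True
      then show ?thesis
        by (simp add: inv.transport_def eqs transport_def push pull_push bounded_lp[OF S])
    next
      case False
      then show ?thesis by (simp add: inv.transport_def bounded_off[OF S])
    qed
  qed
qed

lemma transport_isometric_iso: "pf_isometric_iso p G H transport"
proof -
  interpret inv: lp_group_iso H G p \<theta>' \<theta> by (rule flip)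
  note b = G.pseudofunctions_bounded
  have "pf_hom p G H transport"
    unfolding pf_hom_def
  proof (intro conjI ballI allI)
    fix S T and c :: complex assume S: "S \<in> pseudofunctions p G"
    show "transport S \<in> pseudofunctions p H" by (rule transport_pseudofunction[OF S])
    show "transport (\<lambda>\<xi> t. c * S \<xi> t) = (\<lambda>\<xi> t. c * transport S \<xi> t)"
      by (simp add: transport_def push_linear fun_eq_iff)
    assume T: "T \<in> pseudofunctions p G"
    show "transport (\<lambda>\<xi> t. S \<xi> t + T \<xi> t) = (\<lambda>\<xi> t. transport S \<xi> t + transport T \<xi> t)"
      by (simp add: transport_def push_linear fun_eq_iff)
    show "transport (S \<circ> T) = transport S \<circ> transport T"
    proof
      fix \<eta>
      show "transport (S \<circ> T) \<eta> = (transport S \<circ> transport T) \<eta>"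
      proof (cases "\<eta> \<in> lp p (carrier H)")
        case True
        then show ?thesis
          using bounded_lp[OF b[OF T] pull(1)[OF True]] by (simp add: transport_def push pull_push)
      next
        case False
        then show ?thesis
          using bounded_scale[OF transport_bounded[OF b[OF S]] lp_zero, of 0] by (simp add: transport_def)
      qed
    qed
  qed
  moreover have "pf_isometric p G H transport"
    unfolding pf_isometric_def
  proof
    fix S assume S: "S \<in> pseudofunctions p G"
    show "op_norm p (carrier H) (transport S) = op_norm p (carrier G) S"
      using transport_op_norm_le[OF b[OF S]] inv.transport_op_norm_le[OF transport_bounded[OF b[OF S]]]
      by (simp add: transport_flip[OF b[OF S]])
  qed
  moreover have "bij_betw transport (pseudofunctions p G) (pseudofunctions p H)"
    by (rule bij_betwI[where g = inv.transport])
       (auto simp: transport_pseudofunction inv.transport_pseudofunction transport_flip[OF b]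
          inv.transport_flip[OF H.pseudofunctions_bounded])
  ultimately show ?thesis by (simp add: pf_isometric_iso_def)
qed

end

text \<open>
  The identity operator is \<open>\<phi> S\<close> for some \<open>S\<close>, and \<open>\<phi> S = \<phi> S \<circ> \<phi> 1\<close>.
\<close>

lemma pf_isometric_iso_unital:
  assumes "lp_group G p" and "lp_group H p" and iso: "pf_isometric_iso p G H \<phi>"
  shows "pf_unital p G H \<phi>"
proof -
  interpret G: lp_group G p by fact
  interpret H: lp_group H p by fact
  have hom: "pf_hom p G H \<phi>" and bij: "bij_betw \<phi> (pseudofunctions p G) (pseudofunctions p H)"
    using iso by (auto simp: pf_isometric_iso_def)
  obtain S where S: "S \<in> pseudofunctions p G" "\<phi> S = id_operator p (carrier H)"
    using bij H.id_pseudofunction unfolding bij_betw_def by (metis imageE)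
  note bS = G.pseudofunctions_bounded[OF S(1)]
  let ?e = "\<phi> (id_operator p (carrier G))"
  have "?e \<in> pseudofunctions p H" using hom G.id_pseudofunction by (simp add: pf_hom_def)
  note be = H.pseudofunctions_bounded[OF this]
  have "S \<circ> id_operator p (carrier G) = S"
    using bounded_scale[OF bS lp_zero, of 0] by (auto simp: id_operator_def fun_eq_iff bounded_off[OF bS])
  then have "id_operator p (carrier H) = id_operator p (carrier H) \<circ> ?e"
    using hom S G.id_pseudofunction unfolding pf_hom_def by metis
  also have "\<dots> = ?e"
    using bounded_lp[OF be] bounded_off[OF be] lp_zero by (fastforce simp: id_operator_def fun_eq_iff)
  finally show ?thesis by (simp add: pf_unital_def)
qed

text \<open>
  The matrix coefficient of \<open>\<phi> S\<close> at the unit vector of the identity and a point \<open>h\<close> outside the image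
  of \<open>\<theta>\<close> vanishes for translations, hence for every \<open>S\<close>; but it equals \<open>1\<close> for the translation
  by \<open>h\<close>.
\<close>

lemma (in pf_representation) surjective_imp_theta_surjective:
  assumes surj: "\<phi> ` pseudofunctions p G = pseudofunctions p H"
  shows "\<theta> ` carrier G = carrier H"
proof
  show "\<theta> ` carrier G \<subseteq> carrier H" by auto
  show "carrier H \<subseteq> \<theta> ` carrier G"
  proof (rule ccontr)
    assume "\<not> ?thesis"
    then obtain h where h: "h \<in> carrier H" "h \<notin> \<theta> ` carrier G" by blast
    obtain S where S: "S \<in> pseudofunctions p G" "\<phi> S = Lt p H h"
      using surj H.Lt_pseudofunction[OF h(1)] by (metis imageE)
    note e = unit_vector_lp[OF H.one_closed, of p]
    have "\<phi> S (unit_vector \<one>\<^bsub>H\<^esub>) h = 0"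
    proof (rule G.vanishing_functional[where C = 1 and A = "\<lambda>S. \<phi> S (unit_vector \<one>\<^bsub>H\<^esub>) h", OF _ _ _ _ S(1)])
      fix T assume T: "T \<in> pseudofunctions p G"
      note b = H.pseudofunctions_bounded[OF phi_mem[OF T]]
      show "cmod (\<phi> T (unit_vector \<one>\<^bsub>H\<^esub>) h) \<le> 1 * op_norm p (carrier G) T"
        using cmod_le_lp_norm[OF G.p bounded_lp[OF b e(1)], of h] op_norm_bound[OF G.p b e(1)] e(2) phi_norm[OF T]
        by simp
    next
      fix g assume g: "g \<in> carrier G"
      then have "\<theta> g \<noteq> h" using h by auto
      then show "\<phi> (Lt p G g) (unit_vector \<one>\<^bsub>H\<^esub>) h = 0"
        using rep g by (simp add: H.Lt_unit_vector) (simp add: unit_vector_def)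
    qed (simp_all add: phi_add phi_scale)
    then show False using S(2) h(1) by (simp add: H.Lt_unit_vector) (simp add: unit_vector_def)
  qed
qed

theorem theorem5p8:
  fixes G :: "('a, 'm) monoid_scheme" and H :: "('b, 'n) monoid_scheme" and p :: real
  assumes "group G" and "group H" and "1 \<le> p" and "p \<noteq> 2"
  shows "(\<forall>\<phi>. pf_hom p G H \<phi> \<and> pf_unital p G H \<phi> \<and> pf_contractive p G H \<phi> \<longrightarrow>
            (\<exists>\<theta> \<gamma>. \<theta> \<in> hom G H \<and> \<gamma> \<in> hom G circle_group \<and>
               (\<forall>g\<in>carrier G. \<phi> (Lt p G g) = (\<lambda>\<xi> t. \<gamma> g * Lt p H (\<theta> g) \<xi> t)) \<and>
               (p > 1 \<longrightarrow> amenable (G\<lparr>carrier := kernel G H \<theta>\<rparr>)) \<and>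
               (inj_on \<theta> (carrier G) \<longleftrightarrow> inj_on \<phi> (pseudofunctions p G)) \<and>
               (inj_on \<phi> (pseudofunctions p G) \<longleftrightarrow> pf_isometric p G H \<phi>))) \<and>
         ((\<exists>\<phi>. pf_isometric_iso p G H \<phi>) \<longleftrightarrow> G \<cong> H)"
proof -
  have lpG: "lp_group G p" and lpH: "lp_group H p"
    using assms by (simp_all add: lp_group_def lp_group_axioms_def)
  have rep: "\<exists>\<theta> \<gamma>. pf_representation G H p \<phi> \<theta> \<gamma>"
    if "pf_hom p G H \<phi>" "pf_unital p G H \<phi>" "pf_contractive p G H \<phi>" for \<phi>
  proof -
    interpret pf_contraction G H p \<phi>
      using lpG lpH assms(4) that by (simp add: pf_contraction_def pf_contraction_axioms_def)
    obtain \<theta> \<gamma> where "\<theta> \<in> hom G H" "\<gamma> \<in> hom G circle_group"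
      "\<forall>g\<in>carrier G. \<phi> (Lt p G g) = (\<lambda>\<xi> t. \<gamma> g * Lt p H (\<theta> g) \<xi> t)"
      by (rule induced_homs)
    then have "pf_representation G H p \<phi> \<theta> \<gamma>" by unfold_locales
    then show ?thesis by blast
  qed
  show ?thesis
  proof (intro conjI allI impI)
    fix \<phi> assume \<phi>: "pf_hom p G H \<phi> \<and> pf_unital p G H \<phi> \<and> pf_contractive p G H \<phi>"
    then obtain \<theta> \<gamma> where "pf_representation G H p \<phi> \<theta> \<gamma>" using rep by blast
    then interpret pf_representation G H p \<phi> \<theta> \<gamma> .
    show "\<exists>\<theta> \<gamma>. \<theta> \<in> hom G H \<and> \<gamma> \<in> hom G circle_group \<and>
               (\<forall>g\<in>carrier G. \<phi> (Lt p G g) = (\<lambda>\<xi> t. \<gamma> g * Lt p H (\<theta> g) \<xi> t)) \<and>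
               (p > 1 \<longrightarrow> amenable (G\<lparr>carrier := kernel G H \<theta>\<rparr>)) \<and>
               (inj_on \<theta> (carrier G) \<longleftrightarrow> inj_on \<phi> (pseudofunctions p G)) \<and>
               (inj_on \<phi> (pseudofunctions p G) \<longleftrightarrow> pf_isometric p G H \<phi>)"
      using \<theta> \<gamma> pf_representation_axioms kernel_amenable isometric_imp_injective injective_imp_theta_injective
        theta_injective_imp_isometric
      by (intro exI[of _ \<theta>] exI[of _ \<gamma>]) (use local.rep in blast)
  next
    show "(\<exists>\<phi>. pf_isometric_iso p G H \<phi>) \<longleftrightarrow> G \<cong> H"
    proof
      assume "\<exists>\<phi>. pf_isometric_iso p G H \<phi>"
      then obtain \<phi> where iso: "pf_isometric_iso p G H \<phi>" by blast
      then have \<phi>: "pf_hom p G H \<phi>" "pf_isometric p G H \<phi>"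
        and bij: "bij_betw \<phi> (pseudofunctions p G) (pseudofunctions p H)"
        by (auto simp: pf_isometric_iso_def)
      have "pf_contractive p G H \<phi>" using \<phi>(2) by (simp add: pf_isometric_def pf_contractive_def)
      then obtain \<theta> \<gamma> where "pf_representation G H p \<phi> \<theta> \<gamma>"
        using rep \<phi>(1) pf_isometric_iso_unital[OF lpG lpH iso] by blast
      then interpret pf_representation G H p \<phi> \<theta> \<gamma> .
      have "bij_betw \<theta> (carrier G) (carrier H)"
        using injective_imp_theta_injective surjective_imp_theta_surjective bij by (auto simp: bij_betw_def)
      then have "\<theta> \<in> iso G H" using \<theta> by (simp add: iso_def)
      then show "G \<cong> H" by (auto simp: is_iso_def)
    next
      assume "G \<cong> H"
      then obtain \<theta> where \<theta>: "\<theta> \<in> iso G H" by (auto simp: is_iso_def)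
      let ?\<theta>' = "inv_into (carrier G) \<theta>"
      have bij: "bij_betw \<theta> (carrier G) (carrier H)" using \<theta> by (simp add: iso_def)
      have "?\<theta>' \<in> hom H G" using group.iso_set_sym[OF assms(1) \<theta>] by (simp add: iso_def)
      then interpret lp_group_iso G H p \<theta> ?\<theta>'
        using \<theta> lpG lpH bij
        by (simp add: lp_group_iso_def lp_group_iso_axioms_def iso_def bij_betw_inv_into_left bij_betw_inv_into_right)
      show "\<exists>\<phi>. pf_isometric_iso p G H \<phi>" using transport_isometric_iso by blast
    qed
  qed
qed

end
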